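(* For every integer $n\geq 1$ there exists a constant $C>0$ (depending only on $n$) such that for all $h>0$ and all $\nu\in\{-1,1\}$ the following holds. If $\boldsymbol{u}\in C^1(\mathbb{R};L^2(h\mathbb{Z}))$ is a solution of the cubic discrete nonlinear Schrödinger equation $$\forall t\in\mathbb{R},\ \forall g\in h\mathbb{Z},\quad i\partial_t \boldsymbol{u}_g = (\Delta_h \boldsymbol{u})_g+\nu|\boldsymbol{u}_g|^2\boldsymbol{u}_g ,$$ then for all $t\in\mathbb{R}$ $$\|\boldsymbol{u}(t)\|_{\dot H^n(h\mathbb{Z})}\leq C\left[\|\boldsymbol{u}(0)\|_{\dot H^n(h\mathbb{Z})}+M_{\boldsymbol{u}(0)}^{\frac{2n+1}{3}}+|t|^{\frac{n-1}{2}}M_{\boldsymbol{u}(0)}^{\frac{4n-1}{3}}\right],$$ where $$M_{\boldsymbol{u}(0)}=\|\boldsymbol{u}(0)\|_{\dot H^1(h\mathbb{Z})}+\|\boldsymbol{u}(0)\|_{L^2(h\mathbb{Z})}^3 .$$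
   Context: For $h>0$, $L^2(h\mathbb{Z})$ is the space of sequences $\boldsymbol{u}\in\mathbb{C}^{h\mathbb{Z}}$ with $\|\boldsymbol{u}\|_{L^2(h\mathbb{Z})}^2=h\sum_{g\in h\mathbb{Z}}|\boldsymbol{u}_g|^2<\infty$, with the associated inner product $\langle \boldsymbol{u},\boldsymbol{v}\rangle_{L^2(h\mathbb{Z})}=h\sum_{g\in h\mathbb{Z}}\boldsymbol{u}_g\overline{\boldsymbol{v}_g}$. The discrete second derivative is $(\Delta_h\boldsymbol{u})_g=\frac{\boldsymbol{u}_{g+h}-2\boldsymbol{u}_g+\boldsymbol{u}_{g-h}}{h^2}$ for $g\in h\mathbb{Z}$. For $n\in\mathbb{N}$ and $\boldsymbol{u}\in L^2(h\mathbb{Z})$, the homogeneous discrete Sobolev norm of order $n$ is defined by $\|\boldsymbol{u}\|_{\dot H^n(h\mathbb{Z})}^2=\langle(-\Delta_h)^n\boldsymbol{u},\boldsymbol{u}\rangle_{L^2(h\mathbb{Z})}$. For $n=1$, $|t|^{\frac{n-1}{2}}$ is understood as $1$ for all $t$. *)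

theory Defs
  imports "HOL-Analysis.Analysis"
begin

text \<open>
  A sequence indexed by \<open>h\<int>\<close> is represented by a function \<open>real \<Rightarrow> complex\<close> of which only
  the values on the grid \<open>h\<int>\<close> are ever used: sums, norms and equations are all
  restricted to the grid, so the values off the grid are irrelevant.
\<close>

definition grid :: "real \<Rightarrow> real set" where
  "grid h = range (\<lambda>k::int. h * of_int k)"

definition L2 :: "real \<Rightarrow> (real \<Rightarrow> complex) set" where
  "L2 h = {u. (\<lambda>g. (cmod (u g))\<^sup>2) summable_on grid h}"

definition L2_norm :: "real \<Rightarrow> (real \<Rightarrow> complex) \<Rightarrow> real" where
  "L2_norm h u = sqrt (h * (\<Sum>\<^sub>\<infinity>g\<in>grid h. (cmod (u g))\<^sup>2))"

definition L2_inner :: "real \<Rightarrow> (real \<Rightarrow> complex) \<Rightarrow> (real \<Rightarrow> complex) \<Rightarrow> complex" where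
  "L2_inner h u v = complex_of_real h * (\<Sum>\<^sub>\<infinity>g\<in>grid h. u g * cnj (v g))"

definition discrete_laplacian :: "real \<Rightarrow> (real \<Rightarrow> complex) \<Rightarrow> (real \<Rightarrow> complex)" where
  "discrete_laplacian h u = (\<lambda>g. (u (g + h) - 2 * u g + u (g - h)) / (complex_of_real h)\<^sup>2)"

text \<open>
  The operator \<open>-\<Delta>\<^sub>h\<close> is bounded, self-adjoint and nonnegative on \<open>L\<^sup>2(h\<int>)\<close>, so the inner
  product below is a nonnegative real number; \<open>Re\<close> only changes its type.
\<close>

definition Hdot_norm :: "real \<Rightarrow> nat \<Rightarrow> (real \<Rightarrow> complex) \<Rightarrow> real" where
  "Hdot_norm h n u =
     sqrt (Re (L2_inner h (((\<lambda>v g. - discrete_laplacian h v g) ^^ n) u) u))"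

text \<open>
  Since \<open>h\<close> is a variable, \<open>L\<^sup>2(h\<int>)\<close> is a set rather than a normed type, so membership in
  \<open>C\<^sup>1(\<real>; L\<^sup>2(h\<int>))\<close> is spelled out: difference quotients converge in the norm of \<open>L\<^sup>2(h\<int>)\<close>
  to a derivative which is continuous for that norm.
\<close>

definition has_L2_derivative ::
    "real \<Rightarrow> (real \<Rightarrow> real \<Rightarrow> complex) \<Rightarrow> (real \<Rightarrow> complex) \<Rightarrow> real \<Rightarrow> bool" where
  "has_L2_derivative h u w t \<longleftrightarrow>
     ((\<lambda>s. L2_norm h (\<lambda>g. (u s g - u t g) /\<^sub>R (s - t) - w g)) \<longlongrightarrow> 0) (at t)"

definition L2_continuous :: "real \<Rightarrow> (real \<Rightarrow> real \<Rightarrow> complex) \<Rightarrow> bool" where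
  "L2_continuous h w \<longleftrightarrow>
     (\<forall>t. ((\<lambda>s. L2_norm h (\<lambda>g. w s g - w t g)) \<longlongrightarrow> 0) (at t))"

definition C1_L2 :: "real \<Rightarrow> (real \<Rightarrow> real \<Rightarrow> complex) set" where
  "C1_L2 h = {u. (\<forall>t. u t \<in> L2 h) \<and>
     (\<exists>u'. (\<forall>t. u' t \<in> L2 h) \<and> (\<forall>t. has_L2_derivative h u (u' t) t) \<and> L2_continuous h u')}"

text \<open>
  For \<open>u \<in> C1_L2 h\<close> every coordinate \<open>\<lambda>s. u s g\<close> with \<open>g\<close> on the grid is differentiable, so
  \<open>vector_derivative\<close> below is a genuine derivative.
\<close>

definition DNLS_solution :: "real \<Rightarrow> real \<Rightarrow> (real \<Rightarrow> real \<Rightarrow> complex) \<Rightarrow> bool" where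
  "DNLS_solution h \<nu> u \<longleftrightarrow>
     (\<forall>t. \<forall>g\<in>grid h.
        \<i> * vector_derivative (\<lambda>s. u s g) (at t) =
          discrete_laplacian h (u t) g +
          complex_of_real \<nu> * (complex_of_real (cmod (u t g)))\<^sup>2 * u t g)"

definition M_const :: "real \<Rightarrow> (real \<Rightarrow> complex) \<Rightarrow> real" where
  "M_const h v = Hdot_norm h 1 v + L2_norm h v ^ 3"

text \<open>
  \<open>|t|\<^bsup>(n-1)/2\<^esup>\<close>, read as 1 for \<open>n = 1\<close>. The case distinction is needed because
  \<open>0 powr 0 = 0\<close>.
\<close>

definition time_growth :: "nat \<Rightarrow> real \<Rightarrow> real" where
  "time_growth n t = (if n = 1 then 1 else \<bar>t\<bar> powr ((real n - 1) / 2))"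

end

theory Submission
  imports Defs "HOL-Library.Poly_Mapping" "HOL-Computational_Algebra.Polynomial"
begin

text \<open>
  Rescaling space and time reduces everything to \<open>h = 1\<close>, and for \<open>n = 1\<close> the bound is conservation
  of mass and energy. For \<open>n = m + 1 \<ge> 2\<close> use the modified energy
  \<open>inner (A v) v - \<nu>/4 Re Q(v, v\<^sup>*, v, v\<^sup>*)\<close>, where \<open>A\<close> is the Fourier multiplier with symbol
  \<open>f\<close> such that \<open>f' = \<kappa> sin\<^bsup>2m+1\<^esup>\<close>; its quadratic part is comparable with the square of the
  \<open>m + 1\<close>-st homogeneous norm. The quartic form \<open>Q\<close> is chosen to cancel the quartic
  part of the time derivative: on \<open>\<theta>\<^sub>0 + \<theta>\<^sub>1 + \<theta>\<^sub>2 + \<theta>\<^sub>3 = 0\<close> the symbol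
  \<open>f(\<theta>\<^sub>0) + f(\<theta>\<^sub>2) - f(\<theta>\<^sub>1) - f(\<theta>\<^sub>3)\<close> is divisible by the resonance function
  \<open>cos \<theta>\<^sub>0 + cos \<theta>\<^sub>2 - cos \<theta>\<^sub>1 - cos \<theta>\<^sub>3\<close>, with a Laurent polynomial in \<open>t\<^sub>i = exp (\<i> \<theta>\<^sub>i)\<close> as
  quotient. This quotient is a combination of monomials of degree \<open>2m\<close> in the
  \<open>t\<^sub>i - 1\<close>, each to a power at most \<open>m\<close>, so \<open>Q\<close> carries \<open>2m\<close> differences, at most \<open>m\<close> of them on one
  factor, and so does the sextic form that remains in the time derivative. With
  \<open>\<mu>\<^sup>3\<close> proportional to the constant \<open>M\<close> of the theorem and \<open>r \<ge> \<mu>\<^sup>2\<close> the smallest frequency for which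
  the \<open>m + 1\<close>-st norm is at most \<open>\<mu>\<^sup>3 r\<^sup>m\<close>, interpolation bounds the derivative of the energy
  \<open>Y\<close>, which up to a constant multiple of \<open>\<mu>\<^bsup>4m+6\<^esup>\<close> is of order \<open>\<mu>\<^sup>6 r\<^bsup>2m\<^esup>\<close>, by \<open>\<mu>\<^bsup>14\<^esup> r\<^bsup>2m-2\<^esup>\<close>.
  Hence \<open>(Y / \<mu>\<^sup>6)\<^bsup>1/m\<^esup>\<close> grows at most linearly, with slope of order \<open>\<mu>\<^sup>8\<close>.
\<close>

section \<open>Square-summable sequences\<close>

lemma summable_on_square_add:
  fixes f g :: "'a \<Rightarrow> complex"
  assumes "(\<lambda>k. (cmod (f k))\<^sup>2) summable_on A" "(\<lambda>k. (cmod (g k))\<^sup>2) summable_on A"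
  shows "(\<lambda>k. (cmod (f k + g k))\<^sup>2) summable_on A"
proof (rule summable_on_comparison_test)
  show "(\<lambda>k. 2 * (cmod (f k))\<^sup>2 + 2 * (cmod (g k))\<^sup>2) summable_on A"
    by (intro summable_on_add summable_on_cmult_right assms)
  fix k
  have "(cmod (f k + g k))\<^sup>2 \<le> (cmod (f k) + cmod (g k))\<^sup>2"
    by (intro power_mono norm_triangle_ineq) auto
  also have "\<dots> \<le> 2 * (cmod (f k))\<^sup>2 + 2 * (cmod (g k))\<^sup>2"
    using zero_le_power2[of "cmod (f k) - cmod (g k)"] by (simp add: power2_eq_square algebra_simps)
  finally show "(cmod (f k + g k))\<^sup>2 \<le> 2 * (cmod (f k))\<^sup>2 + 2 * (cmod (g k))\<^sup>2" .
qed auto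

lemma summable_on_mult_square:
  fixes f g :: "'a \<Rightarrow> complex"
  assumes "(\<lambda>k. (cmod (f k))\<^sup>2) summable_on A" "(\<lambda>k. (cmod (g k))\<^sup>2) summable_on A"
  shows "(\<lambda>k. norm (f k * g k)) summable_on A"
proof (rule summable_on_comparison_test)
  show "(\<lambda>k. (cmod (f k))\<^sup>2 + (cmod (g k))\<^sup>2) summable_on A"
    by (intro summable_on_add assms)
  fix k
  show "cmod (f k * g k) \<le> (cmod (f k))\<^sup>2 + (cmod (g k))\<^sup>2"
    using zero_le_power2[of "cmod (f k) - cmod (g k)"] 
    by (simp add: norm_mult power2_eq_square algebra_simps) (smt (verit) mult_nonneg_nonneg norm_ge_zero)
qed auto

lemma bounded_of_summable_square:
  fixes f :: "'a \<Rightarrow> complex"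
  assumes "(\<lambda>k. (cmod (f k))\<^sup>2) summable_on UNIV"
  shows "(cmod (f k))\<^sup>2 \<le> (\<Sum>\<^sub>\<infinity>k. (cmod (f k))\<^sup>2)"
  using infsum_mono2[of "\<lambda>k. (cmod (f k))\<^sup>2" "{k}" UNIV] 
    finite_sum_le_infsum[OF assms, of "{k}"] by simp

lemma summable_on_square_mult_bounded:
  fixes f g :: "'a \<Rightarrow> complex"
  assumes "(\<lambda>k. (cmod (f k))\<^sup>2) summable_on A" "\<And>k. cmod (g k) \<le> B"
  shows "(\<lambda>k. (cmod (g k * f k))\<^sup>2) summable_on A"
proof (rule summable_on_comparison_test)
  show "(\<lambda>k. B\<^sup>2 * (cmod (f k))\<^sup>2) summable_on A"
    by (intro summable_on_cmult_right assms)
  fix k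
  show "(cmod (g k * f k))\<^sup>2 \<le> B\<^sup>2 * (cmod (f k))\<^sup>2"
    by (simp add: norm_mult power_mult_distrib mult_right_mono power_mono assms(2))
qed auto

text \<open>After rescaling, the lattice is the integers for every \<open>h\<close>, so the sequence
  space can be one fixed type, to which the type classes and derivatives of HOL-Analysis
  apply.\<close>

typedef ell2 = "{f :: int \<Rightarrow> complex. (\<lambda>k. (cmod (f k))\<^sup>2) summable_on UNIV}"
  morphisms seq Abs_ell2
  by (rule exI[of _ "\<lambda>_. 0"]) simp

setup_lifting type_definition_ell2

lemma ell2_eqI: "(\<And>k. seq f k = seq g k) \<Longrightarrow> f = g"
  using seq_inject by blast

lemma seq_summable: "(\<lambda>k. (cmod (seq f k))\<^sup>2) summable_on UNIV"
  using seq by blast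

text \<open>The product is pointwise. Square-summable sequences are bounded, so they form an
  algebra, though one without a unit.\<close>

instantiation ell2 :: comm_ring
begin
lift_definition zero_ell2 :: ell2 is "\<lambda>_. 0" by simp
lift_definition plus_ell2 :: "ell2 \<Rightarrow> ell2 \<Rightarrow> ell2" is "\<lambda>f g k. f k + g k"
  by (rule summable_on_square_add)
lift_definition uminus_ell2 :: "ell2 \<Rightarrow> ell2" is "\<lambda>f k. - f k" by simp
lift_definition minus_ell2 :: "ell2 \<Rightarrow> ell2 \<Rightarrow> ell2" is "\<lambda>f g k. f k - g k"
  using summable_on_square_add[where g = "\<lambda>k. - g k" for g] by fastforce
lift_definition times_ell2 :: "ell2 \<Rightarrow> ell2 \<Rightarrow> ell2" is "\<lambda>f g k. f k * g k"
proof -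
  fix f g :: "int \<Rightarrow> complex"
  assume *: "(\<lambda>k. (cmod (f k))\<^sup>2) summable_on UNIV" "(\<lambda>k. (cmod (g k))\<^sup>2) summable_on UNIV"
  have "cmod (f k) \<le> sqrt (\<Sum>\<^sub>\<infinity>k. (cmod (f k))\<^sup>2)" for k
    using bounded_of_summable_square[OF *(1), of k] by (simp add: real_le_rsqrt)
  then show "(\<lambda>k. (cmod (f k * g k))\<^sup>2) summable_on UNIV"
    using summable_on_square_mult_bounded[OF *(2)] by blast
qed
instance
  by standard (transfer; simp add: algebra_simps fun_eq_iff)+
end

lemma seq_simps [simp]:
  "seq 0 k = 0" "seq (f + g) k = seq f k + seq g k" "seq (f - g) k = seq f k - seq g k"
  "seq (- f) k = - seq f k" "seq (f * g) k = seq f k * seq g k"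
  by (transfer; simp)+

lift_definition conj2 :: "ell2 \<Rightarrow> ell2" is "\<lambda>f k. cnj (f k)" by simp

lift_definition shift :: "int \<Rightarrow> ell2 \<Rightarrow> ell2" is "\<lambda>s f k. f (k + s)"
proof -
  fix s :: int and f :: "int \<Rightarrow> complex"
  assume "(\<lambda>k. (cmod (f k))\<^sup>2) summable_on UNIV"
  moreover have "bij (\<lambda>k. k + s)"
    by (rule bij_betw_byWitness[of _ "\<lambda>k. k - s"]) auto
  ultimately show "(\<lambda>k. (cmod (f (k + s)))\<^sup>2) summable_on UNIV"
    using summable_on_reindex_bij_betw[of "\<lambda>k. k + s" UNIV UNIV "\<lambda>k. (cmod (f k))\<^sup>2"] by simp
qed

lift_definition cmul :: "complex \<Rightarrow> ell2 \<Rightarrow> ell2" is "\<lambda>c f k. c * f k"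
  by (simp add: norm_mult power_mult_distrib summable_on_cmult_right)

lemma seq_ops [simp]:
  "seq (conj2 f) k = cnj (seq f k)" "seq (shift s f) k = seq f (k + s)"
  "seq (cmul c f) k = c * seq f k"
  by (transfer; simp)+

text \<open>Bilinear, with no conjugation, because the quartic forms take \<open>v\<close> and
  \<open>conj2 v\<close> as separate arguments.\<close>

definition pair :: "ell2 \<Rightarrow> ell2 \<Rightarrow> complex" where
  "pair f g = (\<Sum>\<^sub>\<infinity>k. seq f k * seq g k)"

lemma pair_abs_summable: "(\<lambda>k. norm (seq f k * seq g k)) summable_on UNIV"
  by (rule summable_on_mult_square) (rule seq_summable)+

lemma pair_summable: "(\<lambda>k. seq f k * seq g k) summable_on UNIV"
  by (rule abs_summable_summable[OF pair_abs_summable])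

lemma pair_commute: "pair f g = pair g f"
  by (simp add: pair_def mult.commute)

lemma pair_add_left: "pair (f + g) h = pair f h + pair g h"
  by (simp add: pair_def distrib_right infsum_add pair_summable)

lemma pair_cmul_left: "pair (cmul c f) h = c * pair f h"
  by (simp add: pair_def mult.assoc infsum_cmult_right pair_summable)

lemma pair_mult: "pair (f * g) h = pair f (g * h)"
  by (simp add: pair_def mult.assoc)

lemma pair_shift: "pair (shift s f) (shift s g) = pair f g"
proof -
  have "bij (\<lambda>k. k + s)"
    by (rule bij_betw_byWitness[of _ "\<lambda>k. k - s"]) auto
  then show ?thesis
    unfolding pair_def
    using infsum_reindex_bij_betw[of "\<lambda>k. k + s" UNIV UNIV "\<lambda>k. seq f k * seq g k"] by simp
qed

lemma pair_conj2: "pair (conj2 f) (conj2 g) = cnj (pair f g)"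
  by (simp add: pair_def flip: infsum_cnj)

lemma Re_pair_conj2_self: "Re (pair f (conj2 f)) = (\<Sum>\<^sub>\<infinity>k. (cmod (seq f k))\<^sup>2)"
proof -
  have "Re (pair f (conj2 f)) = (\<Sum>\<^sub>\<infinity>k. Re (seq f k * seq (conj2 f) k))"
    unfolding pair_def by (rule infsum_Re[OF pair_summable, symmetric])
  then show ?thesis
    unfolding cmod_power2 by (simp add: power2_eq_square)
qed

instantiation ell2 :: real_vector
begin
definition scaleR_ell2 :: "real \<Rightarrow> ell2 \<Rightarrow> ell2" where
  "scaleR_ell2 r f = cmul (complex_of_real r) f"
instance
  by standard (auto intro!: ell2_eqI simp: scaleR_ell2_def algebra_simps)
end

text \<open>The space is treated as a real one, so that energies are real functions to be
  differentiated in time; complex scalars act through the separate \<open>cmul\<close>.\<close>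

instantiation ell2 :: real_inner
begin
definition inner_ell2 :: "ell2 \<Rightarrow> ell2 \<Rightarrow> real" where
  "inner_ell2 f g = Re (pair f (conj2 g))"
definition norm_ell2 :: "ell2 \<Rightarrow> real" where
  "norm_ell2 f = sqrt (inner f f)"
definition sgn_ell2 :: "ell2 \<Rightarrow> ell2" where
  "sgn_ell2 f = f /\<^sub>R norm f"
definition dist_ell2 :: "ell2 \<Rightarrow> ell2 \<Rightarrow> real" where
  "dist_ell2 f g = norm (f - g)"
definition uniformity_ell2 :: "(ell2 \<times> ell2) filter" where
  "uniformity_ell2 = (INF e\<in>{0<..}. principal {(x, y). dist x y < e})"
definition open_ell2 :: "ell2 set \<Rightarrow> bool" where
  "open_ell2 U = (\<forall>x\<in>U. \<forall>\<^sub>F (x', y) in uniformity. x' = x \<longrightarrow> y \<in> U)"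
instance
proof
  fix f g h :: ell2 and a b :: real
  show "sgn f = f /\<^sub>R norm f" by (rule sgn_ell2_def)
  show "dist f g = norm (f - g)" by (rule dist_ell2_def)
  show "(uniformity :: (ell2 \<times> ell2) filter) = (INF e\<in>{0<..}. principal {(x, y). dist x y < e})"
    by (rule uniformity_ell2_def)
  show "open U = (\<forall>x\<in>U. \<forall>\<^sub>F (x', y) in uniformity. x' = x \<longrightarrow> y \<in> U)" for U :: "ell2 set"
    by (rule open_ell2_def)
  have cc: "conj2 (conj2 f) = f" for f by (rule ell2_eqI) simp
  show "inner f g = inner g f"
  proof -
    have "pair g (conj2 f) = cnj (pair f (conj2 g))"
      by (subst pair_conj2[symmetric]) (simp add: cc pair_commute)
    then show ?thesis by (simp add: inner_ell2_def)
  qed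
  show "inner (f + g) h = inner f h + inner g h"
    by (simp add: inner_ell2_def pair_add_left)
  show "inner (a *\<^sub>R f) g = a * inner f g"
    by (simp add: inner_ell2_def scaleR_ell2_def pair_cmul_left)
  have eq: "inner f f = (\<Sum>\<^sub>\<infinity>k. (cmod (seq f k))\<^sup>2)" for f
    by (simp add: inner_ell2_def Re_pair_conj2_self)
  show "0 \<le> inner f f"
    by (simp add: eq infsum_nonneg)
  show "(inner f f = 0) = (f = 0)"
  proof
    assume "inner f f = 0"
    then have "(cmod (seq f k))\<^sup>2 \<le> 0" for k
      using bounded_of_summable_square[OF seq_summable[of f], of k] by (simp add: eq)
    then show "f = 0" by (intro ell2_eqI) simp
  qed (simp add: eq)
  show "norm f = sqrt (inner f f)" by (rule norm_ell2_def)
qed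
end

lemma norm_ell2_square: "(norm (f :: ell2))\<^sup>2 = (\<Sum>\<^sub>\<infinity>k. (cmod (seq f k))\<^sup>2)"
  by (simp add: power2_norm_eq_inner inner_ell2_def Re_pair_conj2_self)

lemma seq_scaleR [simp]: "seq (r *\<^sub>R f) k = complex_of_real r * seq f k"
  by (simp add: scaleR_ell2_def)

lemma norm_seq_le: "cmod (seq f k) \<le> norm f"
  using bounded_of_summable_square[OF seq_summable[of f], of k]
  by (simp flip: norm_ell2_square)

lemma norm_mult_bounded:
  assumes "\<And>k. cmod (seq f k) \<le> B"
  shows "norm (f * g) \<le> B * norm g"
proof -
  have "0 \<le> B" using assms[of 0] norm_ge_zero order_trans by blast
  have "(norm (f * g))\<^sup>2 \<le> (\<Sum>\<^sub>\<infinity>k. B\<^sup>2 * (cmod (seq g k))\<^sup>2)"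
    unfolding norm_ell2_square
  proof (rule infsum_mono)
    show "(\<lambda>k. B\<^sup>2 * (cmod (seq g k))\<^sup>2) summable_on UNIV"
      by (intro summable_on_cmult_right seq_summable)
    show "(cmod (seq (f * g) k))\<^sup>2 \<le> B\<^sup>2 * (cmod (seq g k))\<^sup>2" for k
      by (simp add: norm_mult power_mult_distrib mult_right_mono power_mono assms)
  qed (rule seq_summable)
  also have "\<dots> = (B * norm g)\<^sup>2"
    by (simp add: infsum_cmult_right' power_mult_distrib norm_ell2_square)
  finally show ?thesis
    using \<open>0 \<le> B\<close> by (auto intro: power2_le_imp_le)
qed

instance ell2 :: real_normed_algebra
proof
  fix f g :: ell2 and a :: real
  show "a *\<^sub>R f * g = a *\<^sub>R (f * g)" "f * a *\<^sub>R g = a *\<^sub>R (f * g)"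
    by (auto intro!: ell2_eqI)
  show "norm (f * g) \<le> norm f * norm g"
    by (rule norm_mult_bounded) (rule norm_seq_le)
qed

lift_definition abs2 :: "ell2 \<Rightarrow> ell2" is "\<lambda>f k. complex_of_real (cmod (f k))" by simp

lemma seq_abs2 [simp]: "seq (abs2 f) k = complex_of_real (cmod (seq f k))"
  by (transfer; simp)

lemma norm_abs2 [simp]: "norm (abs2 f) = norm f"
  and norm_conj2 [simp]: "norm (conj2 f) = norm f"
  and norm_cmul [simp]: "norm (cmul c f) = cmod c * norm f"
proof -
  show "norm (abs2 f) = norm f" "norm (conj2 f) = norm f"
    by (rule power2_eq_imp_eq; simp add: norm_ell2_square)+
  show "norm (cmul c f) = cmod c * norm f"
    by (rule power2_eq_imp_eq)
      (simp_all add: power_mult_distrib norm_mult norm_ell2_square infsum_cmult_right')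
qed

lemma norm_shift [simp]: "norm (shift s f) = norm f"
proof -
  have "shift s (conj2 f) = conj2 (shift s f)"
    by (rule ell2_eqI) simp
  then show ?thesis
    by (metis inner_ell2_def norm_ell2_def pair_shift)
qed

lemma conj2_simps [simp]:
  "conj2 (conj2 f) = f" "conj2 (f + g) = conj2 f + conj2 g" "conj2 (f - g) = conj2 f - conj2 g"
  "conj2 (- f) = - conj2 f" "conj2 (f * g) = conj2 f * conj2 g" "conj2 0 = 0"
  "conj2 (cmul c f) = cmul (cnj c) (conj2 f)" "conj2 (shift s f) = shift s (conj2 f)"
  "conj2 (a *\<^sub>R f) = a *\<^sub>R conj2 f"
  by (rule ell2_eqI; simp)+

lemma shift_simps [simp]:
  "shift 0 f = f" "shift s (shift t f) = shift (s + t) f" "shift s (f + g) = shift s f + shift s g"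
  "shift s (f - g) = shift s f - shift s g" "shift s (- f) = - shift s f" "shift s 0 = 0"
  "shift s (f * g) = shift s f * shift s g" "shift s (cmul c f) = cmul c (shift s f)"
  "shift s (a *\<^sub>R f) = a *\<^sub>R shift s f"
  by (rule ell2_eqI; simp add: algebra_simps)+

lemma cmul_simps [simp]:
  "cmul 0 f = 0" "cmul 1 f = f" "cmul c 0 = 0" "cmul c (cmul d f) = cmul (c * d) f"
  "cmul c (- f) = - cmul c f"
  by (rule ell2_eqI; simp)+

lemma cmul_distrib:
  "cmul c (f + g) = cmul c f + cmul c g" "cmul c (f - g) = cmul c f - cmul c g"
  "cmul (c + d) f = cmul c f + cmul d f" "cmul (c - d) f = cmul c f - cmul d f"
  "cmul c (a *\<^sub>R f) = a *\<^sub>R cmul c f"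
  by (rule ell2_eqI; simp add: algebra_simps)+

lemma cmul_mult: "cmul c f * g = cmul c (f * g)" "f * cmul c g = cmul c (f * g)"
  by (rule ell2_eqI; simp)+

lemma bounded_linear_shift: "bounded_linear (shift s)"
  by (rule bounded_linear_intro[where K = 1]) simp_all

lemma bounded_linear_conj2: "bounded_linear conj2"
  by (rule bounded_linear_intro[where K = 1]) simp_all

lemma bounded_linear_seq: "bounded_linear (\<lambda>f. seq f k)"
  by (rule bounded_linear_intro[where K = 1])
    (simp_all add: norm_seq_le scaleR_conv_of_real)

lemma infsum_cmod_mult_le: "(\<Sum>\<^sub>\<infinity>k. cmod (seq f k) * cmod (seq g k)) \<le> norm f * norm g"
proof -
  have "(\<Sum>\<^sub>\<infinity>k. cmod (seq f k) * cmod (seq g k)) = (\<Sum>\<^sub>\<infinity>k. Re (seq (abs2 f) k * seq (conj2 (abs2 g)) k))"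
    by simp
  also have "\<dots> = inner (abs2 f) (abs2 g)"
    unfolding inner_ell2_def pair_def by (rule infsum_Re[OF pair_summable])
  also have "\<dots> \<le> norm f * norm g"
    using norm_cauchy_schwarz[of "abs2 f" "abs2 g"] by simp
  finally show ?thesis .
qed

lemma cmod_mult_summable: "(\<lambda>k. cmod (seq f k) * cmod (seq g k)) summable_on A"
  using pair_abs_summable[of f g] by (auto simp: norm_mult intro: summable_on_subset_banach)

lemma cmod_pair_le: "cmod (pair f g) \<le> norm f * norm g"
proof -
  have "cmod (pair f g) \<le> (\<Sum>\<^sub>\<infinity>k. cmod (seq f k * seq g k))"
    unfolding pair_def by (rule norm_infsum_bound) (rule pair_abs_summable)
  then show ?thesis
    using infsum_cmod_mult_le[of f g] by (simp add: norm_mult)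
qed

lemma pair_add_right: "pair f (g + h) = pair f g + pair f h"
  by (metis pair_add_left pair_commute)

lemma pair_cmul_right: "pair f (cmul c g) = c * pair f g"
  by (metis pair_cmul_left pair_commute)

lemma bounded_bilinear_pair: "bounded_bilinear pair"
proof
  show "\<exists>K. \<forall>a b. cmod (pair a b) \<le> norm a * norm b * K"
    by (rule exI[of _ 1]) (simp add: cmod_pair_le)
qed (simp_all add: pair_add_left pair_add_right scaleR_ell2_def pair_cmul_left pair_cmul_right
      flip: scaleR_conv_of_real)

lemma inner_conj2: "inner (conj2 a) (conj2 b) = inner a b"
  using pair_conj2[of a "conj2 b"] by (simp add: inner_ell2_def)

lemma inner_cmul_left: "inner (cmul c a) b = inner a (cmul (cnj c) b)"
  by (simp add: inner_ell2_def pair_cmul_left pair_cmul_right)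

lemma inner_shift_left: "inner (shift s a) b = inner a (shift (- s) b)"
  using pair_shift[of "s" a "shift (- s) (conj2 b)"] by (simp add: inner_ell2_def)

section \<open>Forward differences and interpolation\<close>

definition fdiff :: "ell2 \<Rightarrow> ell2" where
  "fdiff f = shift 1 f - f"

lemma bounded_linear_fdiff: "bounded_linear fdiff"
  unfolding fdiff_def by (intro bounded_linear_sub bounded_linear_shift bounded_linear_ident)

lemma fdiff_simps [simp]:
  "fdiff (f + g) = fdiff f + fdiff g" "fdiff (f - g) = fdiff f - fdiff g" "fdiff (- f) = - fdiff f"
  "fdiff (cmul c f) = cmul c (fdiff f)" "fdiff 0 = 0" "fdiff (shift s f) = shift s (fdiff f)"
  "conj2 (fdiff f) = fdiff (conj2 f)"
  by (simp_all add: fdiff_def cmul_distrib add.commute)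

lemma funpow_fdiff_simps [simp]:
  "(fdiff ^^ a) (f + g) = (fdiff ^^ a) f + (fdiff ^^ a) g"
  "(fdiff ^^ a) (shift s f) = shift s ((fdiff ^^ a) f)"
  "(fdiff ^^ a) (conj2 f) = conj2 ((fdiff ^^ a) f)"
  "(fdiff ^^ a) 0 = 0"
  by (induction a) simp_all

lemma fdiff_mult: "fdiff (f * g) = fdiff f * shift 1 g + f * fdiff g"
  by (simp add: fdiff_def algebra_simps)

text \<open>Discrete Agmon inequality. The left side is the telescoping sum over
  \<open>j >= k\<close> of the drops of the squared modulus; each drop factors into a difference of
  moduli, at most that of \<open>fdiff f\<close>, and a sum of moduli, and Cauchy-Schwarz
  applies.\<close>

lemma cmod_seq_square_le: "(cmod (seq f k))\<^sup>2 \<le> 2 * norm f * norm (fdiff f)"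
proof -
  define a where "a j = (cmod (seq f j))\<^sup>2" for j
  have sum: "a summable_on A" for A
    unfolding a_def by (rule summable_on_subset_banach[OF seq_summable]) simp
  have sum1: "(\<lambda>j. a (j + 1)) summable_on A" for A
    using summable_on_subset_banach[OF seq_summable[of "shift 1 f"]] unfolding a_def by auto
  have sumd: "(\<lambda>j. a j - a (j + 1)) summable_on A" for A
    using summable_on_add[OF sum summable_on_uminus[THEN iffD2, OF sum1]] by simp
  define b where "b j = cmod (seq (fdiff f) j) * cmod (seq (abs2 f + abs2 (shift 1 f)) j)" for j
  have sumb: "b summable_on A" for A
    unfolding b_def by (rule cmod_mult_summable)
  have "infsum a {k..} = infsum a ({k} \<union> {k+1..})"
    by (rule arg_cong[of _ _ "infsum a"]) auto
  also have "\<dots> = a k + infsum a {k+1..}"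
    by (subst infsum_Un_disjoint) (auto intro: sum)
  also have "infsum a {k+1..} = infsum (\<lambda>j. a (j + 1)) {k..}"
  proof -
    have "bij_betw (\<lambda>j. j + 1) {k..} {k+1..}"
      by (rule bij_betw_byWitness[of _ "\<lambda>j. j - 1"]) auto
    then show ?thesis
      using infsum_reindex_bij_betw[of "\<lambda>j. j + 1" "{k..}" "{k+1..}" a] by simp
  qed
  finally have "a k = infsum a {k..} - infsum (\<lambda>j. a (j + 1)) {k..}"
    by simp
  also have "\<dots> = infsum (\<lambda>j. a j - a (j + 1)) {k..}"
    using infsum_add[OF sumd sum1] by simp
  also have "\<dots> \<le> infsum b {k..}"
  proof (rule infsum_mono)
    fix j
    have "a j - a (j + 1) = (cmod (seq f j) - cmod (seq f (j + 1))) * (cmod (seq f j) + cmod (seq f (j + 1)))"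
      by (simp add: a_def power2_eq_square algebra_simps)
    also have "\<dots> \<le> cmod (seq (fdiff f) j) * (cmod (seq f j) + cmod (seq f (j + 1)))"
      using norm_triangle_ineq3[of "seq f j" "seq f (j + 1)"]
      by (intro mult_right_mono) (auto simp: fdiff_def norm_minus_commute)
    also have "\<dots> = b j"
      unfolding b_def by (simp flip: of_real_add)
    finally show "a j - a (j + 1) \<le> b j" .
  qed (rule sumd sumb)+
  also have "\<dots> \<le> infsum b UNIV"
    by (rule infsum_mono_neutral) (auto intro: sumb, simp add: b_def)
  also have "\<dots> \<le> norm (fdiff f) * norm (abs2 f + abs2 (shift 1 f))"
    unfolding b_def by (rule infsum_cmod_mult_le)
  also have "\<dots> \<le> norm (fdiff f) * (norm f + norm f)"
    using norm_triangle_ineq[of "abs2 f" "abs2 (shift 1 f)"] by (intro mult_left_mono) simp_all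
  finally show ?thesis by (simp add: a_def algebra_simps)
qed

definition lapl :: "ell2 \<Rightarrow> ell2" where
  "lapl f = shift 1 f + shift (- 1) f - f - f"

lemma inner_fdiff: "inner (fdiff f) (fdiff g) = - inner f (lapl g)"
  by (simp add: fdiff_def lapl_def inner_diff_left inner_diff_right inner_add_right inner_shift_left)

text \<open>One summation by parts moves a difference from one factor to the other; then
  Cauchy-Schwarz.\<close>

lemma norm_fdiff_log_convex: 
  "(norm ((fdiff ^^ Suc a) f))\<^sup>2 \<le> norm ((fdiff ^^ a) f) * norm ((fdiff ^^ Suc (Suc a)) f)"
proof -
  define g where "g = (fdiff ^^ a) f"
  have "(norm (fdiff g))\<^sup>2 = - inner g (lapl g)"
    by (simp add: power2_norm_eq_inner inner_fdiff)
  also have "lapl g = shift (- 1) (fdiff (fdiff g))"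
    by (simp add: lapl_def fdiff_def algebra_simps)
  also have "- inner g (shift (- 1) (fdiff (fdiff g))) \<le> norm g * norm (fdiff (fdiff g))"
    using Cauchy_Schwarz_ineq2[of g "shift (- 1) (fdiff (fdiff g))"] by simp
  finally show ?thesis by (simp add: g_def)
qed

section \<open>Laurent polynomials as translation-invariant quadrilinear forms\<close>

text \<open>Laurent polynomials in \<open>t\<^sub>0, t\<^sub>1, t\<^sub>2, t\<^sub>3\<close> modulo \<open>t\<^sub>0 t\<^sub>1 t\<^sub>2 t\<^sub>3 = 1\<close>, by the exponents of the
  first three variables. The relation says that shifting all four factors of a sum over \<open>\<int>\<close> at once
  does not change it.\<close>
type_synonym laurent = "int \<times> int \<times> int \<Rightarrow>\<^sub>0 complex"

lemma poly_mapping_sum_singles: "r = (\<Sum>s\<in>Poly_Mapping.keys r. Poly_Mapping.single s (Poly_Mapping.lookup r s))"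
proof (rule poly_mapping_eqI)
  fix k
  have "(\<Sum>s\<in>Poly_Mapping.keys r. Poly_Mapping.lookup (Poly_Mapping.single s (Poly_Mapping.lookup r s)) k) = (\<Sum>s\<in>Poly_Mapping.keys r. if s = k then Poly_Mapping.lookup r k else 0)"
    by (intro sum.cong) (auto simp: lookup_single)
  then show "Poly_Mapping.lookup r k = Poly_Mapping.lookup (\<Sum>s\<in>Poly_Mapping.keys r. Poly_Mapping.single s (Poly_Mapping.lookup r s)) k"
    by (simp add: lookup_sum in_keys_iff)
qed

lemma poly_mapping_single_induct [case_names zero single add]:
  fixes r :: "'k \<Rightarrow>\<^sub>0 'b :: comm_monoid_add"
  assumes "P 0" "\<And>k c. P (Poly_Mapping.single k c)" "\<And>p q. P p \<Longrightarrow> P q \<Longrightarrow> P (p + q)"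
  shows "P r"
proof -
  have "P (\<Sum>s\<in>A. Poly_Mapping.single s (Poly_Mapping.lookup r s))" if "finite A" for A
    using that by induction (simp_all add: assms)
  then show ?thesis
    using poly_mapping_sum_singles[of r] by (metis finite_keys)
qed

text \<open>Linear extension from monomials. With characters it evaluates Laurent polynomials
  (\<open>ev\<close>), with products of shifts it turns them into quadrilinear forms
  (\<open>form\<close>).\<close>

definition extend :: "('k \<Rightarrow> complex) \<Rightarrow> ('k \<Rightarrow>\<^sub>0 complex) \<Rightarrow> complex" where
  "extend \<phi> r = (\<Sum>s\<in>Poly_Mapping.keys r. Poly_Mapping.lookup r s * \<phi> s)"

lemma extend_superset:
  assumes "finite A" "Poly_Mapping.keys r \<subseteq> A"
  shows "extend \<phi> r = (\<Sum>s\<in>A. Poly_Mapping.lookup r s * \<phi> s)"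
  unfolding extend_def using assms
  by (intro sum.mono_neutral_left) (auto simp: in_keys_iff)

lemma extend_zero [simp]: "extend \<phi> 0 = 0"
  by (simp add: extend_def)

lemma extend_add: "extend \<phi> (p + q) = extend \<phi> p + extend \<phi> q"
proof -
  let ?A = "Poly_Mapping.keys p \<union> Poly_Mapping.keys q"
  have "Poly_Mapping.keys (p + q) \<subseteq> ?A" by (rule keys_add)
  then show ?thesis
    by (simp add: extend_superset[of ?A] lookup_add distrib_right sum.distrib)
qed

lemma extend_single: "extend \<phi> (Poly_Mapping.single k c) = c * \<phi> k"
  by (subst extend_superset[of "{k}"]) auto

lemma extend_single_mult:
  fixes r :: "'k :: comm_monoid_add \<Rightarrow>\<^sub>0 complex"
  shows "extend \<phi> (Poly_Mapping.single k c * r) = c * extend (\<lambda>s. \<phi> (k + s)) r"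
  by (induction r rule: poly_mapping_single_induct)
    (simp_all add: extend_add extend_single mult_single distrib_left)

lemma extend_cmult: "extend (\<lambda>s. c * \<phi> s) r = c * extend \<phi> r"
  by (simp add: extend_def sum_distrib_left algebra_simps)

lemma extend_uminus: "extend \<phi> (- p) = - extend \<phi> p"
  using extend_add[of \<phi> p "- p"] by (simp add: eq_neg_iff_add_eq_0 add.commute)

lemma extend_diff: "extend \<phi> (p - q) = extend \<phi> p - extend \<phi> q"
  using extend_add[of \<phi> p "- q"] by (simp add: extend_uminus)

text \<open>The last case encodes the relation: the fourth variable is the inverse of the product of
  the other three.\<close>

definition unit_exp :: "nat \<Rightarrow> int \<times> int \<times> int" where
  "unit_exp i = (if i = 0 then (1, 0, 0) else if i = 1 then (0, 1, 0)
     else if i = 2 then (0, 0, 1) else (-1, -1, -1))"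

definition tv :: "nat \<Rightarrow> laurent" where "tv i = Poly_Mapping.single (unit_exp i) 1"
definition tvi :: "nat \<Rightarrow> laurent" where "tvi i = Poly_Mapping.single (- unit_exp i) 1"
definition const :: "complex \<Rightarrow> laurent" where "const c = Poly_Mapping.single 0 c"
definition dv :: "nat \<Rightarrow> laurent" where "dv i = tv i - 1"

lemma tv_tvi: "tv i * tvi i = 1"
  by (simp add: tv_def tvi_def mult_single)

lemma const_simps: "const 1 = 1" "const 0 = 0" "const (a + b) = const a + const b"
  "const (a * b) = const a * const b" "const (- a) = - const a"
  by (simp_all add: const_def single_add mult_single single_uminus)

section \<open>Evaluation at characters\<close>

definition chi :: "(nat \<Rightarrow> complex) \<Rightarrow> int \<times> int \<times> int \<Rightarrow> complex" where
  "chi \<theta> s = (case s of (a, b, c) \<Rightarrow> exp (\<i> * (of_int a * \<theta> 0 + of_int b * \<theta> 1 + of_int c * \<theta> 2)))"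

definition ev :: "(nat \<Rightarrow> complex) \<Rightarrow> laurent \<Rightarrow> complex" where
  "ev \<theta> = extend (chi \<theta>)"

lemma chi_add: "chi \<theta> (s + t) = chi \<theta> s * chi \<theta> t"
  by (auto simp: chi_def algebra_simps split: prod.split simp flip: exp_add)

lemma chi_zero [simp]: "chi \<theta> 0 = 1"
  by (simp add: chi_def zero_prod_def)

lemma ev_simps [simp]:
  "ev \<theta> 0 = 0" "ev \<theta> 1 = 1" "ev \<theta> (p + q) = ev \<theta> p + ev \<theta> q" "ev \<theta> (p - q) = ev \<theta> p - ev \<theta> q"
  "ev \<theta> (- p) = - ev \<theta> p" "ev \<theta> (const c) = c" "ev \<theta> (p * q) = ev \<theta> p * ev \<theta> q"
proof -
  show "ev \<theta> 1 = 1"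
    using extend_single[of "chi \<theta>" 0 1] by (simp add: ev_def)
  show "ev \<theta> (p * q) = ev \<theta> p * ev \<theta> q"
    unfolding ev_def
    by (induction p rule: poly_mapping_single_induct)
      (simp_all add: extend_add extend_single_mult extend_single chi_add distrib_right extend_cmult)
qed (simp_all add: ev_def extend_add extend_diff extend_uminus const_def extend_single)

lemma ev_power [simp]: "ev \<theta> (p ^ k) = ev \<theta> p ^ k"
  by (induction k) simp_all

lemma ev_sum [simp]: "ev \<theta> (sum f A) = (\<Sum>x\<in>A. ev \<theta> (f x))"
  by (induction A rule: infinite_finite_induct) simp_all

lemma ev_of_nat [simp]: "ev \<theta> (of_nat k) = of_nat k"
  by (induction k) simp_all

lemma ev_numeral [simp]: "ev \<theta> (numeral k) = numeral k"
  using ev_of_nat[of \<theta> "numeral k"] by simp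

lemma ev_tv:
  assumes "\<theta> 0 + \<theta> 1 + \<theta> 2 + \<theta> 3 = 0" "i < 4"
  shows "ev \<theta> (tv i) = exp (\<i> * \<theta> i)" "ev \<theta> (tvi i) = exp (- (\<i> * \<theta> i))"
proof -
  have 3: "\<theta> 3 = - (\<theta> 0 + \<theta> 1 + \<theta> 2)"
    by (rule minus_unique[symmetric]) (rule assms(1))
  consider "i = 0" | "i = 1" | "i = 2" | "i = 3" using assms(2) by linarith
  then have "ev \<theta> (tv i) = exp (\<i> * \<theta> i) \<and> ev \<theta> (tvi i) = exp (- (\<i> * \<theta> i))"
    by cases (auto simp: ev_def tv_def tvi_def extend_single unit_exp_def chi_def 3 algebra_simps
        intro!: arg_cong[of _ _ exp])
  then show "ev \<theta> (tv i) = exp (\<i> * \<theta> i)" "ev \<theta> (tvi i) = exp (- (\<i> * \<theta> i))" by auto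
qed

lemma chi_separates:
  assumes "s \<noteq> t"
  obtains \<theta> where "\<theta> 0 + \<theta> 1 + \<theta> 2 + \<theta> 3 = 0" "chi \<theta> s \<noteq> chi \<theta> t"
proof -
  obtain a b c where s: "s = (a, b, c)" by (cases s)
  obtain a' b' c' where t: "t = (a', b', c')" by (cases t)
  have ex: "\<exists>x. exp (\<i> * (of_int d * x)) \<noteq> exp (\<i> * (of_int d' * x))" if "d \<noteq> d'" for d d' :: int
  proof (intro exI notI)
    \<comment> \<open>With this angle the quotient of the two values would be
      \<open>exp (\<i> * pi) = -1\<close>.\<close>
    let ?x = "pi / (of_int d - of_int d')"
    assume *: "exp (\<i> * (of_int d * complex_of_real ?x)) = exp (\<i> * (of_int d' * complex_of_real ?x))"
    have "\<i> * (of_int d * complex_of_real ?x) - \<i> * (of_int d' * complex_of_real ?x)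
        = \<i> * ((of_int d - of_int d') * complex_of_real ?x)"
      by (simp only: left_diff_distrib right_diff_distrib)
    also have "\<dots> = \<i> * pi"
      using that by simp
    finally have "\<i> * (of_int d * complex_of_real ?x) - \<i> * (of_int d' * complex_of_real ?x) = \<i> * pi" .
    then have "exp (\<i> * pi) = exp (\<i> * (of_int d * complex_of_real ?x)) / exp (\<i> * (of_int d' * complex_of_real ?x))"
      by (metis exp_diff)
    then show False using * by simp
  qed
  consider "a \<noteq> a'" | "b \<noteq> b'" | "c \<noteq> c'" using assms s t by auto
  then show ?thesis
  proof cases
    case 1
    then obtain x where "exp (\<i> * (of_int a * x)) \<noteq> exp (\<i> * (of_int a' * x))" using ex by blast
    \<comment> \<open>The opposite angle in position 3 keeps the sum of the angles zero;
      \<open>chi\<close> reads positions 0 to 2 only.\<close>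
    then show ?thesis by (intro that[of "(\<lambda>_. 0)(0 := x, 3 := - x)"]) (auto simp: chi_def s t)
  next
    case 2
    then obtain x where "exp (\<i> * (of_int b * x)) \<noteq> exp (\<i> * (of_int b' * x))" using ex by blast
    then show ?thesis by (intro that[of "(\<lambda>_. 0)(1 := x, 3 := - x)"]) (auto simp: chi_def s t)
  next
    case 3
    then obtain x where "exp (\<i> * (of_int c * x)) \<noteq> exp (\<i> * (of_int c' * x))" using ex by blast
    then show ?thesis by (intro that[of "(\<lambda>_. 0)(2 := x, 3 := - x)"]) (auto simp: chi_def s t)
  qed
qed

text \<open>Dedekind's argument: the relation at the angles shifted by \<open>\<phi>\<close>, minus
  \<open>chi \<phi> u\<close> times the original relation, no longer contains the character
  \<open>u\<close>, and it multiplies the coefficient at \<open>t\<close> by a nonzero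
  number.\<close>

lemma chi_independent:
  assumes "finite A" "\<And>\<theta>. \<theta> 0 + \<theta> 1 + \<theta> 2 + \<theta> 3 = 0 \<Longrightarrow> (\<Sum>s\<in>A. c s * chi \<theta> s) = 0" "t \<in> A"
  shows "c t = 0"
  using assms
proof (induction "card A" arbitrary: A c t)
  case (Suc m)
  show ?case
  proof (cases "A = {t}")
    case True
    then show ?thesis using Suc.prems(2)[of "\<lambda>_. 0"] by (simp add: chi_def split: prod.splits)
  next
    case False
    then obtain u where u: "u \<in> A" "u \<noteq> t" using Suc.prems(3) by blast
    obtain \<phi> where \<phi>: "\<phi> 0 + \<phi> 1 + \<phi> 2 + \<phi> 3 = 0" "chi \<phi> t \<noteq> chi \<phi> u"
      using chi_separates u(2) by metis
    define d where "d s = c s * (chi \<phi> s - chi \<phi> u)" for s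
    have "d t = 0"
    proof (rule Suc.hyps(1)[of "A - {u}" d t])
      show "m = card (A - {u})"
        using Suc.hyps(2) u(1) by simp
      fix \<theta> :: "nat \<Rightarrow> complex" assume \<theta>: "\<theta> 0 + \<theta> 1 + \<theta> 2 + \<theta> 3 = 0"
      have "chi (\<lambda>i. \<theta> i + \<phi> i) s = chi \<theta> s * chi \<phi> s" for s
        by (auto simp: chi_def algebra_simps split: prod.split simp flip: exp_add)
      moreover have "(\<theta> 0 + \<phi> 0) + (\<theta> 1 + \<phi> 1) + (\<theta> 2 + \<phi> 2) + (\<theta> 3 + \<phi> 3)
          = (\<theta> 0 + \<theta> 1 + \<theta> 2 + \<theta> 3) + (\<phi> 0 + \<phi> 1 + \<phi> 2 + \<phi> 3)"
        by (simp only: ac_simps)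
      ultimately have "(\<Sum>s\<in>A. c s * (chi \<theta> s * chi \<phi> s)) = 0"
        using Suc.prems(2)[of "\<lambda>i. \<theta> i + \<phi> i"] by (simp only: \<theta> \<phi>(1) add_0_left simp_thms)
      moreover have "(\<Sum>s\<in>A. c s * (chi \<theta> s * chi \<phi> u)) = 0"
        using Suc.prems(2)[OF \<theta>] by (simp flip: sum_distrib_right mult.assoc)
      ultimately have "(\<Sum>s\<in>A. d s * chi \<theta> s) = 0"
        by (simp add: d_def algebra_simps sum_subtractf)
      moreover have "d u = 0" by (simp add: d_def)
      ultimately show "(\<Sum>s\<in>A - {u}. d s * chi \<theta> s) = 0"
        using u(1) Suc.prems(1) by (simp add: sum_diff1)
    qed (use Suc.prems u in auto)
    then show ?thesis using \<phi>(2) by (simp add: d_def)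
  qed
qed auto

text \<open>Follows from independence of characters. It reduces identities of Laurent polynomials to
  trigonometry on the set where the four angles sum to zero.\<close>

lemma ev_eqI:
  assumes "\<And>\<theta>. \<theta> 0 + \<theta> 1 + \<theta> 2 + \<theta> 3 = 0 \<Longrightarrow> ev \<theta> p = ev \<theta> q"
  shows "p = q"
proof -
  have "Poly_Mapping.lookup (p - q) t = 0" for t
  proof (cases "t \<in> Poly_Mapping.keys (p - q)")
    case True
    show ?thesis
    proof (rule chi_independent[OF finite_keys _ True])
      fix \<theta> :: "nat \<Rightarrow> complex" assume "\<theta> 0 + \<theta> 1 + \<theta> 2 + \<theta> 3 = 0"
      then have "ev \<theta> (p - q) = 0" using assms by simp
      then show "(\<Sum>s\<in>Poly_Mapping.keys (p - q). Poly_Mapping.lookup (p - q) s * chi \<theta> s) = 0"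
        by (simp only: ev_def extend_def)
    qed
  qed (simp add: in_keys_iff)
  then have "p - q = 0" by (intro poly_mapping_eqI) simp
  then show ?thesis by simp
qed

section \<open>Quadrilinear forms\<close>

definition base :: "int \<times> int \<times> int \<Rightarrow> (nat \<Rightarrow> ell2) \<Rightarrow> complex" where
  "base s w = (case s of (a, b, c) \<Rightarrow>
     pair (shift a (w 0) * shift b (w 1)) (shift c (w 2) * w 3))"

definition form :: "laurent \<Rightarrow> (nat \<Rightarrow> ell2) \<Rightarrow> complex" where
  "form r w = extend (\<lambda>s. base s w) r"

lemma less4_cases:
  assumes "(i :: nat) < 4"
  obtains "i = 0" | "i = 1" | "i = 2" | "i = 3"
  using assms by linarith

text \<open>This makes multiplication by \<open>tv i\<close> act as a shift of argument
  \<open>i\<close>. For \<open>i = 3\<close> it is the invariance of the sum under a common shift,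
  fact \<open>A\<close>.\<close>

lemma base_unit_exp:
  assumes "i < 4"
  shows "base (unit_exp i + s) w = base s (w(i := shift 1 (w i)))"
    and "base (- unit_exp i + s) w = base s (w(i := shift (-1) (w i)))"
proof -
  obtain a b c where s: "s = (a, b, c)" by (cases s)
  have A: "pair (shift (a - t) (w 0) * shift (b - t) (w 1)) (shift (c - t) (w 2) * w 3)
      = pair (shift a (w 0) * shift b (w 1)) (shift c (w 2) * shift t (w 3))" for t
    by (subst pair_shift[of t, symmetric]) simp
  show "base (unit_exp i + s) w = base s (w(i := shift 1 (w i)))"
    using less4_cases[OF assms] A[of 1]
    by cases (simp_all add: base_def unit_exp_def s add.commute)
  show "base (- unit_exp i + s) w = base s (w(i := shift (-1) (w i)))"
    using less4_cases[OF assms] A[of "-1"]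
    by cases (simp_all add: base_def unit_exp_def s add.commute)
qed

lemma form_tv:
  assumes "i < 4"
  shows "form (tv i * r) w = form r (w(i := shift 1 (w i)))"
    and "form (tvi i * r) w = form r (w(i := shift (-1) (w i)))"
  by (simp_all add: form_def tv_def tvi_def extend_single_mult base_unit_exp[OF assms]
      del: uminus_add_conv_diff)

lemma form_simps [simp]:
  "form 0 w = 0" "form (p + q) w = form p w + form q w" "form (p - q) w = form p w - form q w"
  "form (- p) w = - form p w" "form (const c * p) w = c * form p w"
  by (simp_all add: form_def extend_add extend_diff extend_uminus const_def extend_single_mult)

lemma form_sum: "form (sum f A) w = (\<Sum>x\<in>A. form (f x) w)"
  by (induction A rule: infinite_finite_induct) simp_all

lemma form_one: "form 1 w = pair (w 0 * w 1) (w 2 * w 3)"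
proof -
  have "form 1 w = base 0 w"
    using extend_single[of "\<lambda>s. base s w" 0 1] by (simp add: form_def)
  then show ?thesis by (simp add: base_def zero_prod_def)
qed

lemma base_slot:
  assumes "i < 4"
  shows "base s (w(i := f + g)) = base s (w(i := f)) + base s (w(i := g))"
    and "base s (w(i := cmul c f)) = c * base s (w(i := f))"
  using less4_cases[OF assms]
  by (cases; simp add: base_def distrib_left distrib_right pair_add_left pair_add_right cmul_mult
      pair_cmul_left pair_cmul_right split: prod.split)+

lemma form_slot_add:
  assumes "i < 4"
  shows "form r (w(i := f + g)) = form r (w(i := f)) + form r (w(i := g))"
  by (simp add: form_def extend_def base_slot[OF assms] distrib_left sum.distrib)

lemma form_slot_cmul:
  assumes "i < 4"
  shows "form r (w(i := cmul c f)) = c * form r (w(i := f))"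
  by (simp add: form_def base_slot[OF assms] extend_cmult)

lemma form_slot_uminus:
  assumes "i < 4"
  shows "form r (w(i := - f)) = - form r (w(i := f))"
proof -
  have "- f = cmul (- 1) f" by (rule ell2_eqI) simp
  then show ?thesis using form_slot_cmul[OF assms, of r w "- 1" f] by simp
qed

lemma form_slot_diff:
  assumes "i < 4"
  shows "form r (w(i := f - g)) = form r (w(i := f)) - form r (w(i := g))"
  using form_slot_add[OF assms, of r w f "- g"] form_slot_uminus[OF assms, of r w g] by simp

lemma form_dv:
  assumes "i < 4"
  shows "form (dv i * r) w = form r (w(i := fdiff (w i)))"
  by (simp add: dv_def left_diff_distrib form_tv[OF assms] fdiff_def form_slot_diff[OF assms])

lemma form_dv_power:
  assumes "i < 4"
  shows "form (dv i ^ a * r) w = form r (w(i := (fdiff ^^ a) (w i)))"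
proof (induction a arbitrary: w)
  case (Suc a)
  have "form (dv i ^ Suc a * r) w = form (dv i * (dv i ^ a * r)) w"
    by (simp add: mult.assoc)
  also have "\<dots> = form r (w(i := (fdiff ^^ a) (fdiff (w i))))"
    by (simp only: form_dv[OF assms] Suc.IH fun_upd_same fun_upd_upd)
  finally show ?case by (simp only: funpow.simps o_apply funpow_swap1)
qed simp

text \<open>Turns the monomials that span \<open>Jpow m\<close> into differences of the arguments,
  which is how membership in \<open>Jpow m\<close> enters the estimates.\<close>

lemma form_dv_powers:
  "form (r * (\<Prod>i<4. dv i ^ \<alpha> i)) w = form r (\<lambda>i. if i < 4 then (fdiff ^^ \<alpha> i) (w i) else w i)"
proof -
  have "r * (\<Prod>i<4. dv i ^ \<alpha> i) = dv 0 ^ \<alpha> 0 * (dv 1 ^ \<alpha> 1 * (dv 2 ^ \<alpha> 2 * (dv 3 ^ \<alpha> 3 * r)))"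
    by (simp add: eval_nat_numeral algebra_simps)
  then have "form (r * (\<Prod>i<4. dv i ^ \<alpha> i)) w
      = form r (((w(0 := (fdiff ^^ \<alpha> 0) (w 0)))(1 := (fdiff ^^ \<alpha> 1) (w 1)))
          (2 := (fdiff ^^ \<alpha> 2) (w 2), 3 := (fdiff ^^ \<alpha> 3) (w 3)))"
    by (simp add: form_dv_power del: One_nat_def)
  also have "((w(0 := (fdiff ^^ \<alpha> 0) (w 0)))(1 := (fdiff ^^ \<alpha> 1) (w 1)))
          (2 := (fdiff ^^ \<alpha> 2) (w 2), 3 := (fdiff ^^ \<alpha> 3) (w 3))
      = (\<lambda>i. if i < 4 then (fdiff ^^ \<alpha> i) (w i) else w i)"
    by (rule ext) (auto elim: less4_cases)
  finally show ?thesis .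
qed

text \<open>The \<open>m\<close>-th power of the ideal generated by the products of two different \<open>t\<^sub>i - 1\<close>.\<close>
inductive_set Jpow :: "nat \<Rightarrow> laurent set" for m where
  zero: "0 \<in> Jpow m"
| mon: "(\<forall>i<4. \<alpha> i \<le> m) \<Longrightarrow> (\<Sum>i<4. \<alpha> i) = 2 * m \<Longrightarrow> r * (\<Prod>i<4. dv i ^ \<alpha> i) \<in> Jpow m"
| add: "p \<in> Jpow m \<Longrightarrow> q \<in> Jpow m \<Longrightarrow> p + q \<in> Jpow m"

lemma Jpow_mult_left: "p \<in> Jpow m \<Longrightarrow> r * p \<in> Jpow m"
  by (induction rule: Jpow.induct) (auto simp: distrib_left intro: Jpow.intros simp flip: mult.assoc)

lemma Jpow_uminus: "p \<in> Jpow m \<Longrightarrow> - p \<in> Jpow m"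
  using Jpow_mult_left[of p m "- 1"] by simp

lemma Jpow_diff: "p \<in> Jpow m \<Longrightarrow> q \<in> Jpow m \<Longrightarrow> p - q \<in> Jpow m"
  using Jpow.add[of p m "- q"] Jpow_uminus[of q m] by simp

lemma Jpow_sum: "(\<And>x. x \<in> A \<Longrightarrow> f x \<in> Jpow m) \<Longrightarrow> sum f A \<in> Jpow m"
  by (induction A rule: infinite_finite_induct) (auto intro: Jpow.intros)

lemma Jpow_0: "p \<in> Jpow 0"
  using Jpow.mon[of "\<lambda>_. 0" 0 p] by simp

lemma Jpow_mult:
  assumes "p \<in> Jpow m" "q \<in> Jpow k"
  shows "p * q \<in> Jpow (m + k)"
  using assms(1)
proof (induction rule: Jpow.induct)
  case (mon \<alpha> r)
  show ?case using assms(2)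
  proof (induction rule: Jpow.induct)
    case (mon \<beta> s)
    have "(r * s) * (\<Prod>i<4. dv i ^ (\<alpha> i + \<beta> i)) \<in> Jpow (m + k)"
      using \<open>\<forall>i<4. \<alpha> i \<le> m\<close> \<open>(\<Sum>i<4. \<alpha> i) = 2 * m\<close> mon
      by (intro Jpow.mon) (auto simp: sum.distrib add_mono)
    then show ?case by (simp add: power_add prod.distrib algebra_simps)
  qed (auto intro: Jpow.intros simp: distrib_left)
qed (auto intro: Jpow.intros simp: distrib_right)

lemma dv_mult_in_Jpow:
  assumes "i < 4" "j < 4" "i \<noteq> j"
  shows "dv i * dv j \<in> Jpow 1"
proof -
  let ?\<alpha> = "\<lambda>k. of_bool (k = i) + of_bool (k = j) :: nat"
  have "1 * (\<Prod>k<4. dv k ^ ?\<alpha> k) \<in> Jpow 1"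
    using assms by (intro Jpow.mon) (auto simp: sum.distrib of_bool_def)
  also have "(\<Prod>k<4. dv k ^ ?\<alpha> k) = dv i * dv j"
    using assms by (simp add: power_add prod.distrib of_bool_def if_distrib[of "\<lambda>e. _ ^ e"] prod.delta cong: if_cong)
  finally show ?thesis by simp
qed

lemma Jpow_mult_right: "p \<in> Jpow m \<Longrightarrow> p * r \<in> Jpow m"
  using Jpow_mult_left[of p m r] by (simp add: mult.commute)

text \<open>Since \<open>tv i * tv j - 1 = dv i * tv j + dv j\<close>, every term of the expanded
  product has one difference with index \<open>i\<close> or \<open>j\<close> and one with index
  \<open>k\<close> or \<open>l\<close>.\<close>

lemma tv_diff_in_Jpow:
  assumes "i < 4" "j < 4" "k < 4" "l < 4" "i \<noteq> k" "i \<noteq> l" "j \<noteq> k" "j \<noteq> l"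
  shows "(tv i * tv j - 1) * (tv k * tv l - 1) \<in> Jpow 1"
proof -
  have "(tv i * tv j - 1) * (tv k * tv l - 1)
      = dv i * dv k * (tv j * tv l) + dv i * dv l * tv j + dv j * dv k * tv l + dv j * dv l"
    by (simp add: dv_def algebra_simps)
  moreover have "\<dots> \<in> Jpow 1"
    by (intro Jpow.add Jpow_mult_right dv_mult_in_Jpow assms)
  ultimately show ?thesis by simp
qed

text \<open>Each factor is divisible: \<open>t - 1/t = (t - 1) (1 + 1/t)\<close>.\<close>

lemma tv_sin_in_Jpow:
  assumes "i < 4" "j < 4" "i \<noteq> j"
  shows "(tv i - tvi i) * (tv j - tvi j) \<in> Jpow 1"
proof -
  have *: "tv i - tvi i = dv i * (1 + tvi i)" for i
    using tv_tvi[of i] by (simp add: dv_def algebra_simps)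
  have "(tv i - tvi i) * (tv j - tvi j) = dv i * dv j * ((1 + tvi i) * (1 + tvi j))"
    unfolding * by (simp add: algebra_simps)
  then show ?thesis
    using Jpow_mult_right[OF dv_mult_in_Jpow[OF assms]] by simp
qed

section \<open>Divisibility by the resonance function\<close>

text \<open>The complete homogeneous polynomial of degree \<open>2m\<close> in \<open>x\<close> and \<open>y\<close>, written in terms of
  \<open>P = (x + y)\<^sup>2\<close> and \<open>E = x y\<close>, which makes sense in any commutative ring.\<close>
fun hh :: "nat \<Rightarrow> 'a :: comm_ring_1 \<Rightarrow> 'a \<Rightarrow> 'a" where
  "hh 0 P E = 1"
| "hh (Suc 0) P E = P - E"
| "hh (Suc (Suc m)) P E = (P - E - E) * hh (Suc m) P E - E * E * hh m P E"

text \<open>As \<open>P - 2 E = x^2 + y^2\<close> and \<open>E^2 = x^2 y^2\<close>, the recursion of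
  \<open>hh\<close> is the linear recurrence with characteristic roots \<open>x^2\<close> and
  \<open>y^2\<close>, which the odd powers of \<open>x\<close> and \<open>y\<close> satisfy.\<close>

lemma hh_eq: "(x - y) * hh m ((x + y)\<^sup>2) (x * y) = x ^ (2 * m + 1) - y ^ (2 * m + 1)"
proof (induction m "(x + y)\<^sup>2" "x * y" rule: hh.induct)
  case 2
  show ?case by (simp add: power2_eq_square power3_eq_cube algebra_simps)
next
  case (3 m)
  have "(x - y) * hh (Suc (Suc m)) ((x + y)\<^sup>2) (x * y)
      = ((x + y)\<^sup>2 - x * y - x * y) * ((x - y) * hh (Suc m) ((x + y)\<^sup>2) (x * y))
        - x * y * (x * y) * ((x - y) * hh m ((x + y)\<^sup>2) (x * y))"
    by (simp add: algebra_simps)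
  also have "\<dots> = (x\<^sup>2 + y\<^sup>2) * (x ^ (2 * Suc m + 1) - y ^ (2 * Suc m + 1))
      - x\<^sup>2 * y\<^sup>2 * (x ^ (2 * m + 1) - y ^ (2 * m + 1))"
    unfolding 3 by (simp add: power2_eq_square algebra_simps)
  also have "\<dots> = x ^ (2 * Suc (Suc m) + 1) - y ^ (2 * Suc (Suc m) + 1)"
    by (simp add: power2_eq_square algebra_simps)
  finally show ?case .
qed simp

text \<open>\<open>hh\<close> is built from 1, differences and products. The lemma carries it
  through evaluation and composition of polynomials and through \<open>ev\<close>.\<close>

lemma hh_hom:
  assumes "h 1 = 1" "\<And>x y. h (x - y) = h x - h y" "\<And>x y. h (x * y) = h x * h y"
  shows "h (hh m P E) = hh m (h P) (h E)"
  by (induction m P E rule: hh.induct) (simp_all only: hh.simps assms)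

section \<open>Antiderivatives of polynomials\<close>

lemma pderiv_sum: "pderiv (sum f A) = (\<Sum>x\<in>A. pderiv (f x :: complex poly))"
  by (induction A rule: infinite_finite_induct) (simp_all add: pderiv_add)

definition pint :: "complex poly \<Rightarrow> complex poly" where
  "pint p = (\<Sum>j\<le>degree p. monom (coeff p j / of_nat (Suc j)) (Suc j))"

lemma pderiv_pint [simp]: "pderiv (pint p) = p"
proof -
  have "pderiv (pint p) = (\<Sum>j\<le>degree p. monom (coeff p j) j)"
    by (simp add: pint_def pderiv_sum pderiv_monom del: of_nat_Suc)
  then show ?thesis by (simp add: poly_as_sum_of_monoms)
qed

lemma poly_pint_0 [simp]: "poly (pint p) 0 = 0"
  by (simp add: pint_def poly_sum poly_monom)

lemma poly_pint_1:
  assumes "degree p \<le> N"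
  shows "poly (pint p) 1 = (\<Sum>j\<le>N. coeff p j / of_nat (Suc j))"
proof -
  have "poly (pint p) 1 = (\<Sum>j\<le>degree p. coeff p j / of_nat (Suc j))"
    by (simp add: pint_def poly_sum poly_monom)
  also have "\<dots> = (\<Sum>j\<le>N. coeff p j / of_nat (Suc j))"
    using assms by (intro sum.mono_neutral_left) (auto simp: coeff_eq_0)
  finally show ?thesis .
qed

text \<open>Substitution in the integral of \<open>p\<close> over the segment from \<open>Y\<close>
  to \<open>X\<close>: with a variable endpoint, the difference \<open>d\<close> of the two
  antiderivatives has derivative zero. The divided difference of \<open>pint p\<close> is thus
  obtained without dividing, so that it also makes sense for Laurent polynomials.\<close>

lemma poly_pint_pcompose_lin:
  "(X - Y) * poly (pint (pcompose p [:Y, X - Y:])) 1 = poly (pint p) X - poly (pint p) Y"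
proof -
  define d where "d = pcompose (pint p) [:Y, X - Y:] - smult (X - Y) (pint (pcompose p [:Y, X - Y:]))"
  have "pderiv d = 0"
    by (simp add: d_def pderiv_diff pderiv_pcompose pderiv_smult pderiv_pCons)
  then have "degree d = 0"
    by (simp add: pderiv_eq_0_iff)
  then obtain c where "d = [:c:]"
    using degree_eq_zeroE by blast
  then have "poly d 1 = poly d 0" by simp
  then show ?thesis by (simp add: d_def poly_pcompose algebra_simps)
qed

text \<open>The polynomial with derivative proportional to \<open>(x (1 - x))\<^sup>m\<close> and value 0 at 0, in a form
  with nonnegative terms on the unit interval.\<close>
definition bern :: "nat \<Rightarrow> 'a :: comm_ring_1 \<Rightarrow> 'a" where
  "bern m x = (\<Sum>l\<le>m. of_nat ((2 * m + 1) choose (m + l + 1)) * x ^ (m + l + 1) * (1 - x) ^ (m - l))"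

text \<open>\<open>bern m\<close> is the sum of the Bernstein polynomials of degree
  \<open>2 * m + 1\<close> with index above \<open>m\<close>. Each derivative is a difference of
  neighbouring terms of degree \<open>2 * m\<close>, so the sum telescopes to \<open>b m\<close>, as
  \<open>b (2 * m + 1) = 0\<close>.\<close>

lemma bern_deriv:
  "(bern m has_field_derivative of_nat ((2 * m + 1) * (2 * m choose m)) * (x * (1 - x)) ^ m) (at (x :: complex))"
proof -
  define b where "b i = of_nat ((2 * m + 1) * (2 * m choose i)) * x ^ i * (1 - x) ^ (2 * m - i)" for i
  have "((\<lambda>x. of_nat ((2 * m + 1) choose (m + l + 1)) * x ^ (m + l + 1) * (1 - x) ^ (m - l))
      has_field_derivative b (m + l) - b (m + Suc l)) (at x)" (is "(?g has_field_derivative _) _")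
    if "l \<le> m" for l
  proof -
    let ?N = "2 * m + 1" and ?k = "m + l + 1"
    have 1: "of_nat (?N choose ?k) * (of_nat ?k :: complex) = of_nat (?N * (2 * m choose (m + l)))"
      using Suc_times_binomial_eq[of "2 * m" "m + l"] 
      by (simp only: Suc_eq_plus1 flip: of_nat_mult)
    have 2: "of_nat (?N choose ?k) * (of_nat (m - l) :: complex) = of_nat (?N * (2 * m choose (m + Suc l)))"
    proof -
      have "(?N - ?k) * (?N choose ?k) = ?N * ((?N - 1) choose ?k)"
        using that by (intro binomial_absorb_comp) 
      moreover have "?N - ?k = m - l" "?N - 1 = 2 * m" "?k = m + Suc l" using that by simp_all
      ultimately have "(?N choose ?k) * (m - l) = ?N * (2 * m choose (m + Suc l))"
        by (metis mult.commute)
      then show ?thesis by (metis of_nat_mult)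
    qed
    have e: "2 * m - (m + l) = m - l" "2 * m - (m + Suc l) = m - l - 1" using that by auto
    have D: "((\<lambda>x. c * x ^ Suc a * (1 - x) ^ k) has_field_derivative
        c * (of_nat (Suc a) * x ^ a) * (1 - x) ^ k - c * x ^ Suc a * (of_nat k * (1 - x) ^ (k - 1))) (at x)"
      for c :: complex and a k
    proof -
      have 1: "((\<lambda>x. x ^ Suc a) has_field_derivative of_nat (Suc a) * x ^ a) (at x)"
        by (rule DERIV_cong[OF DERIV_power[OF DERIV_ident]]) simp
      have 2: "((\<lambda>x. (1 - x) ^ k) has_field_derivative - (of_nat k * (1 - x) ^ (k - 1))) (at x)"
        by (auto intro!: derivative_eq_intros)
      have 3: "A + - P * Q = A - Q * P" for A P Q :: complex by simp
      show ?thesis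
        using DERIV_mult[OF DERIV_cmult[OF 1, of c] 2] unfolding 3 .
    qed
    have "(?g has_field_derivative of_nat (?N choose ?k) * (of_nat ?k * x ^ (m + l)) * (1 - x) ^ (m - l)
        - of_nat (?N choose ?k) * x ^ ?k * (of_nat (m - l) * (1 - x) ^ (m - l - 1))) (at x)"
      using D[of "of_nat (?N choose ?k)" "m + l" "m - l"] by (simp only: Suc_eq_plus1)
    also have "of_nat (?N choose ?k) * (of_nat ?k * x ^ (m + l)) * (1 - x) ^ (m - l) = b (m + l)"
      unfolding b_def e 1[symmetric] by (simp only: mult.assoc)
    also have "of_nat (?N choose ?k) * x ^ ?k * (of_nat (m - l) * (1 - x) ^ (m - l - 1)) = b (m + Suc l)"
      unfolding b_def e 2[symmetric] by (simp only: mult_ac Suc_eq_plus1 add.assoc)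
    finally show ?thesis .
  qed
  then have "(bern m has_field_derivative (\<Sum>l\<le>m. b (m + l) - b (m + Suc l))) (at x)"
    unfolding bern_def[abs_def] by (intro DERIV_sum) auto
  also have "(\<Sum>l\<le>m. b (m + l) - b (m + Suc l)) = b m - b (m + Suc m)"
    using sum_telescope[of "\<lambda>l. b (m + l)" m] by simp
  also have "\<dots> = of_nat ((2 * m + 1) * (2 * m choose m)) * (x * (1 - x)) ^ m"
  proof -
    have "b (m + Suc m) = 0" unfolding b_def by (subst binomial_eq_0) simp_all
    moreover have "2 * m - m = m" by simp
    ultimately show ?thesis by (simp only: b_def power_mult_distrib mult.assoc diff_zero)
  qed
  finally show ?thesis .
qed

text \<open>\<open>(1 - cos \<theta>) / 2\<close>, the square of \<open>sin (\<theta> / 2)\<close>,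
  is the symbol of the operator \<open>xop\<close> below; hence \<open>fsym m\<close> is the symbol
  of \<open>enop m\<close>.\<close>

definition fsym :: "nat \<Rightarrow> complex \<Rightarrow> complex" where
  "fsym m \<theta> = bern m ((1 - cos \<theta>) / 2)"

text \<open>The first factor comes from \<open>bern_deriv\<close>; \<open>4 ^ m\<close> from
  \<open>x (1 - x) = sin^2 / 4\<close>; and 2 from the derivative \<open>sin / 2\<close> of
  \<open>(1 - cos) / 2\<close>.\<close>

definition kconst :: "nat \<Rightarrow> complex" where
  "kconst m = of_nat ((2 * m + 1) * (2 * m choose m)) / (2 * 4 ^ m)"

lemma fsym_deriv: "(fsym m has_field_derivative kconst m * sin \<theta> ^ (2 * m + 1)) (at \<theta>)"
proof -
  have "(fsym m has_field_derivative of_nat ((2 * m + 1) * (2 * m choose m)) *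
      (((1 - cos \<theta>) / 2) * (1 - (1 - cos \<theta>) / 2)) ^ m * (sin \<theta> / 2)) (at \<theta>)"
    unfolding fsym_def[abs_def]
    by (rule DERIV_chain2[OF bern_deriv]) (auto intro!: derivative_eq_intros)
  also have "((1 - cos \<theta>) / 2) * (1 - (1 - cos \<theta>) / 2) = (sin \<theta>)\<^sup>2 / 4"
  proof -
    have "(sin \<theta>)\<^sup>2 = 1 - (cos \<theta>)\<^sup>2"
      using sin_cos_squared_add[of \<theta>] by (simp add: eq_diff_eq)
    then show ?thesis by (simp only:) (simp add: field_simps power2_eq_square)
  qed
  finally show ?thesis
    by (simp add: kconst_def power_divide power_mult[symmetric] mult_ac)
qed

lemma fsym_minus: "fsym m (- \<theta>) = fsym m \<theta>"
  by (simp add: fsym_def)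

text \<open>With \<open>x = sin (\<sigma> + \<alpha>)\<close> and \<open>y = sin (\<sigma> - \<alpha>)\<close> one has \<open>(x + y)\<^sup>2 = 4 (1 - Z\<^sup>2) W\<^sup>2\<close> and
  \<open>x y = W\<^sup>2 - Z\<^sup>2\<close> for \<open>Z = cos \<sigma>\<close> and \<open>W = cos \<alpha>\<close>.\<close>
definition kpoly :: "nat \<Rightarrow> complex \<Rightarrow> complex poly" where
  "kpoly m Z = hh m [:0, 0, 4 * (1 - Z\<^sup>2):] [:- Z\<^sup>2, 0, 1:]"

lemma poly_kpoly: "poly (kpoly m Z) W = hh m (4 * (1 - Z\<^sup>2) * W\<^sup>2) (W\<^sup>2 - Z\<^sup>2)"
  unfolding kpoly_def by (subst hh_hom) (simp_all add: power2_eq_square algebra_simps)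

text \<open>Differentiate in \<open>\<alpha>\<close>. With \<open>x\<close>, \<open>y\<close> as in
  the definition of \<open>kpoly\<close>, the left side gives \<open>kconst m\<close> times
  \<open>x^(2m+1) - y^(2m+1)\<close>, which by \<open>hh_eq\<close> has the factor
  \<open>x - y = 2 * cos \<sigma> * sin \<alpha>\<close>; the chain rule on the right gives the
  same. So \<open>\<Phi>\<close> is constant.\<close>

lemma fsym_sum:
  "fsym m (\<sigma> + \<alpha>) + fsym m (\<sigma> - \<alpha>) - (fsym m (\<sigma> + \<beta>) + fsym m (\<sigma> - \<beta>))
    = - 2 * kconst m * cos \<sigma> * (poly (pint (kpoly m (cos \<sigma>))) (cos \<alpha>) - poly (pint (kpoly m (cos \<sigma>))) (cos \<beta>))"
proof -
  define \<Phi> where "\<Phi> \<alpha> = fsym m (\<sigma> + \<alpha>) + fsym m (\<sigma> - \<alpha>)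
    + 2 * kconst m * cos \<sigma> * poly (pint (kpoly m (cos \<sigma>))) (cos \<alpha>)" for \<alpha>
  have "(\<Phi> has_field_derivative 0) (at \<alpha>)" for \<alpha>
  proof -
    define x where "x = sin (\<sigma> + \<alpha>)"
    define y where "y = sin (\<sigma> - \<alpha>)"
    have xy: "x - y = 2 * cos \<sigma> * sin \<alpha>" "x + y = 2 * sin \<sigma> * cos \<alpha>"
      by (simp_all add: x_def y_def sin_add sin_diff)
    have s2: "(sin z)\<^sup>2 = 1 - (cos z)\<^sup>2" for z :: complex
      using sin_cos_squared_add[of z] by (simp add: eq_diff_eq)
    have p: "x * y = (cos \<alpha>)\<^sup>2 - (cos \<sigma>)\<^sup>2"
    proof -
      have "x * y = (sin \<sigma>)\<^sup>2 * (cos \<alpha>)\<^sup>2 - (cos \<sigma>)\<^sup>2 * (sin \<alpha>)\<^sup>2"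
        by (simp add: x_def y_def sin_add sin_diff power2_eq_square algebra_simps)
      then show ?thesis by (simp add: s2 algebra_simps)
    qed
    have q: "(x + y)\<^sup>2 = 4 * (1 - (cos \<sigma>)\<^sup>2) * (cos \<alpha>)\<^sup>2"
      unfolding xy by (simp add: power_mult_distrib s2)
    have "(\<Phi> has_field_derivative kconst m * x ^ (2 * m + 1) * 1 + kconst m * y ^ (2 * m + 1) * (- 1)
        + 2 * kconst m * cos \<sigma> * (poly (kpoly m (cos \<sigma>)) (cos \<alpha>) * (- sin \<alpha>))) (at \<alpha>)"
      unfolding \<Phi>_def[abs_def] x_def y_def
      by (intro DERIV_add DERIV_cmult DERIV_chain2[OF fsym_deriv] DERIV_chain2[OF poly_DERIV, unfolded pderiv_pint] DERIV_cos)
        (auto intro!: derivative_eq_intros)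
    also have "poly (kpoly m (cos \<sigma>)) (cos \<alpha>) = hh m ((x + y)\<^sup>2) (x * y)"
      by (simp add: poly_kpoly p q)
    also have "kconst m * x ^ (2 * m + 1) * 1 + kconst m * y ^ (2 * m + 1) * (- 1)
        + 2 * kconst m * cos \<sigma> * (hh m ((x + y)\<^sup>2) (x * y) * (- sin \<alpha>))
      = kconst m * (x ^ (2 * m + 1) - y ^ (2 * m + 1)) - kconst m * ((2 * cos \<sigma> * sin \<alpha>) * hh m ((x + y)\<^sup>2) (x * y))"
      by (simp add: algebra_simps)
    also have "\<dots> = 0"
      unfolding xy(1)[symmetric] hh_eq by simp
    finally show ?thesis .
  qed
  then obtain c where "\<Phi> \<alpha> = c" for \<alpha>
    using has_field_derivative_zero_constant[of UNIV \<Phi>] by auto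
  then have "\<Phi> \<alpha> = \<Phi> \<beta>" by metis
  then show ?thesis by (simp add: \<Phi>_def algebra_simps)
qed

text \<open>With \<open>X = cos ((\<theta>\<^sub>0 - \<theta>\<^sub>2) / 2)\<close>, \<open>Y = cos ((\<theta>\<^sub>3 - \<theta>\<^sub>1) / 2)\<close> and \<open>Z = cos ((\<theta>\<^sub>0 + \<theta>\<^sub>2) / 2)\<close>, the next
  elements stand for \<open>1 - Z\<^sup>2\<close>, \<open>X\<^sup>2 - Z\<^sup>2\<close>, \<open>Y\<^sup>2 - Z\<^sup>2\<close> and \<open>X Y - Z\<^sup>2\<close>; although \<open>X\<close>, \<open>Y\<close>, \<open>Z\<close>
  involve half angles, these combinations are Laurent polynomials.\<close>
definition one_minus_Z2 :: laurent where
  "one_minus_Z2 = const (1/4) * ((tv 0 * tv 2 - 1) * (tv 1 * tv 3 - 1))"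
definition eX :: laurent where "eX = const (- 1/4) * ((tv 0 - tvi 0) * (tv 2 - tvi 2))"
definition eY :: laurent where "eY = const (- 1/4) * ((tv 1 - tvi 1) * (tv 3 - tvi 3))"
definition eXY :: laurent where
  "eXY = const (1/4) * ((tv 0 * tv 2 - 1) * (tv 1 * tv 3 - 1) - (tv 0 * tv 1 - 1) * (tv 2 * tv 3 - 1)
    - (tv 0 * tv 3 - 1) * (tv 1 * tv 2 - 1))"
definition Z2 :: laurent where "Z2 = 1 - one_minus_Z2"

text \<open>Polynomials in the parameter \<open>s\<close> of the segment \<open>W = Y + s (X - Y)\<close>.\<close>
definition Es :: "laurent poly" where "Es = [:eY, eXY + eXY - eY - eY, eX + eY - eXY - eXY:]"
definition Ps :: "laurent poly" where "Ps = smult (const 4 * one_minus_Z2) (Es + [:Z2:])"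

text \<open>The sum is the integral over \<open>s \<in> [0, 1]\<close> of \<open>hh m Ps Es\<close>.\<close>
definition qform :: "nat \<Rightarrow> laurent" where
  "qform m = const (kconst m) *
    (\<Sum>j\<le>degree (hh m Ps Es). coeff (hh m Ps Es) j * const (1 / of_nat (Suc j)))"

definition freq :: "nat \<Rightarrow> nat \<Rightarrow> laurent" where
  "freq m i = bern m (const (1/4) * (1 + 1 - tv i - tvi i))"

lemma coeff_Jpow_mult:
  assumes "\<And>j. coeff p j \<in> Jpow a" "\<And>j. coeff q j \<in> Jpow b"
  shows "coeff (p * q) j \<in> Jpow (a + b)"
  unfolding coeff_mult by (intro Jpow_sum Jpow_mult assms)

text \<open>\<open>hh m\<close> is homogeneous of degree \<open>m\<close> in its two arguments, so
  each of its terms is a multiple of a product of \<open>m\<close> coefficients from the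
  ideal.\<close>

lemma coeff_hh_Jpow:
  assumes "\<And>j. coeff P j \<in> Jpow 1" "\<And>j. coeff E j \<in> Jpow 1"
  shows "coeff (hh m P E) j \<in> Jpow m"
  using assms
proof (induction m P E arbitrary: j rule: hh.induct[case_names 1 2 3])
  case (1 P E)
  then show ?case by (simp add: Jpow_0)
next
  case (2 P E)
  then show ?case by (simp add: Jpow_diff)
next
  case (3 m P E)
  have "coeff ((P - E - E) * hh (Suc m) P E) j \<in> Jpow (1 + Suc m)"
    using 3 by (intro coeff_Jpow_mult) (auto simp only: coeff_diff intro!: Jpow_diff)
  moreover have "coeff (E * E * hh m P E) j \<in> Jpow (1 + 1 + m)"
    using 3 by (intro coeff_Jpow_mult) auto
  ultimately show ?case by (simp add: Jpow_diff)
qed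

lemma eX_in_Jpow: "eX \<in> Jpow 1" "eY \<in> Jpow 1" "eXY \<in> Jpow 1" "one_minus_Z2 \<in> Jpow 1"
  unfolding eX_def eY_def eXY_def one_minus_Z2_def
  by (intro Jpow_mult_left Jpow_diff tv_sin_in_Jpow tv_diff_in_Jpow; simp)+

lemma qform_in_Jpow: "qform m \<in> Jpow m"
proof -
  have E: "coeff Es j \<in> Jpow 1" for j
    unfolding Es_def
    by (auto simp: coeff_pCons simp del: One_nat_def
        intro!: Jpow.add Jpow_diff Jpow_mult_left eX_in_Jpow Jpow.zero split: nat.split)
  \<comment> \<open>\<open>Z2\<close> is 1 at zero angles, hence not in the ideal; membership comes
    from the factor \<open>one_minus_Z2\<close>.\<close>
  have P: "coeff Ps j \<in> Jpow 1" for j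
    unfolding Ps_def coeff_smult by (rule Jpow_mult_right, rule Jpow_mult_left, rule eX_in_Jpow)
  show ?thesis
    unfolding qform_def by (intro Jpow_mult_left Jpow_sum Jpow_mult_right coeff_hh_Jpow E P)
qed

section \<open>The divisibility identity, verified on characters\<close>

lemma ev_hh_poly:
  "map_poly (ev \<theta>) (hh m P E) = hh m (map_poly (ev \<theta>) P) (map_poly (ev \<theta>) E)"
proof (rule hh_hom)
  show "map_poly (ev \<theta>) 1 = 1"
    by (simp add: map_poly_1)
  show "map_poly (ev \<theta>) (p - q) = map_poly (ev \<theta>) p - map_poly (ev \<theta>) q" for p q
    by (intro poly_eqI) (simp add: coeff_map_poly)
  show "map_poly (ev \<theta>) (p * q) = map_poly (ev \<theta>) p * map_poly (ev \<theta>) q" for p q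
    by (intro poly_eqI) (simp add: coeff_map_poly coeff_mult)
qed

lemma ev_segment:
  assumes "\<theta> 0 + \<theta> 1 + \<theta> 2 + \<theta> 3 = 0"
  defines "X \<equiv> cos ((\<theta> 0 - \<theta> 2) / 2)" and "Y \<equiv> cos ((\<theta> 3 - \<theta> 1) / 2)" and "Z \<equiv> cos ((\<theta> 0 + \<theta> 2) / 2)"
  shows "ev \<theta> one_minus_Z2 = 1 - Z\<^sup>2" "ev \<theta> eX = X\<^sup>2 - Z\<^sup>2" "ev \<theta> eY = Y\<^sup>2 - Z\<^sup>2"
    "ev \<theta> eXY = X * Y - Z\<^sup>2"
proof -
  \<comment> \<open>In terms of the exponentials of half angles, \<open>th\<close> makes every
    \<open>t_i\<close> a monomial, and the four claims become identities of rational functions in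
    \<open>a\<close>, \<open>b\<close>, \<open>s\<close>.\<close>
  define a where "a = exp (\<i> * ((\<theta> 0 - \<theta> 2) / 2))"
  define b where "b = exp (\<i> * ((\<theta> 3 - \<theta> 1) / 2))"
  define s where "s = exp (\<i> * ((\<theta> 0 + \<theta> 2) / 2))"
  have nz: "a \<noteq> 0" "b \<noteq> 0" "s \<noteq> 0" by (simp_all add: a_def b_def s_def)
  have "q = - ((p + r) / 2) - (u - q) / 2 \<and> u = (u - q) / 2 - (p + r) / 2"
    if "p + q + r + u = 0" for p q r u :: complex
  proof -
    have q: "q = - (p + r + u)"
      by (rule minus_unique[symmetric]) (use that in \<open>simp add: ac_simps\<close>)
    show ?thesis unfolding q by (simp add: field_simps)
  qed
  from this[OF assms(1)] have e1: "\<theta> 1 = - ((\<theta> 0 + \<theta> 2) / 2) - (\<theta> 3 - \<theta> 1) / 2"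
    and e3: "\<theta> 3 = (\<theta> 3 - \<theta> 1) / 2 - (\<theta> 0 + \<theta> 2) / 2"
    by blast+
  have e0: "\<theta> 0 = (\<theta> 0 + \<theta> 2) / 2 + (\<theta> 0 - \<theta> 2) / 2"
    and e2: "\<theta> 2 = (\<theta> 0 + \<theta> 2) / 2 - (\<theta> 0 - \<theta> 2) / 2"
    by (simp_all add: field_simps)
  have ex: "exp (\<i> * (x + y)) = exp (\<i> * x) * exp (\<i> * y)"
      "exp (\<i> * (x - y)) = exp (\<i> * x) / exp (\<i> * y)"
      "exp (\<i> * (- x - y)) = 1 / (exp (\<i> * x) * exp (\<i> * y))" for x y
    by (simp_all add: distrib_left right_diff_distrib exp_add exp_diff exp_minus divide_inverse)
  have th: "exp (\<i> * \<theta> 0) = s * a" "exp (\<i> * \<theta> 2) = s / a" "exp (\<i> * \<theta> 1) = 1 / (s * b)" "exp (\<i> * \<theta> 3) = b / s"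
    unfolding a_def b_def s_def
    by (subst e0, rule ex) (subst e2, rule ex, subst e1, rule ex, subst e3, rule ex)
  have cos: "X = (a + 1 / a) / 2" "Y = (b + 1 / b) / 2" "Z = (s + 1 / s) / 2"
    by (simp_all add: X_def Y_def Z_def cos_exp_eq a_def b_def s_def exp_minus inverse_eq_divide)
  have tv: "ev \<theta> (tv i) = exp (\<i> * \<theta> i)" "ev \<theta> (tvi i) = 1 / exp (\<i> * \<theta> i)" if "i < 4" for i
    using ev_tv[OF assms(1) that] by (simp_all add: exp_minus inverse_eq_divide)
  show "ev \<theta> one_minus_Z2 = 1 - Z\<^sup>2"
    unfolding one_minus_Z2_def cos
    by (simp add: tv th del: One_nat_def) (simp add: nz field_simps power2_eq_square)
  show "ev \<theta> eX = X\<^sup>2 - Z\<^sup>2"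
    unfolding eX_def cos
    by (simp add: tv th del: One_nat_def) (simp add: nz field_simps power2_eq_square)
  show "ev \<theta> eY = Y\<^sup>2 - Z\<^sup>2"
    unfolding eY_def cos
    by (simp add: tv th del: One_nat_def) (simp add: nz field_simps power2_eq_square)
  show "ev \<theta> eXY = X * Y - Z\<^sup>2"
    unfolding eXY_def cos
    by (simp add: tv th del: One_nat_def) (simp add: nz field_simps power2_eq_square)
qed

lemma ev_hom_map_poly:
  "map_poly (ev \<theta>) (p + q) = map_poly (ev \<theta>) p + map_poly (ev \<theta>) q"
  "map_poly (ev \<theta>) (smult c p) = smult (ev \<theta> c) (map_poly (ev \<theta>) p)"
  by (intro poly_eqI; simp add: coeff_map_poly)+

text \<open>Under \<open>ev\<close>, the polynomial \<open>hh m Ps Es\<close> becomes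
  \<open>kpoly m Z\<close> along the segment from \<open>Y\<close> to \<open>X\<close>, and
  \<open>qform m\<close> its integral times \<open>kconst m\<close>;
  \<open>poly_pint_pcompose_lin\<close> evaluates the integral.\<close>

lemma ev_qform:
  assumes "\<theta> 0 + \<theta> 1 + \<theta> 2 + \<theta> 3 = 0"
  defines "X \<equiv> cos ((\<theta> 0 - \<theta> 2) / 2)" and "Y \<equiv> cos ((\<theta> 3 - \<theta> 1) / 2)" and "Z \<equiv> cos ((\<theta> 0 + \<theta> 2) / 2)"
  shows "(X - Y) * ev \<theta> (qform m) = kconst m * (poly (pint (kpoly m Z)) X - poly (pint (kpoly m Z)) Y)"
proof -
  note seg = ev_segment[OF assms(1), folded X_def Y_def Z_def]
  let ?h = "hh m Ps Es" and ?l = "[:Y, X - Y:]"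
  have E: "map_poly (ev \<theta>) Es = pcompose [:- Z\<^sup>2, 0, 1:] ?l"
    by (simp add: Es_def map_poly_pCons seg pcompose_pCons power2_eq_square algebra_simps)
  have P: "map_poly (ev \<theta>) Ps = pcompose [:0, 0, 4 * (1 - Z\<^sup>2):] ?l"
    by (simp add: Ps_def Z2_def ev_hom_map_poly E map_poly_pCons seg pcompose_pCons power2_eq_square algebra_simps)
  have "map_poly (ev \<theta>) ?h = pcompose (kpoly m Z) ?l"
    unfolding ev_hh_poly E P kpoly_def
    by (rule hh_hom[symmetric]) (simp_all add: pcompose_diff pcompose_mult pcompose_1)
  moreover have "poly (pint (map_poly (ev \<theta>) ?h)) 1
      = (\<Sum>j\<le>degree ?h. coeff (map_poly (ev \<theta>) ?h) j / of_nat (Suc j))"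
    by (rule poly_pint_1) (simp add: degree_le coeff_map_poly coeff_eq_0)
  moreover have "ev \<theta> (qform m) = kconst m * (\<Sum>j\<le>degree ?h. coeff (map_poly (ev \<theta>) ?h) j / of_nat (Suc j))"
    by (simp add: qform_def coeff_map_poly)
  ultimately have "ev \<theta> (qform m) = kconst m * poly (pint (pcompose (kpoly m Z) ?l)) 1"
    by simp
  then show ?thesis
    using poly_pint_pcompose_lin[of X Y "kpoly m Z"] by (simp add: mult.left_commute)
qed

lemma ev_bern: "ev \<theta> (bern m x) = bern m (ev \<theta> x)"
  by (simp add: bern_def)

lemma ev_freq:
  assumes "\<theta> 0 + \<theta> 1 + \<theta> 2 + \<theta> 3 = 0" "i < 4"
  shows "ev \<theta> (freq m i) = fsym m (\<theta> i)"
proof -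
  have "(1/4) * (1 + 1 - exp (\<i> * \<theta> i) - exp (- (\<i> * \<theta> i))) = (1 - cos (\<theta> i)) / 2"
    by (simp add: cos_exp_eq field_simps)
  moreover have "ev \<theta> (const (1/4) * (1 + 1 - tv i - tvi i)) = (1/4) * (1 + 1 - exp (\<i> * \<theta> i) - exp (- (\<i> * \<theta> i)))"
    by (simp only: ev_simps ev_tv[OF assms])
  ultimately show ?thesis
    by (simp only: freq_def fsym_def ev_bern)
qed

text \<open>The divisibility by the resonance function. On characters the bracket is
  \<open>4 * cos \<sigma> * (cos \<alpha> - cos \<beta>)\<close>, so \<open>fsym_sum\<close> and
  \<open>ev_qform\<close> give the same value for both sides; \<open>-1/2\<close> reconciles this 4
  with the factor \<open>-2\<close> of \<open>fsym_sum\<close>.\<close>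

lemma freq_identity:
  "freq m 0 + freq m 2 - freq m 1 - freq m 3 = const (- 1/2) *
    ((tv 0 + tvi 0 + tv 2 + tvi 2 - tv 1 - tvi 1 - tv 3 - tvi 3) * qform m)"
proof (rule ev_eqI)
  fix \<theta> :: "nat \<Rightarrow> complex" assume \<theta>: "\<theta> 0 + \<theta> 1 + \<theta> 2 + \<theta> 3 = 0"
  define \<sigma> where "\<sigma> = (\<theta> 0 + \<theta> 2) / 2"
  define \<alpha> where "\<alpha> = (\<theta> 0 - \<theta> 2) / 2"
  define \<beta> where "\<beta> = (\<theta> 3 - \<theta> 1) / 2"
  have "q = - ((p + r) / 2 + (u - q) / 2) \<and> u = - ((p + r) / 2 - (u - q) / 2)"
    if "p + q + r + u = 0" for p q r u :: complex
  proof -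
    have q: "q = - (p + r + u)"
      by (rule minus_unique[symmetric]) (use that in \<open>simp add: ac_simps\<close>)
    show ?thesis unfolding q by (simp add: field_simps)
  qed
  from this[OF \<theta>] have e: "\<theta> 1 = - (\<sigma> + \<beta>)" "\<theta> 3 = - (\<sigma> - \<beta>)" "\<theta> 0 = \<sigma> + \<alpha>" "\<theta> 2 = \<sigma> - \<alpha>"
    unfolding \<sigma>_def \<alpha>_def \<beta>_def by (blast, blast, simp_all add: field_simps)
  have cs: "ev \<theta> (tv i) + ev \<theta> (tvi i) = 2 * cos (\<theta> i)" if "i < 4" for i
    using ev_tv[OF \<theta> that] by (simp add: cos_exp_eq)
  have "ev \<theta> (tv 0 + tvi 0 + tv 2 + tvi 2 - tv 1 - tvi 1 - tv 3 - tvi 3)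
      = (ev \<theta> (tv 0) + ev \<theta> (tvi 0)) + (ev \<theta> (tv 2) + ev \<theta> (tvi 2))
        - (ev \<theta> (tv 1) + ev \<theta> (tvi 1)) - (ev \<theta> (tv 3) + ev \<theta> (tvi 3))"
    by simp
  also have "\<dots> = 4 * cos \<sigma> * (cos \<alpha> - cos \<beta>)"
    unfolding cs[of 0, simplified] cs[of 1, simplified One_nat_def, simplified, folded One_nat_def] cs[of 2, simplified] cs[of 3, simplified] e cos_minus
    by (simp add: cos_add cos_diff algebra_simps)
  finally have "ev \<theta> (const (- 1/2) * ((tv 0 + tvi 0 + tv 2 + tvi 2 - tv 1 - tvi 1 - tv 3 - tvi 3) * qform m))
      = - 2 * cos \<sigma> * ((cos \<alpha> - cos \<beta>) * ev \<theta> (qform m))"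
    by (simp only: ev_simps) simp
  also have "\<dots> = fsym m (\<sigma> + \<alpha>) + fsym m (\<sigma> - \<alpha>) - (fsym m (\<sigma> + \<beta>) + fsym m (\<sigma> - \<beta>))"
    unfolding fsym_sum using ev_qform[OF \<theta>, of m] by (simp add: \<sigma>_def \<alpha>_def \<beta>_def)
  also have "\<dots> = fsym m (\<theta> 0) + fsym m (\<theta> 2) - fsym m (\<theta> 1) - fsym m (\<theta> 3)"
    unfolding e fsym_minus by simp
  also have "\<dots> = ev \<theta> (freq m 0 + freq m 2 - freq m 1 - freq m 3)"
    using ev_freq[OF \<theta>] by simp
  finally show "ev \<theta> (freq m 0 + freq m 2 - freq m 1 - freq m 3) = ev \<theta> (const (- 1/2) *
    ((tv 0 + tvi 0 + tv 2 + tvi 2 - tv 1 - tvi 1 - tv 3 - tvi 3) * qform m))" by simp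
qed

section \<open>Estimates for the multilinear forms\<close>

text \<open>The size that scaling and interpolation predict for the first \<open>m + 1\<close> differences of a
  function with \<open>\<parallel>fdiff f\<parallel> \<le> M\<close>, sup norm \<open>\<rho>\<close> and frequencies up to \<open>r\<close>.\<close>
definition regular :: "nat \<Rightarrow> real \<Rightarrow> real \<Rightarrow> real \<Rightarrow> real \<Rightarrow> ell2 \<Rightarrow> bool" where
  "regular m M \<rho> r c f \<longleftrightarrow>
     (\<forall>a. 1 \<le> a \<and> a \<le> m + 1 \<longrightarrow> norm ((fdiff ^^ a) f) \<le> c * M * r ^ (a - 1)) \<and>
     (\<forall>a\<le>m. \<forall>k. cmod (seq ((fdiff ^^ a) f) k) \<le> c * \<rho> * r ^ a)"

lemma regular_conj2: "regular m M \<rho> r c f \<Longrightarrow> regular m M \<rho> r c (conj2 f)"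
  by (simp add: regular_def)

lemma fdiff_funpow_mult:
  "(fdiff ^^ Suc a) ((fdiff ^^ i) f * shift s ((fdiff ^^ j) g))
    = (fdiff ^^ a) ((fdiff ^^ Suc i) f * shift (s + 1) ((fdiff ^^ j) g))
      + (fdiff ^^ a) ((fdiff ^^ i) f * shift s ((fdiff ^^ Suc j) g))"
proof -
  have 1: "fdiff ((fdiff ^^ i) f * shift s ((fdiff ^^ j) g))
    = (fdiff ^^ Suc i) f * shift (s + 1) ((fdiff ^^ j) g) + (fdiff ^^ i) f * shift s ((fdiff ^^ Suc j) g)"
    by (simp add: fdiff_mult add.commute)
  have 2: "(fdiff ^^ Suc a) y = (fdiff ^^ a) (fdiff y)" for y
    by (simp add: funpow_swap1)
  show ?thesis
    unfolding 2 1 by (rule funpow_fdiff_simps(1))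
qed

text \<open>Leibniz rule: each difference doubles the number of terms, whence the power of 2. In the
  \<open>l^2\<close> bound, a factor that carries a difference is measured in \<open>l^2\<close> and
  the other in the sup norm; with at most \<open>m + 1\<close> differences in total, the latter has
  at most \<open>m\<close>.\<close>

lemma regular_mult:
  assumes f: "regular m M \<rho> r c f" and g: "regular m M \<rho> r d g"
    and nn: "0 \<le> c" "0 \<le> d" "0 \<le> M" "0 \<le> \<rho>" "0 \<le> r"
  shows "regular m M \<rho> r (2 ^ (m + 1) * \<rho> * c * d) (f * g)"
proof -
  have f1: "norm ((fdiff ^^ a) f) \<le> c * M * r ^ (a - 1)" if "1 \<le> a" "a \<le> m + 1" for a
    using f that by (auto simp: regular_def)
  have f2: "cmod (seq ((fdiff ^^ a) f) k) \<le> c * \<rho> * r ^ a" if "a \<le> m" for a k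
    using f that by (auto simp: regular_def)
  have g1: "norm ((fdiff ^^ a) g) \<le> d * M * r ^ (a - 1)" if "1 \<le> a" "a \<le> m + 1" for a
    using g that by (auto simp: regular_def)
  have g2: "cmod (seq ((fdiff ^^ a) g) k) \<le> d * \<rho> * r ^ a" if "a \<le> m" for a k
    using g that by (auto simp: regular_def)
  \<comment> \<open>\<open>i\<close> and \<open>j\<close> count the differences already on the
    factors, \<open>a\<close> those still outside; the shift \<open>s\<close> is produced by the
    product rule.\<close>
  have 1: "norm ((fdiff ^^ a) ((fdiff ^^ i) f * shift s ((fdiff ^^ j) g)))
      \<le> 2 ^ a * (\<rho> * c * d * M * r ^ (i + j + a - 1))" if "1 \<le> i + j + a" "i + j + a \<le> m + 1" for a i j s
    using that
  proof (induction a arbitrary: i j s)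
    case 0
    show ?case
    proof (cases "i = 0")
      case True
      have "norm (f * shift s ((fdiff ^^ j) g)) \<le> (c * \<rho>) * norm (shift s ((fdiff ^^ j) g))"
        using f2[of 0] by (intro norm_mult_bounded) simp
      also have "\<dots> \<le> (c * \<rho>) * (d * M * r ^ (j - 1))"
        using 0 True g1[of j] nn by (intro mult_left_mono) auto
      finally show ?thesis using True by (simp add: mult_ac)
    next
      case False
      have "norm (shift s ((fdiff ^^ j) g) * (fdiff ^^ i) f) \<le> (d * \<rho> * r ^ j) * norm ((fdiff ^^ i) f)"
        using 0 False g2[of j] by (intro norm_mult_bounded) simp
      also have "\<dots> \<le> (d * \<rho> * r ^ j) * (c * M * r ^ (i - 1))"
        using 0 False f1[of i] nn by (intro mult_left_mono) auto
      also have "\<dots> = \<rho> * c * d * M * r ^ (i + j - 1)"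
        using False by (cases i) (simp_all add: power_add mult_ac)
      finally show ?thesis by (simp add: mult.commute)
    qed
  next
    case (Suc a)
    have "norm ((fdiff ^^ Suc a) ((fdiff ^^ i) f * shift s ((fdiff ^^ j) g)))
        \<le> norm ((fdiff ^^ a) ((fdiff ^^ Suc i) f * shift (s + 1) ((fdiff ^^ j) g)))
          + norm ((fdiff ^^ a) ((fdiff ^^ i) f * shift s ((fdiff ^^ Suc j) g)))"
      unfolding fdiff_funpow_mult by (rule norm_triangle_ineq)
    also have "\<dots> \<le> 2 ^ a * (\<rho> * c * d * M * r ^ (Suc i + j + a - 1)) + 2 ^ a * (\<rho> * c * d * M * r ^ (i + Suc j + a - 1))"
      using Suc.prems by (intro add_mono[OF Suc.IH Suc.IH]) simp_all
    also have "\<dots> = 2 ^ Suc a * (\<rho> * c * d * M * r ^ (i + j + Suc a - 1))"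
      by simp
    finally show ?case .
  qed
  have 2: "cmod (seq ((fdiff ^^ a) ((fdiff ^^ i) f * shift s ((fdiff ^^ j) g))) k)
      \<le> 2 ^ a * (\<rho> * c * d * \<rho> * r ^ (i + j + a))" if "i + j + a \<le> m" for a i j s k
    using that
  proof (induction a arbitrary: i j s)
    case 0
    have "cmod (seq ((fdiff ^^ i) f) k) * cmod (seq ((fdiff ^^ j) g) (k + s)) \<le> (c * \<rho> * r ^ i) * (d * \<rho> * r ^ j)"
      using 0 nn by (intro mult_mono f2 g2) auto
    then show ?case by (simp add: norm_mult power_add mult_ac)
  next
    case (Suc a)
    have "cmod (seq ((fdiff ^^ Suc a) ((fdiff ^^ i) f * shift s ((fdiff ^^ j) g))) k)
        \<le> cmod (seq ((fdiff ^^ a) ((fdiff ^^ Suc i) f * shift (s + 1) ((fdiff ^^ j) g))) k)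
          + cmod (seq ((fdiff ^^ a) ((fdiff ^^ i) f * shift s ((fdiff ^^ Suc j) g))) k)"
      unfolding fdiff_funpow_mult seq_simps by (rule norm_triangle_ineq)
    also have "\<dots> \<le> 2 ^ a * (\<rho> * c * d * \<rho> * r ^ (Suc i + j + a)) + 2 ^ a * (\<rho> * c * d * \<rho> * r ^ (i + Suc j + a))"
      using Suc.prems by (intro add_mono[OF Suc.IH Suc.IH]) simp_all
    also have "\<dots> = 2 ^ Suc a * (\<rho> * c * d * \<rho> * r ^ (i + j + Suc a))"
      by simp
    finally show ?case .
  qed
  show ?thesis
    unfolding regular_def
  proof (intro conjI allI impI)
    fix a assume a: "1 \<le> a \<and> a \<le> m + 1"
    have "norm ((fdiff ^^ a) (f * g)) \<le> 2 ^ a * (\<rho> * c * d * M * r ^ (a - 1))"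
      using 1[of 0 0 a 0] a by simp
    also have "\<dots> \<le> 2 ^ (m + 1) * (\<rho> * c * d * M * r ^ (a - 1))"
      using a nn by (intro mult_right_mono power_increasing) auto
    finally show "norm ((fdiff ^^ a) (f * g)) \<le> 2 ^ (m + 1) * \<rho> * c * d * M * r ^ (a - 1)"
      by (simp add: mult_ac)
  next
    fix a k assume a: "a \<le> m"
    have "cmod (seq ((fdiff ^^ a) (f * g)) k) \<le> 2 ^ a * (\<rho> * c * d * \<rho> * r ^ a)"
      using 2[of 0 0 a 0] a by simp
    also have "\<dots> \<le> 2 ^ (m + 1) * (\<rho> * c * d * \<rho> * r ^ a)"
      using a nn by (intro mult_right_mono power_increasing) auto
    finally show "cmod (seq ((fdiff ^^ a) (f * g)) k) \<le> 2 ^ (m + 1) * \<rho> * c * d * \<rho> * r ^ a"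
      by (simp add: mult_ac)
  qed
qed

lemma cmod_pair4_le:
  assumes "\<And>k. cmod (seq a k) \<le> A" "\<And>k. cmod (seq b k) \<le> B"
  shows "cmod (pair (a * b) (c * d)) \<le> A * B * (norm c * norm d)"
proof -
  have "0 \<le> A" using assms(1)[of 0] norm_ge_zero order_trans by blast
  have "pair (a * b) (c * d) = pair (a * (b * c)) d"
    by (simp add: pair_mult mult.assoc)
  also have "cmod \<dots> \<le> norm (a * (b * c)) * norm d"
    by (rule cmod_pair_le)
  also have "\<dots> \<le> A * norm (b * c) * norm d"
    by (intro mult_right_mono norm_mult_bounded assms) simp
  also have "\<dots> \<le> A * (B * norm c) * norm d"
    using \<open>0 \<le> A\<close> by (intro mult_right_mono mult_left_mono norm_mult_bounded assms) simp_all
  finally show ?thesis by (simp add: mult.assoc)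
qed

text \<open>Hoelder's inequality with two arguments in \<open>l^2\<close> and two in the sup norm.
  The summand is a pointwise product, so any two arguments can be regrouped into the
  \<open>l^2\<close> places; this gives the six cases.\<close>

lemma cmod_base_le:
  assumes "\<And>i k. i < 4 \<Longrightarrow> cmod (seq (w i) k) \<le> A i" "i < 4" "j < 4" "i \<noteq> j"
  shows "cmod (base s w) \<le> norm (w i) * norm (w j) * (\<Prod>k\<in>{..<4} - {i, j}. A k)"
proof -
  obtain a b c where s: "s = (a, b, c)" by (cases s)
  let ?w0 = "shift a (w 0)" and ?w1 = "shift b (w 1)" and ?w2 = "shift c (w 2)" and ?w3 = "w 3"
  have A: "cmod (seq ?w0 k) \<le> A 0" "cmod (seq ?w1 k) \<le> A 1" "cmod (seq ?w2 k) \<le> A 2" "cmod (seq ?w3 k) \<le> A 3" for k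
    using assms(1) by simp_all
  consider "i = 0 \<and> j = 1 \<or> i = 1 \<and> j = 0" | "i = 0 \<and> j = 2 \<or> i = 2 \<and> j = 0" | "i = 0 \<and> j = 3 \<or> i = 3 \<and> j = 0"
    | "i = 1 \<and> j = 2 \<or> i = 2 \<and> j = 1" | "i = 1 \<and> j = 3 \<or> i = 3 \<and> j = 1" | "i = 2 \<and> j = 3 \<or> i = 3 \<and> j = 2"
    by (rule less4_cases[OF assms(2)]; rule less4_cases[OF assms(3)]) (use assms(4) in auto)
  then show ?thesis
  proof cases
    case 1
    have "{..<4} - {i, j} = {2, 3}"
      using 1 by (auto elim: less4_cases)
    then have R: "(\<Prod>k\<in>{..<4} - {i, j}. A k) = A 2 * A 3"
      by simp
    have B: "base s w = pair (?w2 * ?w3) (?w0 * ?w1)"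
      by (simp add: base_def s pair_def mult_ac)
    have "cmod (pair (?w2 * ?w3) (?w0 * ?w1)) \<le> A 2 * A 3 * (norm ?w0 * norm ?w1)"
      by (rule cmod_pair4_le) (rule A)+
    then show ?thesis using 1 unfolding R B by (auto simp: mult_ac)
  next
    case 2
    have "{..<4} - {i, j} = {1, 3}"
      using 2 by (auto elim: less4_cases)
    then have R: "(\<Prod>k\<in>{..<4} - {i, j}. A k) = A 1 * A 3"
      by simp
    have B: "base s w = pair (?w1 * ?w3) (?w0 * ?w2)"
      by (simp add: base_def s pair_def mult_ac)
    have "cmod (pair (?w1 * ?w3) (?w0 * ?w2)) \<le> A 1 * A 3 * (norm ?w0 * norm ?w2)"
      by (rule cmod_pair4_le) (rule A)+
    then show ?thesis using 2 unfolding R B by (auto simp: mult_ac)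
  next
    case 3
    have "{..<4} - {i, j} = {1, 2}"
      using 3 by (auto elim: less4_cases)
    then have R: "(\<Prod>k\<in>{..<4} - {i, j}. A k) = A 1 * A 2"
      by simp
    have B: "base s w = pair (?w1 * ?w2) (?w0 * ?w3)"
      by (simp add: base_def s pair_def mult_ac)
    have "cmod (pair (?w1 * ?w2) (?w0 * ?w3)) \<le> A 1 * A 2 * (norm ?w0 * norm ?w3)"
      by (rule cmod_pair4_le) (rule A)+
    then show ?thesis using 3 unfolding R B by (auto simp: mult_ac)
  next
    case 4
    have "{..<4} - {i, j} = {0, 3}"
      using 4 by (auto elim: less4_cases)
    then have R: "(\<Prod>k\<in>{..<4} - {i, j}. A k) = A 0 * A 3"
      by simp
    have B: "base s w = pair (?w0 * ?w3) (?w1 * ?w2)"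
      by (simp add: base_def s pair_def mult_ac)
    have "cmod (pair (?w0 * ?w3) (?w1 * ?w2)) \<le> A 0 * A 3 * (norm ?w1 * norm ?w2)"
      by (rule cmod_pair4_le) (rule A)+
    then show ?thesis using 4 unfolding R B by (auto simp: mult_ac)
  next
    case 5
    have "{..<4} - {i, j} = {0, 2}"
      using 5 by (auto elim: less4_cases)
    then have R: "(\<Prod>k\<in>{..<4} - {i, j}. A k) = A 0 * A 2"
      by simp
    have B: "base s w = pair (?w0 * ?w2) (?w1 * ?w3)"
      by (simp add: base_def s pair_def mult_ac)
    have "cmod (pair (?w0 * ?w2) (?w1 * ?w3)) \<le> A 0 * A 2 * (norm ?w1 * norm ?w3)"
      by (rule cmod_pair4_le) (rule A)+
    then show ?thesis using 5 unfolding R B by (auto simp: mult_ac)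
  next
    case 6
    have "{..<4} - {i, j} = {0, 1}"
      using 6 by (auto elim: less4_cases)
    then have R: "(\<Prod>k\<in>{..<4} - {i, j}. A k) = A 0 * A 1"
      by simp
    have B: "base s w = pair (?w0 * ?w1) (?w2 * ?w3)"
      by (simp add: base_def s pair_def mult_ac)
    have "cmod (pair (?w0 * ?w1) (?w2 * ?w3)) \<le> A 0 * A 1 * (norm ?w2 * norm ?w3)"
      by (rule cmod_pair4_le) (rule A)+
    then show ?thesis using 6 unfolding R B by (auto simp: mult_ac)
  qed
qed

lemma cmod_form_le:
  assumes "\<And>s. cmod (base s w) \<le> K"
  shows "cmod (form r w) \<le> (\<Sum>s\<in>Poly_Mapping.keys r. cmod (Poly_Mapping.lookup r s)) * K"
  unfolding form_def extend_def sum_distrib_right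
  by (rule sum_norm_le) (simp add: norm_mult mult_left_mono assms)

text \<open>Two arguments are measured in \<open>l^2\<close>, giving \<open>M\<^sup>2\<close>, and
  two in the sup norm, giving \<open>\<rho>\<^sup>2\<close>. In \<open>regular\<close>, an
  \<open>l^2\<close> bound has one power of \<open>r\<close> less than its number of differences,
  which leaves \<open>2 * m - 2\<close> of \<open>2 * m\<close> powers.\<close>

definition form_bounded :: "nat \<Rightarrow> laurent \<Rightarrow> real \<Rightarrow> bool" where
  "form_bounded m p C \<longleftrightarrow> (\<forall>M \<rho> r c w. 0 \<le> M \<longrightarrow> 0 \<le> \<rho> \<longrightarrow> 0 \<le> r \<longrightarrow>
    (\<forall>i<4. 0 \<le> c i \<and> regular m M \<rho> r (c i) (w i)) \<longrightarrow>
    cmod (form p w) \<le> C * (\<Prod>i<4. c i) * M\<^sup>2 * \<rho>\<^sup>2 * r ^ (2 * m - 2))"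

text \<open>No argument carries more than \<open>m\<close> of the \<open>2 * m\<close> differences,
  so at least two arguments carry some; these two are put in \<open>l^2\<close>, and the others have
  sup bounds up to order \<open>m\<close>.\<close>

lemma form_Jpow_le:
  assumes "p \<in> Jpow m" "1 \<le> m"
  shows "\<exists>C\<ge>0. form_bounded m p C"
  using assms(1)
proof (induction rule: Jpow.induct)
  case zero
  show ?case by (rule exI[of _ 0]) (simp add: form_bounded_def)
next
  case (add p q)
  obtain C where C: "0 \<le> C" "form_bounded m p C" using add.IH(1) by blast
  obtain D where D: "0 \<le> D" "form_bounded m q D" using add.IH(2) by blast
  have "form_bounded m (p + q) (C + D)"
    unfolding form_bounded_def
  proof (intro allI impI)
    fix M \<rho> r :: real and c :: "nat \<Rightarrow> real" and w :: "nat \<Rightarrow> ell2"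
    assume *: "0 \<le> M" "0 \<le> \<rho>" "0 \<le> r" "\<forall>i<4. 0 \<le> c i \<and> regular m M \<rho> r (c i) (w i)"
    have "cmod (form (p + q) w) \<le> cmod (form p w) + cmod (form q w)"
      by (simp add: norm_triangle_ineq)
    then show "cmod (form (p + q) w) \<le> (C + D) * (\<Prod>i<4. c i) * M\<^sup>2 * \<rho>\<^sup>2 * r ^ (2 * m - 2)"
      using C(2)[unfolded form_bounded_def, rule_format, of M \<rho> r c w] 
        D(2)[unfolded form_bounded_def, rule_format, of M \<rho> r c w] * by (simp add: distrib_right)
  qed
  then show ?case using C(1) D(1) by (intro exI[of _ "C + D"]) simp
next
  case (mon \<alpha> r0)
  have fin: "finite ({..<4} :: nat set)" by simp
  have "\<exists>i<4. 1 \<le> \<alpha> i"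
  proof (rule ccontr)
    assume "\<not> (\<exists>i<4. 1 \<le> \<alpha> i)"
    then have "(\<Sum>i<4. \<alpha> i) = 0" by (intro sum.neutral) (auto simp: not_le)
    then show False using mon(2) assms(2) by simp
  qed
  then obtain i where i: "i < 4" "1 \<le> \<alpha> i" by blast
  have "\<exists>j<4. j \<noteq> i \<and> 1 \<le> \<alpha> j"
  proof (rule ccontr)
    assume "\<not> (\<exists>j<4. j \<noteq> i \<and> 1 \<le> \<alpha> j)"
    then have "(\<Sum>j\<in>{..<4} - {i}. \<alpha> j) = 0" by (intro sum.neutral) (auto simp: not_le)
    then have "(\<Sum>j<4. \<alpha> j) = \<alpha> i" using i(1) by (subst sum.remove[of _ i]) simp_all
    moreover have "\<alpha> i \<le> m" using mon(1) i(1) by blast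
    ultimately show False using mon(2) assms(2) by linarith
  qed
  then obtain j where j: "j < 4" "j \<noteq> i" "1 \<le> \<alpha> j" by blast
  let ?R = "{..<4} - {i, j}"
  let ?C = "\<Sum>s\<in>Poly_Mapping.keys r0. cmod (Poly_Mapping.lookup r0 s)"
  have R: "{..<4} - {i} - {j} = ?R" by auto
  have split: "(\<Prod>k<4. h k) = h i * (h j * (\<Prod>k\<in>?R. h k))" for h :: "nat \<Rightarrow> real"
  proof -
    have "(\<Prod>k<4. h k) = h i * prod h ({..<4} - {i})"
      by (rule prod.remove) (use i in simp_all)
    also have "prod h ({..<4} - {i}) = h j * prod h ({..<4} - {i} - {j})"
      by (rule prod.remove) (use j in simp_all)
    finally show ?thesis unfolding R .
  qed
  have "\<alpha> i + (\<alpha> j + (\<Sum>k\<in>?R. \<alpha> k)) = 2 * m"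
  proof -
    have "(\<Sum>k<4. \<alpha> k) = \<alpha> i + sum \<alpha> ({..<4} - {i})"
      by (rule sum.remove) (use i in simp_all)
    also have "sum \<alpha> ({..<4} - {i}) = \<alpha> j + sum \<alpha> ({..<4} - {i} - {j})"
      by (rule sum.remove) (use j in simp_all)
    finally show ?thesis unfolding R mon(2) by simp
  qed
  then have ex: "(\<alpha> i - 1) + ((\<alpha> j - 1) + (\<Sum>k\<in>?R. \<alpha> k)) = 2 * m - 2"
    using i j by linarith
  have card: "card ?R = 2" using i j by (simp add: card_Diff_subset)
  have "form_bounded m (r0 * (\<Prod>i<4. dv i ^ \<alpha> i)) ?C"
    unfolding form_bounded_def
  proof (intro allI impI)
    fix M \<rho> r :: real and c :: "nat \<Rightarrow> real" and w :: "nat \<Rightarrow> ell2"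
    assume nn: "0 \<le> M" "0 \<le> \<rho>" "0 \<le> r" and reg: "\<forall>i<4. 0 \<le> c i \<and> regular m M \<rho> r (c i) (w i)"
    let ?v = "\<lambda>i. if i < 4 then (fdiff ^^ \<alpha> i) (w i) else w i"
    have sup: "cmod (seq (?v k) x) \<le> c k * \<rho> * r ^ \<alpha> k" if "k < 4" for k x
      using reg mon(1) that by (auto simp: regular_def)
    have l2: "norm (?v k) \<le> c k * M * r ^ (\<alpha> k - 1)" if "k < 4" "1 \<le> \<alpha> k" for k
    proof -
      have "\<alpha> k \<le> m + 1" using mon(1) that(1) by fastforce
      then show ?thesis using reg that unfolding regular_def by auto
    qed
    have "cmod (base s ?v) \<le> (c i * M * r ^ (\<alpha> i - 1)) * (c j * M * r ^ (\<alpha> j - 1)) * (\<Prod>k\<in>?R. c k * \<rho> * r ^ \<alpha> k)" for s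
    proof -
      have "cmod (base s ?v) \<le> norm (?v i) * norm (?v j) * (\<Prod>k\<in>?R. c k * \<rho> * r ^ \<alpha> k)"
        proof (rule cmod_base_le)
        show "i < 4" "j < 4" "i \<noteq> j" using i j by auto
      qed (rule sup)
      also have "\<dots> \<le> (c i * M * r ^ (\<alpha> i - 1)) * (c j * M * r ^ (\<alpha> j - 1)) * (\<Prod>k\<in>?R. c k * \<rho> * r ^ \<alpha> k)"
      proof (intro mult_right_mono mult_mono l2 prod_nonneg)
        show "0 \<le> c k * \<rho> * r ^ \<alpha> k" if "k \<in> ?R" for k using reg nn that by simp
        show "0 \<le> c i * M * r ^ (\<alpha> i - 1)" using reg nn i by simp
      qed (use i j in simp_all)
      finally show ?thesis .
    qed
    also have "(c i * M * r ^ (\<alpha> i - 1)) * (c j * M * r ^ (\<alpha> j - 1)) * (\<Prod>k\<in>?R. c k * \<rho> * r ^ \<alpha> k)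
        = (\<Prod>i<4. c i) * M\<^sup>2 * \<rho>\<^sup>2 * r ^ (2 * m - 2)"
      unfolding split prod.distrib prod_constant card ex[symmetric] power_add power_sum
      by (simp add: power2_eq_square mult_ac)
    finally have "cmod (form (r0 * (\<Prod>i<4. dv i ^ \<alpha> i)) w) \<le> ?C * ((\<Prod>i<4. c i) * M\<^sup>2 * \<rho>\<^sup>2 * r ^ (2 * m - 2))"
      unfolding form_dv_powers by (rule cmod_form_le)
    then show "cmod (form (r0 * (\<Prod>i<4. dv i ^ \<alpha> i)) w) \<le> ?C * (\<Prod>i<4. c i) * M\<^sup>2 * \<rho>\<^sup>2 * r ^ (2 * m - 2)"
      by (simp add: mult.assoc)
  qed
  then show ?case by (intro exI[of _ ?C]) (simp add: sum_nonneg)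
qed

lemma lapl_simps [simp]:
  "lapl (cmul c f) = cmul c (lapl f)" "lapl (f + g) = lapl f + lapl g" "lapl (f - g) = lapl f - lapl g"
  "lapl (a *\<^sub>R f) = a *\<^sub>R lapl f" "conj2 (lapl f) = lapl (conj2 f)"
  "lapl (- f) = - lapl f"
  by (rule ell2_eqI; simp add: lapl_def algebra_simps)+

lemma cmul_scaleR [simp]: "cmul c (a *\<^sub>R f) = a *\<^sub>R cmul c f"
  by (rule ell2_eqI) simp

lemma inner_lapl_commute: "inner (lapl f) g = inner f (lapl g)"
  by (metis inner_commute inner_fdiff minus_equation_iff)

lemma inner_cmul_ii: "inner g (cmul (- \<i>) g) = 0"
proof -
  have "inner g (cmul (- \<i>) g) = inner (cmul \<i> g) g"
    by (simp add: inner_cmul_left)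
  moreover have "cmul \<i> g = - cmul (- \<i>) g" by (rule ell2_eqI) simp
  ultimately show ?thesis by (simp add: inner_commute)
qed

section \<open>The modified energy\<close>

text \<open>The properties of Fourier multipliers with real even symbol that the energy computation
  uses.\<close>

definition symmetric_multiplier :: "(ell2 \<Rightarrow> ell2) \<Rightarrow> bool" where
  "symmetric_multiplier A \<longleftrightarrow> bounded_linear A \<and> (\<forall>f g. inner (A f) g = inner f (A g)) \<and>
     (\<forall>c f. A (cmul c f) = cmul c (A f)) \<and> (\<forall>f. A (lapl f) = lapl (A f)) \<and> (\<forall>f. A (conj2 f) = conj2 (A f))"

text \<open>\<open>A\<close> is complex linear and symmetric, so its Hermitian quadratic form is
  real.\<close>

lemma symmetric_multiplier_inner_ii:
  assumes "symmetric_multiplier A"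
  shows "inner (A f) (cmul (- \<i>) f) = 0"
proof -
  have "inner (A f) (cmul (- \<i>) f) = inner f (cmul (- \<i>) (A f))"
    using assms by (simp add: symmetric_multiplier_def)
  also have "\<dots> = inner (A f) (cmul \<i> f)"
    by (metis complex_cnj_i inner_cmul_left inner_commute)
  also have "cmul \<i> f = - cmul (- \<i>) f" by (rule ell2_eqI) simp
  finally show ?thesis by simp
qed

text \<open>Their symbols are the squares of \<open>sin (\<theta> / 2)\<close> and
  \<open>cos (\<theta> / 2)\<close>.\<close>

definition xop :: "ell2 \<Rightarrow> ell2" where "xop f = (- 1 / 4) *\<^sub>R lapl f"
definition yop :: "ell2 \<Rightarrow> ell2" where "yop f = f - xop f"

lemma bounded_linear_lapl: "bounded_linear lapl"
  unfolding lapl_def by (intro bounded_linear_sub bounded_linear_add bounded_linear_shift bounded_linear_ident)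

lemma symmetric_multiplier_lapl:
  assumes "symmetric_multiplier A"
  shows "symmetric_multiplier (\<lambda>f. lapl (A f))"
  using assms bounded_linear_compose[OF bounded_linear_lapl]
  by (auto simp: symmetric_multiplier_def inner_lapl_commute)

lemma symmetric_multiplier_xop:
  assumes "symmetric_multiplier A"
  shows "symmetric_multiplier (\<lambda>f. xop (A f))"
proof -
  have "A (a *\<^sub>R f) = a *\<^sub>R A f" for a f
    using assms unfolding symmetric_multiplier_def by (metis linear_simps(5))
  then show ?thesis
    using symmetric_multiplier_lapl[OF assms]
      bounded_linear_minus[OF bounded_linear_const_scaleR[of "\<lambda>f. lapl (A f)" "1 / 4"]]
    unfolding symmetric_multiplier_def xop_def by simp
qed

lemma symmetric_multiplier_yop:
  assumes "symmetric_multiplier A"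
  shows "symmetric_multiplier (\<lambda>f. yop (A f))"
  using symmetric_multiplier_xop[OF assms] assms bounded_linear_sub[of A "\<lambda>f. xop (A f)"]
  unfolding symmetric_multiplier_def yop_def
  by (simp add: inner_diff_left inner_diff_right cmul_distrib)

lemma symmetric_multiplier_powers: "symmetric_multiplier (\<lambda>f. (yop ^^ b) ((xop ^^ a) f))"
proof (induction b)
  case 0
  show ?case
  proof (induction a)
    case 0
    show ?case by (simp add: symmetric_multiplier_def bounded_linear_ident)
  next
    case (Suc a)
    then show ?case using symmetric_multiplier_xop by simp
  qed
next
  case (Suc b)
  then show ?case using symmetric_multiplier_yop by simp
qed

text \<open>\<open>bern m\<close> applied to the operator \<open>xop\<close>, with
  \<open>yop\<close> in the role of \<open>1 - x\<close>: the multiplier with symbol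
  \<open>fsym m\<close>.\<close>

definition enop :: "nat \<Rightarrow> ell2 \<Rightarrow> ell2" where
  "enop m f = (\<Sum>l\<le>m. real ((2 * m + 1) choose (m + l + 1)) *\<^sub>R (yop ^^ (m - l)) ((xop ^^ (m + l + 1)) f))"

lemma cmul_sum: "cmul c (sum f A) = (\<Sum>x\<in>A. cmul c (f x))"
  by (induction A rule: infinite_finite_induct) (simp_all add: cmul_distrib)

lemma lapl_sum: "lapl (sum f A) = (\<Sum>x\<in>A. lapl (f x))"
  using linear_sum[OF bounded_linear.linear[OF bounded_linear_lapl]] by blast

lemma conj2_sum: "conj2 (sum f A) = (\<Sum>x\<in>A. conj2 (f x))"
  by (induction A rule: infinite_finite_induct) simp_all

lemma symmetric_multiplier_enop: "symmetric_multiplier (enop m)"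
proof -
  note p = symmetric_multiplier_powers[unfolded symmetric_multiplier_def]
  show ?thesis
    unfolding symmetric_multiplier_def enop_def
  proof (intro conjI allI)
    show "bounded_linear (\<lambda>f. \<Sum>l\<le>m. real ((2 * m + 1) choose (m + l + 1)) *\<^sub>R (yop ^^ (m - l)) ((xop ^^ (m + l + 1)) f))"
      by (intro bounded_linear_sum bounded_linear_const_scaleR) (use p in blast)
  qed (use p in \<open>simp_all add: inner_sum_left inner_sum_right cmul_sum lapl_sum conj2_sum del: funpow.simps\<close>)
qed

section \<open>Multipliers inside quadrilinear forms\<close>

lemma form_xop:
  assumes "i < 4"
  shows "form (const (1/4) * (1 + 1 - tv i - tvi i) * r) w = form r (w(i := xop (w i)))"
proof -
  have "xop (w i) = cmul (1/4) (w i + w i - shift 1 (w i) - shift (-1) (w i))"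
    by (rule ell2_eqI) (simp add: xop_def lapl_def algebra_simps)
  then have "form r (w(i := xop (w i)))
      = 1/4 * (form r w + form r w - form r (w(i := shift 1 (w i))) - form r (w(i := shift (-1) (w i))))"
    by (simp only: form_slot_cmul[OF assms] form_slot_add[OF assms] form_slot_diff[OF assms] fun_upd_triv)
  then show ?thesis
    by (simp only: mult.assoc form_simps left_diff_distrib distrib_right form_tv[OF assms] mult_1)
qed

lemma form_yop:
  assumes "i < 4"
  shows "form ((1 - const (1/4) * (1 + 1 - tv i - tvi i)) * r) w = form r (w(i := yop (w i)))"
  unfolding yop_def left_diff_distrib[of 1] form_slot_diff[OF assms] form_simps(3) mult_1
    form_xop[OF assms] fun_upd_triv ..

lemma form_iterate:
  assumes "\<And>r w. form (x * r) w = form r (w(i := T (w i)))"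
  shows "form (x ^ a * r) w = form r (w(i := (T ^^ a) (w i)))"
proof (induction a arbitrary: w)
  case (Suc a)
  have "form (x ^ Suc a * r) w = form (x * (x ^ a * r)) w"
    by (simp add: mult.assoc)
  also have "\<dots> = form r (w(i := (T ^^ a) (T (w i))))"
    by (simp only: assms Suc.IH fun_upd_same fun_upd_upd)
  finally show ?case by (simp only: funpow.simps o_apply funpow_swap1)
qed simp

lemma of_nat_laurent: "(of_nat k :: laurent) = const (of_nat k)"
  by (induction k) (simp_all add: const_simps)

text \<open>Both sides expand \<open>bern m\<close>, on the left at the Laurent polynomial that acts
  as \<open>xop\<close> in argument \<open>i\<close>, on the right at \<open>xop\<close> itself; the
  terms match one by one.\<close>

lemma form_freq:
  assumes "i < 4"
  shows "form (freq m i) w = form 1 (w(i := enop m (w i)))"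
proof -
  let ?x = "const (1/4) * (1 + 1 - tv i - tvi i)"
  have t: "form (of_nat c * ?x ^ a * (1 - ?x) ^ b) w = form 1 (w(i := real c *\<^sub>R (yop ^^ b) ((xop ^^ a) (w i))))" for a b c
  proof -
    have "form (of_nat c * ?x ^ a * (1 - ?x) ^ b) w = of_nat c * form (?x ^ a * ((1 - ?x) ^ b * 1)) w"
      by (simp only: of_nat_laurent mult.assoc form_simps mult_1_right)
    also have "\<dots> = of_nat c * form 1 (w(i := (yop ^^ b) ((xop ^^ a) (w i))))"
      by (simp only: form_iterate[OF form_xop[OF assms]] form_iterate[OF form_yop[OF assms]] fun_upd_same fun_upd_upd)
    finally show ?thesis
      by (simp add: scaleR_ell2_def form_slot_cmul[OF assms])
  qed
  have z: "form 1 (w(i := 0)) = 0"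
    using form_slot_cmul[OF assms, of 1 w 0 0] by simp
  have s: "form 1 (w(i := sum g A)) = (\<Sum>l\<in>A. form 1 (w(i := g l)))" if "finite A" for g :: "nat \<Rightarrow> ell2" and A
    using that by induction (simp_all only: sum.empty z sum.insert form_slot_add[OF assms] not_False_eq_True)
  show ?thesis
    unfolding freq_def bern_def enop_def s[OF finite_atMost] form_sum t ..
qed

section \<open>Time derivatives and conservation laws\<close>

lemma base_has_vector_derivative:
  assumes "\<And>i. i < 4 \<Longrightarrow> ((\<lambda>t. w t i) has_vector_derivative d i) (at t)"
  shows "((\<lambda>t. base s (w t)) has_vector_derivative (\<Sum>i<4. base s ((w t)(i := d i)))) (at t)"
proof -
  obtain a b c where s: "s = (a, b, c)" by (cases s)
  have sh: "((\<lambda>t. shift e (w t i)) has_vector_derivative shift e (d i)) (at t)" if "i < 4" for e i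
    by (rule bounded_linear.has_vector_derivative[OF bounded_linear_shift assms[OF that]])
  have "((\<lambda>t. pair (shift a (w t 0) * shift b (w t 1)) (shift c (w t 2) * w t 3)) has_vector_derivative
      pair (shift a (w t 0) * shift b (w t 1)) (shift c (w t 2) * d 3 + shift c (d 2) * w t 3)
      + pair (shift a (w t 0) * shift b (d 1) + shift a (d 0) * shift b (w t 1)) (shift c (w t 2) * w t 3)) (at t)"
    by (intro bounded_bilinear.has_vector_derivative[OF bounded_bilinear_pair]
        has_vector_derivative_mult sh assms) simp_all
  then show ?thesis
    by (simp add: base_def s eval_nat_numeral pair_add_left pair_add_right add_ac)
qed

lemma form_has_vector_derivative:
  assumes "\<And>i. i < 4 \<Longrightarrow> ((\<lambda>t. w t i) has_vector_derivative d i) (at t)"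
  shows "((\<lambda>t. form r (w t)) has_vector_derivative (\<Sum>i<4. form r ((w t)(i := d i)))) (at t)"
proof -
  have "((\<lambda>t. form r (w t)) has_vector_derivative
      (\<Sum>s\<in>Poly_Mapping.keys r. Poly_Mapping.lookup r s * (\<Sum>i<4. base s ((w t)(i := d i))))) (at t)"
    unfolding form_def extend_def
    by (intro has_vector_derivative_sum has_vector_derivative_mult_right base_has_vector_derivative assms)
  then show ?thesis
    unfolding form_def extend_def sum_distrib_left by (subst sum.swap)
qed

lemma has_real_derivative_inner:
  fixes f g :: "real \<Rightarrow> 'a :: real_inner"
  assumes "(f has_vector_derivative f') (at t)" "(g has_vector_derivative g') (at t)"
  shows "((\<lambda>t. inner (f t) (g t)) has_real_derivative inner (f t) g' + inner f' (g t)) (at t)"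
  unfolding has_real_derivative_iff_has_vector_derivative
  by (rule bounded_bilinear.has_vector_derivative[OF bounded_bilinear_inner assms])

definition cubic :: "ell2 \<Rightarrow> ell2" where "cubic f = f * conj2 f * f"

locale dnls =
  fixes \<nu> :: real and v :: "real \<Rightarrow> ell2"
  assumes nu: "\<nu> = 1 \<or> \<nu> = - 1"
    and deriv: "\<And>t. (v has_vector_derivative cmul (- \<i>) (lapl (v t) + \<nu> *\<^sub>R cubic (v t))) (at t)"
begin

lemma deriv_conj: "((\<lambda>t. conj2 (v t)) has_vector_derivative
    cmul \<i> (lapl (conj2 (v t)) + \<nu> *\<^sub>R conj2 (cubic (v t)))) (at t)"
  using bounded_linear.has_vector_derivative[OF bounded_linear_conj2 deriv, of t] by simp

text \<open>Conservation of mass: \<open>lapl\<close> and multiplication by the squared modulus have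
  real quadratic forms, so after the factor \<open>- \<i>\<close> both parts of the derivative are
  orthogonal to \<open>v t\<close>.\<close>

lemma norm_v: "norm (v t) = norm (v 0)"
proof -
  have "((\<lambda>t. inner (v t) (v t)) has_real_derivative 0) (at t)" for t
  proof -
    let ?w = "cmul (- \<i>) (lapl (v t) + \<nu> *\<^sub>R cubic (v t))"
    have "inner (v t) (cmul (- \<i>) (lapl (v t))) = 0"
    proof -
      have "inner (v t) (lapl (cmul (- \<i>) (v t))) = - inner (fdiff (v t)) (cmul (- \<i>) (fdiff (v t)))"
        by (metis fdiff_simps(4) inner_fdiff minus_minus)
      then show ?thesis by (simp add: inner_cmul_ii)
    qed
    moreover have "inner (v t) (cmul (- \<i>) (cubic (v t))) = 0"
    proof -
      have "inner (v t) (cmul (- \<i>) (cubic (v t))) = inner (v t * conj2 (v t)) (cmul (- \<i>) (v t * conj2 (v t)))"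
        unfolding cubic_def inner_ell2_def pair_def by (simp add: mult_ac)
      then show ?thesis by (simp add: inner_cmul_ii)
    qed
    ultimately have "inner (v t) ?w = 0"
      by (simp add: cmul_distrib inner_add_right)
    then show ?thesis
      using has_real_derivative_inner[OF deriv[of t] deriv[of t]] by (simp add: inner_commute)
  qed
  then have "inner (v t) (v t) = inner (v 0) (v 0)"
    using DERIV_const_ratio_const2 DERIV_isconst_all by blast
  then show ?thesis by (simp add: norm_eq_sqrt_inner)
qed

text \<open>The Hamiltonian; the last squared norm is the sum of the fourth powers of the
  moduli.\<close>

definition energy :: "real \<Rightarrow> real" where
  "energy t = (norm (fdiff (v t)))\<^sup>2 - \<nu> / 2 * (norm (v t * conj2 (v t)))\<^sup>2"

text \<open>Up to the factor \<open>- 2\<close>, the gradient of the energy is the right-hand side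
  \<open>?w\<close>, and \<open>v\<close> moves along \<open>- \<i>\<close> times \<open>?w\<close>,
  orthogonally to it.\<close>

lemma energy_const: "energy t = energy 0"
proof -
  have "(energy has_real_derivative 0) (at t)" for t
  proof -
    let ?v = "v t"
    let ?w = "lapl ?v + \<nu> *\<^sub>R cubic ?v"
    let ?d = "cmul (- \<i>) ?w"
    have d1: "((\<lambda>t. fdiff (v t)) has_vector_derivative fdiff ?d) (at t)"
      by (rule bounded_linear.has_vector_derivative[OF bounded_linear_fdiff deriv])
    have d2: "((\<lambda>t. v t * conj2 (v t)) has_vector_derivative ?v * conj2 ?d + ?d * conj2 ?v) (at t)"
      by (intro has_vector_derivative_mult deriv bounded_linear.has_vector_derivative[OF bounded_linear_conj2])
    have e: "energy = (\<lambda>t. inner (fdiff (v t)) (fdiff (v t)) - \<nu> / 2 * inner (v t * conj2 (v t)) (v t * conj2 (v t)))"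
      unfolding energy_def by (simp add: power2_norm_eq_inner)
    have "(energy has_real_derivative (inner (fdiff ?v) (fdiff ?d) + inner (fdiff ?d) (fdiff ?v))
        - \<nu> / 2 * (inner (?v * conj2 ?v) (?v * conj2 ?d + ?d * conj2 ?v) + inner (?v * conj2 ?d + ?d * conj2 ?v) (?v * conj2 ?v))) (at t)"
      unfolding e by (intro DERIV_diff DERIV_cmult has_real_derivative_inner d1 d2)
    moreover have "inner (fdiff ?v) (fdiff d) + inner (fdiff d) (fdiff ?v) = - 2 * inner (lapl ?v) d" for d
    proof -
      have "inner (fdiff ?v) (fdiff d) = - inner (lapl ?v) d"
        by (simp add: inner_fdiff inner_lapl_commute)
      then show ?thesis by (simp add: inner_commute[of "fdiff d"])
    qed
    moreover have "inner (?v * conj2 ?v) (?v * conj2 d) = inner (cubic ?v) d"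
        "inner (?v * conj2 ?v) (d * conj2 ?v) = inner (cubic ?v) d" for d
    proof -
      have "inner (?v * conj2 ?v) (?v * conj2 d) = inner (conj2 (cubic ?v)) (conj2 d)"
        by (simp add: cubic_def inner_ell2_def pair_def mult_ac)
      then show "inner (?v * conj2 ?v) (?v * conj2 d) = inner (cubic ?v) d"
        by (simp add: inner_conj2)
      show "inner (?v * conj2 ?v) (d * conj2 ?v) = inner (cubic ?v) d"
        by (simp add: cubic_def inner_ell2_def pair_def mult_ac)
    qed
    ultimately have "(energy has_real_derivative - 2 * inner (lapl ?v) ?d - \<nu> / 2 * (4 * inner (cubic ?v) ?d)) (at t)"
      by (simp only: inner_add_right inner_add_left inner_commute[of "?v * conj2 ?d"] inner_commute[of "?d * conj2 ?v"]) 
        (simp add: algebra_simps)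
    also have "- 2 * inner (lapl ?v) ?d - \<nu> / 2 * (4 * inner (cubic ?v) ?d) = - 2 * inner ?w ?d"
      by (simp only: inner_add_left inner_scaleR_left) (simp add: algebra_simps)
    finally show ?thesis by (simp only: inner_cmul_ii) simp
  qed
  then show ?thesis
    using DERIV_isconst_all by blast
qed

end

section \<open>Comparison of the quadratic part with the homogeneous norm\<close>

lemma xop_yop_commute:
  "xop (fdiff f) = fdiff (xop f)" "(yop ^^ b) (xop f) = xop ((yop ^^ b) f)"
proof -
  have fl: "fdiff (lapl f) = lapl (fdiff f)" for f
    by (rule ell2_eqI) (simp add: lapl_def fdiff_def algebra_simps)
  have fs: "fdiff (a *\<^sub>R f) = a *\<^sub>R fdiff f" for a f
    by (simp add: scaleR_ell2_def)
  show "xop (fdiff f) = fdiff (xop f)" by (simp only: xop_def fl fs)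
  have yx: "yop (xop f) = xop (yop f)" for f
    by (simp add: yop_def xop_def algebra_simps)
  show "(yop ^^ b) (xop f) = xop ((yop ^^ b) f)"
    by (induction b) (simp_all add: yx)
qed

lemma inner_xop: "inner (xop f) g = 1/4 * inner (fdiff f) (fdiff g)"
  by (simp add: xop_def inner_fdiff inner_lapl_commute)

lemma inner_xop_power: "inner ((xop ^^ a) f) g = (1/4) ^ a * inner ((fdiff ^^ a) f) ((fdiff ^^ a) g)"
proof (induction a arbitrary: f g)
  case (Suc a)
  have c: "fdiff ((xop ^^ a) f) = (xop ^^ a) (fdiff f)" for f
    by (induction a) (simp_all flip: xop_yop_commute(1))
  have "inner ((xop ^^ Suc a) f) g = 1/4 * inner ((xop ^^ a) (fdiff f)) (fdiff g)"
    by (simp add: inner_xop c)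
  then show ?case
    unfolding Suc.IH by (simp add: funpow_swap1)
qed simp

lemma inner_yop_nonneg: "0 \<le> inner (yop f) f"
proof -
  have "inner (yop f) f = 1/4 * inner (f + shift 1 f) (f + shift 1 f)"
    by (simp add: yop_def xop_def lapl_def inner_add_left inner_add_right inner_diff_left inner_shift_left algebra_simps)
  then show ?thesis
    using inner_ge_zero[of "f + shift 1 f"] by linarith
qed

text \<open>The operators commute and are symmetric, so factors can be moved in pairs, one to each
  side, until \<open>b\<close> is 0 or both exponents are at most 1. A single \<open>xop\<close>
  gives \<open>fdiff\<close> on both sides, and \<open>yop\<close> alone is
  \<open>inner_yop_nonneg\<close>.\<close>

lemma inner_powers_nonneg: "0 \<le> inner ((yop ^^ b) ((xop ^^ a) f)) f"
proof -
  have X: "inner (xop f) g = inner f (xop g)" for f g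
    by (simp add: xop_def inner_lapl_commute)
  have Y: "inner (yop f) g = inner f (yop g)" for f g
    by (simp add: yop_def inner_diff_left inner_diff_right X)
  show ?thesis
  proof (induction b arbitrary: f rule: nat_less_induct)
    case (1 b)
    consider "b = 0" | "b = 1" | c where "b = Suc (Suc c)"
      by (metis One_nat_def not0_implies_Suc)
    then show ?case
    proof cases
      case 1
      then show ?thesis by (simp add: inner_xop_power)
    next
      case 2
      have "inner (yop ((xop ^^ a) f)) f \<ge> 0"
      proof (induction a arbitrary: f rule: nat_less_induct)
        case (1 a)
        consider "a = 0" | "a = 1" | c where "a = Suc (Suc c)"
          by (metis One_nat_def not0_implies_Suc)
        then show ?case
        proof cases
          case 1
          then show ?thesis by (simp add: inner_yop_nonneg)
        next
          case 2
          have "inner (yop (xop f)) f = 1/4 * inner (yop (fdiff f)) (fdiff f)"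
            using xop_yop_commute(2)[of 1 f] 
            by (simp add: inner_xop yop_def flip: xop_yop_commute(1))
          then show ?thesis using 2 inner_yop_nonneg[of "fdiff f"] by simp
        next
          case (3 c)
          have "inner (yop ((xop ^^ a) f)) f = inner (yop ((xop ^^ c) (xop f))) (xop f)"
            using 3 xop_yop_commute(2)[of 1 "(xop ^^ c) (xop f)"] by (simp add: X funpow_swap1)
          then show ?thesis using 1 3 by simp
        qed
      qed
      then show ?thesis using 2 by simp
    next
      case (3 c)
      have "inner ((yop ^^ b) ((xop ^^ a) f)) f = inner ((yop ^^ c) ((xop ^^ a) (yop f))) (yop f)"
      proof -
        have "(xop ^^ a) (yop g) = yop ((xop ^^ a) g)" for g
          using xop_yop_commute(2)[of 1] by (induction a) simp_all
        moreover have "(yop ^^ b) ((xop ^^ a) f) = yop ((yop ^^ c) (yop ((xop ^^ a) f)))"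
          using 3 by (simp add: funpow_swap1)
        ultimately show ?thesis by (simp only: Y)
      qed
      then show ?thesis using 1 3 by simp
    qed
  qed
qed

text \<open>On the Fourier side, the integral of the squared modulus of the transform of
  \<open>f\<close> against \<open>x^a (1 - x)^b\<close> with
  \<open>x = sin^2 (\<theta> / 2)\<close>. It replaces Fourier analysis here.\<close>

definition pw :: "nat \<Rightarrow> nat \<Rightarrow> ell2 \<Rightarrow> real" where
  "pw a b f = inner ((yop ^^ b) ((xop ^^ a) f)) f"

lemma pw_nonneg: "0 \<le> pw a b f"
  unfolding pw_def by (rule inner_powers_nonneg)

lemma pw_0: "pw a 0 f = (1/4) ^ a * (norm ((fdiff ^^ a) f))\<^sup>2"
  by (simp add: pw_def inner_xop_power power2_norm_eq_inner)

lemma pw_split: "pw a b f = pw (Suc a) b f + pw a (Suc b) f"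
  by (simp add: pw_def xop_yop_commute(2) yop_def inner_diff_left)

text \<open>Inserting \<open>(xop + yop)^k = 1\<close> gives binomial coefficients; the induction
  splits one factor at a time and replaces them by \<open>2 ^ k\<close>.\<close>

lemma pw_le_sum: "pw a b f \<le> 2 ^ k * (\<Sum>l\<le>k. pw (a + l) (b + k - l) f)"
proof (induction k arbitrary: a b)
  case (Suc k)
  let ?S = "\<Sum>l\<le>Suc k. pw (a + l) (b + Suc k - l) f"
  have "pw (Suc a) b f \<le> 2 ^ k * ?S"
  proof -
    have "(\<Sum>l\<le>k. pw (Suc a + l) (b + k - l) f) \<le> ?S"
      unfolding sum.atMost_Suc_shift[of _ k] using pw_nonneg by (simp add: sum_nonneg)
    then show ?thesis using Suc[of "Suc a" b] by (meson mult_left_mono order_trans zero_le_numeral zero_le_power)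
  qed
  moreover have "pw a (Suc b) f \<le> 2 ^ k * ?S"
  proof -
    have "(\<Sum>l\<le>k. pw (a + l) (Suc b + k - l) f) \<le> ?S"
      unfolding sum.atMost_Suc using pw_nonneg by (simp add: sum_nonneg)
    then show ?thesis using Suc[of a "Suc b"] by (meson mult_left_mono order_trans zero_le_numeral zero_le_power)
  qed
  ultimately show ?case using pw_split[of a b f] by simp
qed simp

lemma pw_antimono: "pw (a + l) b f \<le> pw a 0 f"
proof -
  have "pw a b f \<le> pw a 0 f" for a
  proof (induction b)
    case (Suc b)
    then show ?case using pw_split[of a b f] pw_nonneg[of "Suc a" b f] by simp
  qed simp
  moreover have "pw (a + l) 0 f \<le> pw a 0 f"
  proof (induction l)
    case (Suc l)
    then show ?case using pw_split[of "a + l" 0 f] pw_nonneg[of "a + l" 1 f] by simp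
  qed simp
  ultimately show ?thesis using order_trans by blast
qed

lemma inner_enop: "inner (enop m f) f = (\<Sum>l\<le>m. real ((2 * m + 1) choose (m + l + 1)) * pw (m + l + 1) (m - l) f)"
  unfolding enop_def inner_sum_left inner_scaleR_left pw_def ..

text \<open>All coefficients of \<open>enop m\<close> are at least 1 and all its terms nonnegative,
  so \<open>pw_le_sum\<close> with \<open>k = m\<close> recovers \<open>pw (m + 1) 0\<close>, a
  multiple of the squared norm.\<close>

lemma inner_enop_lower: "(1/4) ^ (m + 1) / 2 ^ m * (norm ((fdiff ^^ (m + 1)) f))\<^sup>2 \<le> inner (enop m f) f"
proof -
  have "(1/4) ^ (m + 1) * (norm ((fdiff ^^ (m + 1)) f))\<^sup>2 = pw (m + 1) 0 f"
    by (rule pw_0[symmetric])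
  also have "\<dots> \<le> 2 ^ m * (\<Sum>l\<le>m. pw (m + 1 + l) (m - l) f)"
    using pw_le_sum[of "m + 1" 0 f m] by (simp only: add_0)
  also have "(\<Sum>l\<le>m. pw (m + 1 + l) (m - l) f) \<le> inner (enop m f) f"
    unfolding inner_enop
  proof (rule sum_mono)
    fix l assume "l \<in> {..m}"
    then have "1 \<le> ((2 * m + 1) choose (m + l + 1))"
      by (simp add: Suc_le_eq del: binomial_Suc_Suc)
    then have "1 * pw (m + l + 1) (m - l) f \<le> real ((2 * m + 1) choose (m + l + 1)) * pw (m + l + 1) (m - l) f"
      by (intro mult_right_mono pw_nonneg) simp
    then show "pw (m + 1 + l) (m - l) f \<le> real ((2 * m + 1) choose (m + l + 1)) * pw (m + l + 1) (m - l) f"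
      by (simp add: add_ac del: binomial_Suc_Suc)
  qed
  finally show ?thesis by (simp add: field_simps)
qed

text \<open>Each of the \<open>m + 1\<close> binomial coefficients is at most
  \<open>2 ^ (2 * m + 1)\<close>, and every term has at least \<open>m + 1\<close> factors
  \<open>xop\<close>.\<close>

lemma inner_enop_upper: "inner (enop m f) f \<le> real (m + 1) * 2 ^ (2 * m + 1) * (norm ((fdiff ^^ (m + 1)) f))\<^sup>2"
proof -
  have "inner (enop m f) f \<le> (\<Sum>l\<le>m. 2 ^ (2 * m + 1) * (norm ((fdiff ^^ (m + 1)) f))\<^sup>2)"
    unfolding inner_enop
  proof (rule sum_mono)
    fix l
    have "pw (m + l + 1) (m - l) f \<le> pw (m + 1) 0 f"
      using pw_antimono[of "m + 1" l "m - l" f] by (simp add: add_ac)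
    also have "\<dots> = (1/4) ^ (m + 1) * (norm ((fdiff ^^ (m + 1)) f))\<^sup>2"
      by (rule pw_0)
    also have "\<dots> \<le> 1 * (norm ((fdiff ^^ (m + 1)) f))\<^sup>2"
      by (intro mult_right_mono power_le_one) auto
    finally have "pw (m + l + 1) (m - l) f \<le> (norm ((fdiff ^^ (m + 1)) f))\<^sup>2" by simp
    moreover have "real ((2 * m + 1) choose (m + l + 1)) \<le> 2 ^ (2 * m + 1)"
      using binomial_le_pow2[of "2 * m + 1" "m + l + 1"] by (metis of_nat_le_iff of_nat_numeral of_nat_power)
    ultimately show "real ((2 * m + 1) choose (m + l + 1)) * pw (m + l + 1) (m - l) f
        \<le> 2 ^ (2 * m + 1) * (norm ((fdiff ^^ (m + 1)) f))\<^sup>2"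
      by (intro mult_mono pw_nonneg) simp_all
  qed
  then show ?thesis by (simp add: mult_ac)
qed

section \<open>Cancellation of the quartic terms\<close>

context dnls
begin

definition slots :: "real \<Rightarrow> nat \<Rightarrow> ell2" where
  "slots t i = (if even i then v t else conj2 (v t))"

definition slots_cubic :: "real \<Rightarrow> nat \<Rightarrow> ell2" where
  "slots_cubic t i = (if even i then cubic (v t) else conj2 (cubic (v t)))"

text \<open>The factor \<open>\<nu> / 4\<close> is the one for which the quartic terms cancel in
  \<open>mod_energy_deriv\<close>.\<close>

definition mod_energy :: "nat \<Rightarrow> real \<Rightarrow> real" where
  "mod_energy m t = inner (enop m (v t)) (v t) - \<nu> / 4 * Re (form (qform m) (slots t))"

text \<open>What the nonlinearity contributes to the derivative of the quartic form; the signs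
  alternate because the conjugate solution evolves with the opposite sign of
  \<open>\<i>\<close>.\<close>

definition sextic :: "nat \<Rightarrow> real \<Rightarrow> complex" where
  "sextic m t = (\<Sum>i<4. (- 1) ^ i * form (qform m) ((slots t)(i := slots_cubic t i)))"

lemma sum_less4: "(\<Sum>i<4. h i) = h 0 + h 1 + h 2 + h (3 :: nat)" for h :: "nat \<Rightarrow> 'b :: comm_monoid_add"
  by (simp add: eval_nat_numeral)

text \<open>Exchanging the two even arguments preserves the sum, and conjugation exchanges even and
  odd arguments; so all four terms of \<open>freq_identity\<close> are expressed by one
  number.\<close>

lemma form_freq_slots:
  "form (freq m 2) (slots t) = form (freq m 0) (slots t)"
  "form (freq m 1) (slots t) = cnj (form (freq m 0) (slots t))"
  "form (freq m 3) (slots t) = cnj (form (freq m 0) (slots t))"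
proof -
  have c: "enop m (conj2 f) = conj2 (enop m f)" for f
    using symmetric_multiplier_enop[of m] by (simp add: symmetric_multiplier_def)
  show "form (freq m 2) (slots t) = form (freq m 0) (slots t)"
    by (simp add: form_freq form_one slots_def) (rule pair_commute)
  show "form (freq m 1) (slots t) = cnj (form (freq m 0) (slots t))"
    "form (freq m 3) (slots t) = cnj (form (freq m 0) (slots t))"
    by (simp_all add: form_freq form_one slots_def c flip: pair_conj2)
      (simp_all add: pair_def mult_ac)
qed

text \<open>The linear flow preserves the quadratic part, because \<open>enop m\<close> composed
  with \<open>lapl\<close> is again a symmetric multiplier; only the cubic term contributes.\<close>

lemma inner_enop_deriv:
  "((\<lambda>t. inner (enop m (v t)) (v t)) has_real_derivative - 2 * \<nu> * Im (form (freq m 0) (slots t))) (at t)"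
proof -
  have sm: "bounded_linear (enop m)" "inner (enop m f) g = inner f (enop m g)" for f g
    using symmetric_multiplier_enop[of m] by (simp_all add: symmetric_multiplier_def)
  let ?d = "cmul (- \<i>) (lapl (v t) + \<nu> *\<^sub>R cubic (v t))"
  have "inner (enop m (v t)) (cmul (- \<i>) (lapl (v t))) = inner (lapl (enop m (v t))) (cmul (- \<i>) (v t))"
    by (simp add: inner_lapl_commute)
  also have "\<dots> = 0"
    using symmetric_multiplier_inner_ii[OF symmetric_multiplier_lapl[OF symmetric_multiplier_enop]] .
  finally have 1: "inner (enop m (v t)) (cmul (- \<i>) (lapl (v t))) = 0" .
  have "inner (enop m (v t)) (cmul (- \<i>) (cubic (v t))) = Re (\<i> * form (freq m 0) (slots t))"
    by (simp add: form_freq form_one slots_def inner_ell2_def pair_cmul_right cubic_def pair_mult mult_ac)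
      (simp add: pair_def mult_ac)
  then have "inner (enop m (v t)) ?d = - \<nu> * Im (form (freq m 0) (slots t))"
    using 1 by (simp add: cmul_distrib inner_add_right)
  moreover have "((\<lambda>t. inner (enop m (v t)) (v t)) has_real_derivative inner (enop m (v t)) ?d + inner (enop m ?d) (v t)) (at t)"
    by (intro has_real_derivative_inner bounded_linear.has_vector_derivative[OF sm(1)] deriv)
  ultimately show ?thesis
    by (simp add: sm(2)[of ?d] inner_commute[of ?d] mult.assoc)
qed

text \<open>In argument \<open>i\<close> the operator \<open>lapl\<close> is multiplication by
  \<open>tv i + tvi i - 2\<close>. With the alternating signs the four constants \<open>-2\<close>
  cancel, and the resonance function remains.\<close>

lemma form_slots_deriv:
  "((\<lambda>t. form q (slots t)) has_vector_derivative
    - \<i> * form ((tv 0 + tvi 0 + tv 2 + tvi 2 - tv 1 - tvi 1 - tv 3 - tvi 3) * q) (slots t)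
    - \<i> * complex_of_real \<nu> * (\<Sum>i<4. (- 1) ^ i * form q ((slots t)(i := slots_cubic t i)))) (at t)"
proof -
  define \<epsilon> :: "nat \<Rightarrow> complex" where "\<epsilon> i = (- 1) ^ i" for i
  define d where "d i = cmul (- \<i> * \<epsilon> i) (lapl (slots t i) + \<nu> *\<^sub>R slots_cubic t i)" for i
  have alg: "(- \<i> * e) * (p + c * s) = - \<i> * e * p - \<i> * c * (e * s)" for e p c s :: complex
    by (simp add: algebra_simps)
  have "((\<lambda>t. slots t i) has_vector_derivative d i) (at t)" for i
    using deriv[of t] deriv_conj[of t] by (auto simp: slots_def[abs_def] d_def slots_cubic_def \<epsilon>_def)
  then have "((\<lambda>t. form q (slots t)) has_vector_derivative (\<Sum>i<4. form q ((slots t)(i := d i)))) (at t)"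
    by (rule form_has_vector_derivative)
  moreover have "form q ((slots t)(i := d i)) = - \<i> * \<epsilon> i * (form (tv i * q) (slots t) + form (tvi i * q) (slots t) - 2 * form q (slots t))
      - \<i> * complex_of_real \<nu> * (\<epsilon> i * form q ((slots t)(i := slots_cubic t i)))" if "i < 4" for i
  proof -
    have "form q ((slots t)(i := d i)) = (- \<i> * \<epsilon> i) * (form q ((slots t)(i := lapl (slots t i)))
        + complex_of_real \<nu> * form q ((slots t)(i := slots_cubic t i)))"
      unfolding d_def by (simp only: form_slot_cmul[OF that] form_slot_add[OF that] scaleR_ell2_def)
    also have "form q ((slots t)(i := lapl (slots t i))) = form (tv i * q) (slots t) + form (tvi i * q) (slots t) - 2 * form q (slots t)"
      unfolding lapl_def form_slot_diff[OF that] form_slot_add[OF that] fun_upd_triv form_tv[OF that] by simp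
    finally show ?thesis by (simp only: alg)
  qed
  ultimately have "((\<lambda>t. form q (slots t)) has_vector_derivative
      (\<Sum>i<4. - \<i> * \<epsilon> i * (form (tv i * q) (slots t) + form (tvi i * q) (slots t) - 2 * form q (slots t))
      - \<i> * complex_of_real \<nu> * (\<epsilon> i * form q ((slots t)(i := slots_cubic t i))))) (at t)"
    by simp
  moreover have "(\<Sum>i<4. - \<i> * \<epsilon> i * (form (tv i * q) (slots t) + form (tvi i * q) (slots t) - 2 * form q (slots t)))
      = - \<i> * form ((tv 0 + tvi 0 + tv 2 + tvi 2 - tv 1 - tvi 1 - tv 3 - tvi 3) * q) (slots t)"
    unfolding sum_less4 by (simp add: \<epsilon>_def distrib_right left_diff_distrib algebra_simps)
  ultimately show ?thesis
    by (simp only: sum_subtractf \<epsilon>_def sum_distrib_left)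
qed

text \<open>With \<open>z\<close> the quartic number of \<open>form_freq_slots\<close>, the identity
  \<open>freq_identity\<close> gives \<open>G = - 8 * \<i> * Im z\<close>, so the quartic form
  contributes \<open>2 * \<nu> * Im z\<close> and cancels \<open>inner_enop_deriv\<close>. The
  sextic rest carries \<open>\<nu> * \<nu> = 1\<close>.\<close>

lemma mod_energy_deriv:
  "(mod_energy m has_real_derivative 1/4 * Re (\<i> * sextic m t)) (at t)"
proof -
  define z where "z = form (freq m 0) (slots t)"
  define G where "G = form ((tv 0 + tvi 0 + tv 2 + tvi 2 - tv 1 - tvi 1 - tv 3 - tvi 3) * qform m) (slots t)"
  have "form (freq m 0 + freq m 2 - freq m 1 - freq m 3) (slots t) = - 1/2 * G"
    unfolding freq_identity form_simps G_def ..
  then have "z + z - cnj z - cnj z = - 1/2 * G"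
    unfolding form_simps form_freq_slots z_def .
  then have "G = - 2 * (z + z - cnj z - cnj z)" by simp
  then have G: "G = - 8 * \<i> * Im z"
    by (simp add: complex_eq_iff)
  have "((\<lambda>t. Re (form (qform m) (slots t))) has_vector_derivative
      Re (- \<i> * G - \<i> * complex_of_real \<nu> * sextic m t)) (at t)"
    unfolding G_def sextic_def
    by (rule bounded_linear.has_vector_derivative[OF bounded_linear_Re form_slots_deriv])
  then have "((\<lambda>t. Re (form (qform m) (slots t))) has_real_derivative
      Re (- \<i> * G - \<i> * complex_of_real \<nu> * sextic m t)) (at t)"
    by (simp add: has_real_derivative_iff_has_vector_derivative)
  then have "(mod_energy m has_real_derivative - 2 * \<nu> * Im z
      - \<nu> / 4 * Re (- \<i> * G - \<i> * complex_of_real \<nu> * sextic m t)) (at t)"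
    unfolding mod_energy_def[abs_def] z_def
    by (intro DERIV_diff inner_enop_deriv DERIV_cmult)
  also have "- 2 * \<nu> * Im z - \<nu> / 4 * Re (- \<i> * G - \<i> * complex_of_real \<nu> * sextic m t)
      = (\<nu> * \<nu>) / 4 * Re (\<i> * sextic m t)"
    unfolding G by (simp add: algebra_simps)
  also have "\<nu> * \<nu> = 1" using nu by auto
  finally show ?thesis .
qed

end

section \<open>Growth of the norms\<close>

text \<open>A discrete maximum principle. The quotients \<open>b i\<close> are still log-convex; if
  their maximum exceeded \<open>K\<close>, its first position would be interior, with a strictly
  smaller left neighbour, against log-convexity there.\<close>

lemma log_convex_bound:
  fixes a :: "nat \<Rightarrow> real"
  assumes nn: "\<And>j. 0 \<le> a j" and conv: "\<And>j. (a (Suc j))\<^sup>2 \<le> a j * a (Suc (Suc j))"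
    and r: "0 < r" and a0: "a 0 \<le> K" and am: "a m \<le> K * r ^ m" and j: "j \<le> m"
  shows "a j \<le> K * r ^ j"
proof (rule ccontr)
  define b where "b i = a i / r ^ i" for i
  have b0: "0 \<le> b i" for i using nn r by (simp add: b_def)
  have bc: "(b (Suc i))\<^sup>2 \<le> b i * b (Suc (Suc i))" for i
  proof -
    have "(b (Suc i))\<^sup>2 = (a (Suc i))\<^sup>2 / (r ^ i * r ^ Suc (Suc i))"
      by (simp add: b_def power2_eq_square)
    also have "\<dots> \<le> a i * a (Suc (Suc i)) / (r ^ i * r ^ Suc (Suc i))"
      using r by (intro divide_right_mono conv) simp
    finally show ?thesis by (simp add: b_def)
  qed
  assume "\<not> a j \<le> K * r ^ j"
  then have bj: "K < b j" using r by (simp add: b_def field_simps)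
  define B where "B = Max (b ` {..m})"
  have le: "b i \<le> B" if "i \<le> m" for i using that by (simp add: B_def)
  have "K < B" using le[OF j] bj by simp
  have "0 \<le> K" using a0 nn[of 0] by simp
  then have "0 < B" using \<open>K < B\<close> by simp
  have "\<exists>i. i \<le> m \<and> b i = B"
    using Max_in[of "b ` {..m}"] unfolding B_def by fastforce
  then obtain i where i: "i \<le> m" "b i = B" and least: "\<And>l. l < i \<Longrightarrow> \<not> (l \<le> m \<and> b l = B)"
    using exists_least_iff[of "\<lambda>i. i \<le> m \<and> b i = B"] by blast
  have "i \<noteq> 0"
  proof
    assume "i = 0"
    then have "B \<le> K" using i(2) a0 by (simp add: b_def)
    then show False using \<open>K < B\<close> by simp
  qed
  then obtain l where l: "i = Suc l" using not0_implies_Suc by blast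
  have "i \<noteq> m"
  proof
    assume "i = m"
    then have "B \<le> K" using i(2) am r by (simp add: b_def field_simps)
    then show False using \<open>K < B\<close> by simp
  qed
  then have "b (Suc i) \<le> B" using i(1) le by simp
  moreover have "b l < B" using least[of l] le[of l] i(1) l by fastforce
  ultimately have "b l * b (Suc i) < B * B"
    using b0[of l] b0[of "Suc i"] \<open>0 < B\<close> 
    by (meson le_less_trans mult_left_mono mult_strict_right_mono)
  then show False using bc[of l] i(2) l by (simp add: power2_eq_square)
qed

text \<open>The \<open>l^2\<close> bounds interpolate between orders 1 and \<open>m + 1\<close>. The
  sup bounds combine consecutive \<open>l^2\<close> bounds in the Agmon inequality: at order 0
  through \<open>norm f\<close>, at higher orders with the excess \<open>\<mu>\<^sup>2\<close>
  absorbed by one factor \<open>r\<close>.\<close>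

lemma regular_interpolation:
  assumes mu: "0 < \<mu>" and r: "\<mu>\<^sup>2 \<le> r"
    and f0: "norm f \<le> \<mu>" and f1: "norm (fdiff f) \<le> \<mu> ^ 3" and fm: "norm ((fdiff ^^ (m + 1)) f) \<le> \<mu> ^ 3 * r ^ m"
  shows "regular m (\<mu> ^ 3) (\<mu>\<^sup>2) r 2 f"
proof -
  have r0: "0 < r" using mu r by (meson less_le_trans zero_less_power)
  define a where "a j = norm ((fdiff ^^ Suc j) f)" for j
  have a: "a j \<le> \<mu> ^ 3 * r ^ j" if "j \<le> m" for j
  proof (rule log_convex_bound[OF _ _ r0 _ _ that])
    show "(a (Suc j))\<^sup>2 \<le> a j * a (Suc (Suc j))" for j
      unfolding a_def by (rule norm_fdiff_log_convex)
  qed (use f1 fm in \<open>simp_all add: a_def\<close>)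
  show ?thesis
    unfolding regular_def
  proof (intro conjI allI impI)
    fix j assume j: "1 \<le> j \<and> j \<le> m + 1"
    then have "norm ((fdiff ^^ j) f) \<le> \<mu> ^ 3 * r ^ (j - 1)"
      using a[of "j - 1"] by (cases j) (simp_all add: a_def)
    moreover have "0 \<le> \<mu> ^ 3 * r ^ (j - 1)" using mu r0 by simp
    ultimately show "norm ((fdiff ^^ j) f) \<le> 2 * \<mu> ^ 3 * r ^ (j - 1)" by simp
  next
    fix j k assume j: "j \<le> m"
    have s: "(cmod (seq ((fdiff ^^ j) f) k))\<^sup>2 \<le> 2 * (norm ((fdiff ^^ j) f) * a j)"
      using cmod_seq_square_le[of "(fdiff ^^ j) f" k] by (simp add: a_def)
    have "(cmod (seq ((fdiff ^^ j) f) k))\<^sup>2 \<le> (2 * \<mu>\<^sup>2 * r ^ j)\<^sup>2"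
    proof (cases j)
      case 0
      have "norm f * a 0 \<le> \<mu> * \<mu> ^ 3"
        using f0 a[of 0] mu by (intro mult_mono) (simp_all add: a_def)
      also have "\<dots> = (\<mu>\<^sup>2)\<^sup>2" by (simp add: eval_nat_numeral)
      finally have "(cmod (seq ((fdiff ^^ j) f) k))\<^sup>2 \<le> 2 * (\<mu>\<^sup>2)\<^sup>2"
        using s 0 by simp
      also have "\<dots> \<le> (2 * \<mu>\<^sup>2 * r ^ j)\<^sup>2" using 0 by (simp add: power_mult_distrib)
      finally show ?thesis .
    next
      case (Suc i)
      have "norm ((fdiff ^^ j) f) * a j \<le> (\<mu> ^ 3 * r ^ i) * (\<mu> ^ 3 * r ^ j)"
        using a[of i] a[of j] j Suc mu r0 by (intro mult_mono) (simp_all add: a_def)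
      also have "\<dots> = (\<mu>\<^sup>2)\<^sup>2 * r ^ i * r ^ j * \<mu>\<^sup>2"
        by (simp add: eval_nat_numeral)
      also have "\<dots> \<le> (\<mu>\<^sup>2)\<^sup>2 * r ^ i * r ^ j * r"
        using r r0 by (intro mult_left_mono) simp_all
      also have "\<dots> = (\<mu>\<^sup>2 * r ^ j)\<^sup>2"
        by (simp add: Suc power2_eq_square)
      finally have "(cmod (seq ((fdiff ^^ j) f) k))\<^sup>2 \<le> 2 * (\<mu>\<^sup>2 * r ^ j)\<^sup>2"
        using s by simp
      also have "\<dots> \<le> (2 * \<mu>\<^sup>2 * r ^ j)\<^sup>2" by (simp add: power_mult_distrib)
      finally show ?thesis .
    qed
    moreover have "0 \<le> 2 * \<mu>\<^sup>2 * r ^ j" using r0 by simp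
    ultimately show "cmod (seq ((fdiff ^^ j) f) k) \<le> 2 * \<mu>\<^sup>2 * r ^ j"
      using power2_le_imp_le by blast
  qed
qed

lemma power_sum_le:
  fixes a b :: real
  assumes "0 \<le> a" "0 \<le> b"
  shows "(a + b) ^ m \<le> 2 ^ m * (a ^ m + b ^ m)"
proof -
  have "(a + b) ^ m \<le> (2 * max a b) ^ m"
    using assms by (intro power_mono) auto
  also have "\<dots> = 2 ^ m * max a b ^ m" by (simp add: power_mult_distrib)
  also have "max a b ^ m \<le> a ^ m + b ^ m"
    using assms by (simp add: max_def)
  finally show ?thesis by simp
qed

text \<open>The exponent \<open>1 / m - 1\<close> is at most 0, so the lower bound on
  \<open>z\<close> bounds \<open>z powr (1 / m - 1)\<close> from above by a multiple of
  \<open>1 / r ^ (2 * m - 2)\<close>, exactly offsetting the growth allowed for \<open>Y'\<close>.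
  Thus \<open>Z\<close> has bounded slope, of order \<open>\<mu> ^ 8\<close>.\<close>

lemma polynomial_growth:
  fixes Y Y' r :: "real \<Rightarrow> real"
  assumes m: "1 \<le> m" and c: "0 < c" and mu: "0 < \<mu>" and D: "0 \<le> D"
    and r: "\<And>t. 0 < r t"
    and lower: "\<And>t. c * (\<mu> ^ 6 * r t ^ (2 * m)) \<le> Y t"
    and deriv: "\<And>t. (Y has_real_derivative Y' t) (at t)"
    and bound: "\<And>t. \<bar>Y' t\<bar> \<le> D * (\<mu> ^ 14 * r t ^ (2 * m - 2))"
  shows "Y t \<le> 2 ^ m * (Y 0 + (D * c powr (1 / m - 1)) ^ m * (\<mu> ^ (8 * m + 6) * \<bar>t\<bar> ^ m))"
proof -
  define B where "B = D * c powr (1 / m - 1)"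
  have B0: "0 \<le> B" using D by (simp add: B_def)
  define z where "z t = Y t / \<mu> ^ 6" for t
  have zl: "c * r t ^ (2 * m) \<le> z t" for t
    using lower[of t] mu by (simp add: z_def field_simps)
  have cr: "0 < c * r t ^ (2 * m)" for t using c r by simp
  have z0: "0 < z t" for t using zl[of t] cr[of t] by linarith
  define Z where "Z t = z t powr (1 / m)" for t
  have Zd: "(Z has_real_derivative (1 / m) * z t powr (1 / m - 1) * (Y' t / \<mu> ^ 6)) (at t)" for t
  proof -
    have "(z has_real_derivative Y' t / \<mu> ^ 6) (at t)"
      unfolding z_def[abs_def] by (intro DERIV_cdivide deriv)
    then show ?thesis
      unfolding Z_def[abs_def] by (rule DERIV_chain2[where g = z, OF has_real_derivative_powr[OF z0]])
  qed
  have Zb: "norm ((1 / m) * z t powr (1 / m - 1) * (Y' t / \<mu> ^ 6)) \<le> B * \<mu> ^ 8" for t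
  proof -
    have "z t powr (1 / m - 1) \<le> (c * r t ^ (2 * m)) powr (1 / m - 1)"
      using m cr[of t] zl[of t] by (intro powr_mono2') (simp_all add: field_simps)
    also have "\<dots> = c powr (1 / m - 1) / r t ^ (2 * m - 2)"
    proof -
      have "(r t ^ (2 * m)) powr (1 / m - 1) = r t powr (real (2 * m) * (1 / m - 1))"
        using r[of t] by (simp add: powr_powr flip: powr_realpow)
      also have "real (2 * m) * (1 / m - 1) = - real (2 * m - 2)"
        using m by (simp add: field_simps of_nat_diff)
      also have "r t powr - real (2 * m - 2) = 1 / r t ^ (2 * m - 2)"
        using r[of t] by (simp add: powr_minus powr_realpow divide_inverse)
      finally show ?thesis using c r[of t] by (simp add: powr_mult)
    qed
    finally have 1: "z t powr (1 / m - 1) \<le> c powr (1 / m - 1) / r t ^ (2 * m - 2)" .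
    have "\<bar>Y' t / \<mu> ^ 6\<bar> \<le> D * (\<mu> ^ 8 * r t ^ (2 * m - 2))"
    proof -
      have "\<bar>Y' t / \<mu> ^ 6\<bar> \<le> D * (\<mu> ^ 14 * r t ^ (2 * m - 2)) / \<mu> ^ 6"
        using bound[of t] mu by (simp add: divide_right_mono)
      also have "\<mu> ^ 14 = \<mu> ^ 8 * \<mu> ^ 6" by (simp flip: power_add)
      also have "D * (\<mu> ^ 8 * \<mu> ^ 6 * x) / \<mu> ^ 6 = D * (\<mu> ^ 8 * x)" for x
      proof -
        have "D * (a * b * x) / b = D * (a * x)" if "b \<noteq> 0" for a b :: real
          using that by simp
        then show ?thesis using mu by (metis less_irrefl power_not_zero)
      qed
      finally show ?thesis .
    qed
    then have "z t powr (1 / m - 1) * \<bar>Y' t / \<mu> ^ 6\<bar>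
        \<le> (c powr (1 / m - 1) / r t ^ (2 * m - 2)) * (D * (\<mu> ^ 8 * r t ^ (2 * m - 2)))"
      using 1 r[of t] by (intro mult_mono) simp_all
    also have "\<dots> = B * \<mu> ^ 8"
      using r[of t] by (simp add: B_def)
    finally have 2: "z t powr (1 / m - 1) * \<bar>Y' t / \<mu> ^ 6\<bar> \<le> B * \<mu> ^ 8" .
    have "norm ((1 / m) * z t powr (1 / m - 1) * (Y' t / \<mu> ^ 6)) = (1 / m) * (z t powr (1 / m - 1) * \<bar>Y' t / \<mu> ^ 6\<bar>)"
      by (simp add: abs_mult)
    also have "\<dots> \<le> 1 * (z t powr (1 / m - 1) * \<bar>Y' t / \<mu> ^ 6\<bar>)"
      using m by (intro mult_right_mono) simp_all
    finally show ?thesis using 2 by simp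
  qed
  have "norm (Z t - Z 0) \<le> B * \<mu> ^ 8 * norm (t - 0)"
    by (rule field_differentiable_bound[of UNIV Z "\<lambda>t. (1 / m) * z t powr (1 / m - 1) * (Y' t / \<mu> ^ 6)"])
      (use Zd Zb in auto)
  then have "Z t \<le> Z 0 + B * \<mu> ^ 8 * \<bar>t\<bar>" by (simp add: abs_le_iff)
  then have "Z t ^ m \<le> (Z 0 + B * \<mu> ^ 8 * \<bar>t\<bar>) ^ m"
    by (intro power_mono) (simp_all add: Z_def)
  also have "\<dots> \<le> 2 ^ m * (Z 0 ^ m + (B * \<mu> ^ 8 * \<bar>t\<bar>) ^ m)"
    using B0 mu by (intro power_sum_le) (simp_all add: Z_def)
  finally have Zm: "Z t ^ m \<le> 2 ^ m * (Z 0 ^ m + (B * \<mu> ^ 8 * \<bar>t\<bar>) ^ m)" .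
  have "Z t ^ m = z t" for t
    using m z0[of t] by (simp add: Z_def powr_powr flip: powr_realpow)
  then have "Y t / \<mu> ^ 6 \<le> 2 ^ m * (Y 0 / \<mu> ^ 6 + (B * \<mu> ^ 8 * \<bar>t\<bar>) ^ m)"
    using Zm by (simp add: z_def)
  then have "Y t \<le> 2 ^ m * (Y 0 / \<mu> ^ 6 + (B * \<mu> ^ 8 * \<bar>t\<bar>) ^ m) * \<mu> ^ 6"
    using mu by (simp add: pos_divide_le_eq)
  also have "\<dots> = 2 ^ m * (Y 0 + B ^ m * (\<mu> ^ (8 * m + 6) * \<bar>t\<bar> ^ m))"
    using mu by (simp add: power_mult_distrib power_add power_mult[symmetric] field_simps)
  finally show ?thesis by (simp add: B_def)
qed

text \<open>Either \<open>\<mu> ^ 4\<close> is at most \<open>\<epsilon> * r\<^sup>2\<close>, and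
  the first term suffices, or \<open>r\<close> is bounded in terms of \<open>\<mu>\<close>, and the
  second does. This absorbs the quartic part of the modified energy.\<close>

lemma young_split:
  fixes \<mu> r \<epsilon> :: real
  assumes "0 < \<mu>" "0 < r" "0 < \<epsilon>"
  shows "\<mu> ^ 10 * r ^ (2 * k) \<le> \<epsilon> * (\<mu> ^ 6 * r ^ (2 * Suc k)) + (1 / \<epsilon>) ^ k * \<mu> ^ (4 * Suc k + 6)"
proof (cases "\<mu> ^ 4 \<le> \<epsilon> * r\<^sup>2")
  case True
  have "\<mu> ^ 10 * r ^ (2 * k) = \<mu> ^ 4 * (\<mu> ^ 6 * r ^ (2 * k))"
    by (simp flip: power_add mult.assoc)
  also have "\<dots> \<le> (\<epsilon> * r\<^sup>2) * (\<mu> ^ 6 * r ^ (2 * k))"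
    using True assms by (intro mult_right_mono) simp_all
  also have "\<dots> = \<epsilon> * (\<mu> ^ 6 * r ^ (2 * Suc k))"
    by (simp add: power2_eq_square mult_ac)
  finally show ?thesis using assms by (simp add: add_increasing2)
next
  case False
  then have "r\<^sup>2 \<le> (1 / \<epsilon>) * \<mu> ^ 4" using assms by (simp add: field_simps)
  then have "(r\<^sup>2) ^ k \<le> ((1 / \<epsilon>) * \<mu> ^ 4) ^ k" by (intro power_mono) simp_all
  then have "\<mu> ^ 10 * r ^ (2 * k) \<le> \<mu> ^ 10 * ((1 / \<epsilon>) ^ k * \<mu> ^ (4 * k))"
    using assms by (intro mult_left_mono) (simp_all add: power_mult_distrib power_divide flip: power_mult)
  also have "\<dots> = (1 / \<epsilon>) ^ k * (\<mu> ^ 10 * \<mu> ^ (4 * k))"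
    by (simp only: mult_ac)
  also have "\<mu> ^ 10 * \<mu> ^ (4 * k) = \<mu> ^ (4 * Suc k + 6)"
    unfolding power_add[symmetric] by (rule arg_cong[of _ _ "power \<mu>"]) simp
  finally show ?thesis using assms by (simp add: add_increasing)
qed

lemma prod_less4: "(\<Prod>i<4. h i) = h 0 * h 1 * h 2 * h (3 :: nat)" for h :: "nat \<Rightarrow> 'b :: comm_monoid_mult"
  by (simp add: eval_nat_numeral)

section \<open>The differential inequality for the modified energy\<close>

context dnls
begin

text \<open>The power 10 is that of \<open>(\<mu> ^ 3)\<^sup>2 * (\<mu>\<^sup>2)\<^sup>2\<close>. A
  cubic argument brings two more sup norms, that is \<open>\<mu> ^ 4\<close>, through
  \<open>regular_mult\<close>.\<close>

lemma form_slots_le: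
  assumes C: "form_bounded m (qform m) C" and r: "0 \<le> r" and mu: "0 \<le> \<mu>"
    and reg: "regular m (\<mu> ^ 3) (\<mu>\<^sup>2) r 2 (v t)"
  shows "cmod (form (qform m) (slots t)) \<le> 16 * C * (\<mu> ^ 10 * r ^ (2 * m - 2))"
    and "cmod (sextic m t) \<le> 256 * 4 ^ (m + 1) * C * (\<mu> ^ 14 * r ^ (2 * m - 2))"
proof -
  have C': "cmod (form (qform m) w) \<le> C * (\<Prod>i<4. c i) * (\<mu> ^ 3)\<^sup>2 * (\<mu>\<^sup>2)\<^sup>2 * r ^ (2 * m - 2)"
    if "\<And>i. i < 4 \<Longrightarrow> 0 \<le> c i" "\<And>i. i < 4 \<Longrightarrow> regular m (\<mu> ^ 3) (\<mu>\<^sup>2) r (c i) (w i)" for c w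
    using C[unfolded form_bounded_def, rule_format, of "\<mu> ^ 3" "\<mu>\<^sup>2" r c w] that mu r by simp
  have m10: "(\<mu> ^ 3)\<^sup>2 * (\<mu>\<^sup>2)\<^sup>2 = \<mu> ^ 10" by (simp flip: power_mult power_add)
  have sl: "regular m (\<mu> ^ 3) (\<mu>\<^sup>2) r 2 (slots t i)" for i
    using reg by (simp add: slots_def regular_conj2)
  have "cmod (form (qform m) (slots t)) \<le> C * (\<Prod>i<(4 :: nat). 2) * (\<mu> ^ 3)\<^sup>2 * (\<mu>\<^sup>2)\<^sup>2 * r ^ (2 * m - 2)"
    by (rule C') (simp_all add: sl)
  also have "\<dots> = 16 * C * (((\<mu> ^ 3)\<^sup>2 * (\<mu>\<^sup>2)\<^sup>2) * r ^ (2 * m - 2))"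
    by (simp add: mult_ac)
  finally show "cmod (form (qform m) (slots t)) \<le> 16 * C * (\<mu> ^ 10 * r ^ (2 * m - 2))"
    unfolding m10 .
  let ?c = "2 ^ (m + 1) * \<mu>\<^sup>2 * (2 ^ (m + 1) * \<mu>\<^sup>2 * 2 * 2) * 2"
  have c: "?c = 8 * 4 ^ (m + 1) * \<mu> ^ 4"
  proof -
    have "(4 :: real) ^ (m + 1) = 2 ^ (m + 1) * 2 ^ (m + 1)" by (simp flip: power_mult_distrib)
    moreover have "\<mu> ^ 4 = \<mu>\<^sup>2 * \<mu>\<^sup>2" by (simp flip: power_add)
    ultimately show ?thesis by (simp only: mult_ac)
  qed
  have cb: "regular m (\<mu> ^ 3) (\<mu>\<^sup>2) r ?c (slots_cubic t i)" for i
  proof -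
    have "regular m (\<mu> ^ 3) (\<mu>\<^sup>2) r ?c (cubic (v t))"
      unfolding cubic_def using mu r by (intro regular_mult regular_conj2 reg) simp_all
    then show ?thesis by (simp add: slots_cubic_def regular_conj2)
  qed
  have "cmod ((- 1) ^ i * form (qform m) ((slots t)(i := slots_cubic t i))) \<le> 64 * 4 ^ (m + 1) * C * (\<mu> ^ 14 * r ^ (2 * m - 2))"
    if "i < 4" for i
  proof -
    define d where "d k = (if k = i then ?c else 2)" for k :: nat
    have "cmod (form (qform m) ((slots t)(i := slots_cubic t i))) \<le> C * (\<Prod>k<4. d k) * (\<mu> ^ 3)\<^sup>2 * (\<mu>\<^sup>2)\<^sup>2 * r ^ (2 * m - 2)"
      by (rule C') (use mu sl cb in \<open>auto simp: d_def\<close>)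
    also have "(\<Prod>k<4. d k) = ?c * 8"
      unfolding prod_less4 using that by (elim less4_cases) (simp_all add: d_def)
    also have "C * (?c * 8) * (\<mu> ^ 3)\<^sup>2 * (\<mu>\<^sup>2)\<^sup>2 * r ^ (2 * m - 2) = 64 * 4 ^ (m + 1) * C * ((\<mu> ^ 4 * \<mu> ^ 10) * r ^ (2 * m - 2))"
      unfolding c m10[symmetric] by (simp only: mult_ac)
    also have "\<mu> ^ 4 * \<mu> ^ 10 = \<mu> ^ 14" by (simp flip: power_add)
    finally show ?thesis
      by (simp only: norm_mult norm_power norm_minus_cancel norm_one power_one mult_1)
  qed
  then have "cmod (sextic m t) \<le> (\<Sum>i<(4 :: nat). 64 * 4 ^ (m + 1) * C * (\<mu> ^ 14 * r ^ (2 * m - 2)))"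
    unfolding sextic_def by (intro sum_norm_le) simp
  then show "cmod (sextic m t) \<le> 256 * 4 ^ (m + 1) * C * (\<mu> ^ 14 * r ^ (2 * m - 2))"
    by simp
qed

lemma high_norm_growth:
  fixes k :: nat
  defines "m \<equiv> Suc k"
  defines "R \<equiv> \<lambda>t. norm ((fdiff ^^ (m + 1)) (v t))"
  assumes C0: "0 \<le> C" and C: "form_bounded m (qform m) C" and mu: "0 < \<mu>"
    and v0: "\<And>t. norm (v t) \<le> \<mu>" and v1: "\<And>t. norm (fdiff (v t)) \<le> \<mu> ^ 3"
    and c0_def: "c0 = (1/4) ^ (m + 1) / 2 ^ m" and K0_def: "K0 = real (m + 1) * 2 ^ (2 * m + 1)"
    and A_def: "A = c0 + 4 * C * (2 * (4 * C + 1) / c0) ^ k"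
    and D_def: "D = 64 * 4 ^ (m + 1) * C"
  shows "(R t)\<^sup>2 \<le> 2 / c0 * 2 ^ m * ((K0 + 4 * C) * (R 0)\<^sup>2 + (4 * C + A) * \<mu> ^ (4 * m + 6)
    + (D * (c0 / 2) powr (1 / m - 1)) ^ m * (\<mu> ^ (8 * m + 6) * \<bar>t\<bar> ^ m))"
proof -
  have c0: "0 < c0" by (simp add: c0_def)
  \<comment> \<open>Either the root is the maximum and \<open>q t = (R t)\<^sup>2\<close>, or
    \<open>r t = \<mu>\<^sup>2\<close> and \<open>q t = P\<close>; so \<open>q\<close> and the
    squared norm differ by at most \<open>P\<close>.\<close>
  define r where "r t = max (\<mu>\<^sup>2) (root m (R t / \<mu> ^ 3))" for t
  define P where "P = \<mu> ^ (4 * m + 6)"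
  define q where "q t = \<mu> ^ 6 * r t ^ (2 * m)" for t
  have R0: "0 \<le> R t" for t by (simp add: R_def)
  have r0: "0 < r t" and rmu: "\<mu>\<^sup>2 \<le> r t" for t using mu by (simp_all add: r_def less_max_iff_disj)
  have root: "root m (R t / \<mu> ^ 3) ^ m = R t / \<mu> ^ 3" for t
    using R0 mu by (intro real_root_pow_pos2) (simp_all add: m_def)
  have rm: "R t \<le> \<mu> ^ 3 * r t ^ m" for t
  proof -
    have "root m (R t / \<mu> ^ 3) ^ m \<le> r t ^ m"
      using R0 mu by (intro power_mono) (simp_all add: r_def m_def)
    then show ?thesis unfolding root using mu by (simp add: field_simps)
  qed
  have Rq: "(R t)\<^sup>2 \<le> q t" for t
  proof -
    have "(R t)\<^sup>2 \<le> (\<mu> ^ 3 * r t ^ m)\<^sup>2" using R0 rm by (intro power_mono)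
    also have "\<dots> = q t" by (simp add: q_def power_mult_distrib mult.commute flip: power_mult)
    finally show ?thesis .
  qed
  have qR: "q t \<le> (R t)\<^sup>2 + P" for t
  proof (cases "r t = \<mu>\<^sup>2")
    case True
    have "q t = P"
      unfolding q_def P_def True by (simp add: power_add mult_ac flip: power_mult)
    then show ?thesis by simp
  next
    case False
    then have "r t = root m (R t / \<mu> ^ 3)" by (auto simp: r_def max_def split: if_splits)
    then have "r t ^ m = R t / \<mu> ^ 3" using root by simp
    moreover have "q t = (\<mu> ^ 3 * r t ^ m)\<^sup>2" by (simp add: q_def power_mult_distrib mult.commute flip: power_mult)
    ultimately have "q t = (R t)\<^sup>2" using mu by simp
    then show ?thesis using mu by (simp add: P_def)
  qed
  have reg: "regular m (\<mu> ^ 3) (\<mu>\<^sup>2) (r t) 2 (v t)" for t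
    using rm[of t] by (intro regular_interpolation mu rmu v0 v1) (simp add: R_def)
  define T where "T t = \<mu> ^ 10 * r t ^ (2 * k)" for t
  have Q: "\<bar>\<nu> / 4 * Re (form (qform m) (slots t))\<bar> \<le> 4 * C * T t" for t
  proof -
    have "\<bar>\<nu> / 4 * Re (form (qform m) (slots t))\<bar> = 1/4 * \<bar>Re (form (qform m) (slots t))\<bar>"
      using nu by (auto simp: abs_mult)
    also have "\<dots> \<le> 1/4 * (16 * C * (\<mu> ^ 10 * r t ^ (2 * m - 2)))"
      using form_slots_le(1)[OF C _ _ reg, of t] r0[of t] mu abs_Re_le_cmod[of "form (qform m) (slots t)"] by simp
    finally show ?thesis by (simp add: T_def m_def)
  qed
  define Y where "Y t = mod_energy m t + A * P" for t
  have P0: "0 < P" using mu by (simp add: P_def)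
  have lower: "c0 / 2 * (\<mu> ^ 6 * r t ^ (2 * m)) \<le> Y t" for t
  proof -
    \<comment> \<open>Chosen to make \<open>4 * C * \<epsilon> \<le> c0 / 2\<close>; the added 1
      covers \<open>C = 0\<close>. In \<open>A\<close>, the summand \<open>c0\<close> pays for the
      \<open>P\<close> lost in \<open>qR\<close>, the other for the remainder in
      \<open>young_split\<close>.\<close>
    define \<epsilon> where "\<epsilon> = c0 / (2 * (4 * C + 1))"
    have e: "0 < \<epsilon>" using c0 C0 by (simp add: \<epsilon>_def)
    have "T t \<le> \<epsilon> * q t + (1 / \<epsilon>) ^ k * P"
      using young_split[OF mu r0[of t] e, of k] by (simp add: T_def q_def P_def m_def)
    then have "4 * C * T t \<le> 4 * C * (\<epsilon> * q t + (1 / \<epsilon>) ^ k * P)"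
      using C0 by (intro mult_left_mono) simp_all
    also have "\<dots> = (4 * C * \<epsilon>) * q t + (A - c0) * P"
      by (simp add: A_def \<epsilon>_def algebra_simps)
    also have "\<dots> \<le> (c0 / 2) * q t + (A - c0) * P"
    proof -
      have "4 * C * \<epsilon> \<le> c0 / 2" using c0 C0 by (simp add: \<epsilon>_def field_simps)
      moreover have "0 \<le> q t" using mu r0[of t] by (simp add: q_def)
      ultimately have "4 * C * \<epsilon> * q t \<le> c0 / 2 * q t" by (rule mult_right_mono)
      then show ?thesis by simp
    qed
    finally have 1: "4 * C * T t \<le> (c0 / 2) * q t + (A - c0) * P" .
    have "c0 * (q t - P) \<le> c0 * (R t)\<^sup>2" using c0 qR[of t] by (intro mult_left_mono) simp_all
    also have "\<dots> \<le> inner (enop m (v t)) (v t)"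
      unfolding R_def c0_def by (rule inner_enop_lower)
    finally have "c0 * q t - c0 * P - 4 * C * T t \<le> mod_energy m t"
      using Q[of t] by (simp add: mod_energy_def right_diff_distrib abs_le_iff)
    then have "c0 / 2 * q t \<le> Y t" using 1 by (simp add: Y_def algebra_simps)
    then show ?thesis unfolding q_def .
  qed
  have deriv: "(Y has_real_derivative 1/4 * Re (\<i> * sextic m t)) (at t)" for t
    unfolding Y_def[abs_def] using DERIV_add[OF mod_energy_deriv DERIV_const] by fastforce
  have bound: "\<bar>1/4 * Re (\<i> * sextic m t)\<bar> \<le> D * (\<mu> ^ 14 * r t ^ (2 * m - 2))" for t
  proof -
    have "\<bar>1/4 * Re (\<i> * sextic m t)\<bar> \<le> 1/4 * cmod (sextic m t)"
      using abs_Im_le_cmod[of "sextic m t"] by (simp add: abs_mult)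
    also have "\<dots> \<le> 1/4 * (256 * 4 ^ (m + 1) * C * (\<mu> ^ 14 * r t ^ (2 * m - 2)))"
      using form_slots_le(2)[OF C _ _ reg, of t] r0[of t] mu by (intro mult_left_mono) simp_all
    finally show ?thesis by (simp add: D_def mult_ac)
  qed
  have "Y t \<le> 2 ^ m * (Y 0 + (D * (c0 / 2) powr (1 / m - 1)) ^ m * (\<mu> ^ (8 * m + 6) * \<bar>t\<bar> ^ m))"
    by (rule polynomial_growth[OF _ _ mu _ r0 lower deriv bound]) (use c0 C0 in \<open>simp_all add: m_def D_def\<close>)
  moreover have "Y 0 \<le> (K0 + 4 * C) * (R 0)\<^sup>2 + (4 * C + A) * P"
  proof -
    \<comment> \<open>At time 0 no small constant is required:
      \<open>\<mu>\<^sup>2 \<le> r 0\<close> alone bounds the quartic size \<open>T 0\<close> by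
      \<open>q 0\<close>.\<close>
    have "\<mu> ^ 4 \<le> (r 0)\<^sup>2"
      using power_mono[OF rmu[of 0], of 2] by (simp flip: power_mult)
    then have "\<mu> ^ 4 * (\<mu> ^ 6 * r 0 ^ (2 * k)) \<le> (r 0)\<^sup>2 * (\<mu> ^ 6 * r 0 ^ (2 * k))"
      using mu r0[of 0] by (intro mult_right_mono) simp_all
    moreover have "\<mu> ^ 4 * (\<mu> ^ 6 * r 0 ^ (2 * k)) = T 0"
      by (simp add: T_def flip: power_add mult.assoc)
    moreover have "(r 0)\<^sup>2 * (\<mu> ^ 6 * r 0 ^ (2 * k)) = q 0"
      by (simp add: q_def m_def power2_eq_square mult_ac)
    ultimately have "T 0 \<le> (R 0)\<^sup>2 + P" using qR[of 0] by simp
    then have "4 * C * T 0 \<le> 4 * C * ((R 0)\<^sup>2 + P)" using C0 by (intro mult_left_mono) simp_all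
    moreover have "inner (enop m (v 0)) (v 0) \<le> K0 * (R 0)\<^sup>2"
      unfolding R_def K0_def by (rule inner_enop_upper)
    ultimately show ?thesis
      using Q[of 0] by (simp add: Y_def mod_energy_def algebra_simps abs_le_iff)
  qed
  ultimately have "Y t \<le> 2 ^ m * ((K0 + 4 * C) * (R 0)\<^sup>2 + (4 * C + A) * P
      + (D * (c0 / 2) powr (1 / m - 1)) ^ m * (\<mu> ^ (8 * m + 6) * \<bar>t\<bar> ^ m))" (is "_ \<le> 2 ^ m * ?B")
    by (smt (verit, best) mult_left_mono zero_le_power)
  moreover have "(R t)\<^sup>2 \<le> 2 / c0 * Y t"
    using order_trans[OF mult_left_mono[OF Rq[of t], of "c0 / 2"] lower[of t, folded q_def]] c0
    by (simp add: field_simps)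
  ultimately have "(R t)\<^sup>2 \<le> 2 / c0 * (2 ^ m * ?B)"
    using c0 by (meson divide_nonneg_pos less_imp_le mult_left_mono order_trans zero_le_numeral)
  then show ?thesis by (simp add: P_def mult.assoc)
qed

end

lemma high_norm_bound:
  assumes "1 \<le> m"
  shows "\<exists>K>0. \<forall>\<nu> v \<mu> t. dnls \<nu> v \<longrightarrow> 0 < \<mu> \<longrightarrow> (\<forall>t. norm (v t) \<le> \<mu>) \<longrightarrow> (\<forall>t. norm (fdiff (v t)) \<le> \<mu> ^ 3) \<longrightarrow>
    (norm ((fdiff ^^ (m + 1)) (v t)))\<^sup>2 \<le> K * ((norm ((fdiff ^^ (m + 1)) (v 0)))\<^sup>2 + \<mu> ^ (4 * m + 6) + \<mu> ^ (8 * m + 6) * \<bar>t\<bar> ^ m)"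
proof -
  obtain k where k: "m = Suc k" using assms by (metis Suc_le_D One_nat_def)
  obtain C where C: "0 \<le> C" "form_bounded m (qform m) C"
    using form_Jpow_le[OF qform_in_Jpow assms] by blast
  define c0 :: real where "c0 = (1/4) ^ (m + 1) / 2 ^ m"
  define K0 where "K0 = real (m + 1) * 2 ^ (2 * m + 1)"
  define A where "A = c0 + 4 * C * (2 * (4 * C + 1) / c0) ^ k"
  define D where "D = 64 * 4 ^ (m + 1) * C"
  define B where "B = (D * (c0 / 2) powr (1 / m - 1)) ^ m"
  define K1 where "K1 = K0 + 8 * C + A + B"
  define K where "K = 2 / c0 * 2 ^ m * K1"
  have pos: "0 < c0" "0 < K0" "0 < A" "0 \<le> B"
    using C(1) by (auto simp: c0_def K0_def A_def D_def B_def intro!: add_pos_nonneg)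
  have K1: "K0 + 4 * C \<le> K1" "4 * C + A \<le> K1" "B \<le> K1" "0 < K1"
    using pos C(1) by (simp_all add: K1_def)
  show ?thesis
  proof (intro exI[of _ K] conjI allI impI)
    show "0 < K" unfolding K_def using pos K1(4) by (intro mult_pos_pos) simp_all
    fix \<nu> v \<mu> t
    assume "dnls \<nu> v" and mu: "0 < \<mu>" and v: "\<forall>t. norm (v t) \<le> \<mu>" "\<forall>t. norm (fdiff (v t)) \<le> \<mu> ^ 3"
    then interpret dnls \<nu> v by simp
    let ?a = "(norm ((fdiff ^^ (m + 1)) (v 0)))\<^sup>2" and ?b = "\<mu> ^ (4 * m + 6)" and ?c = "\<mu> ^ (8 * m + 6) * \<bar>t\<bar> ^ m"
    have "(norm ((fdiff ^^ (m + 1)) (v t)))\<^sup>2 \<le> 2 / c0 * 2 ^ m * ((K0 + 4 * C) * ?a + (4 * C + A) * ?b + B * ?c)"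
      unfolding B_def k
      by (rule high_norm_growth[OF C(1) C(2)[unfolded k] mu])
        (use v in \<open>simp_all add: c0_def K0_def A_def D_def k\<close>)
    also have "\<dots> \<le> 2 / c0 * 2 ^ m * (K1 * ?a + K1 * ?b + K1 * ?c)"
      using pos mu by (intro mult_left_mono add_mono mult_right_mono K1) simp_all
    finally show "(norm ((fdiff ^^ (m + 1)) (v t)))\<^sup>2 \<le> K * (?a + ?b + ?c)"
      by (simp add: K_def algebra_simps)
  qed
qed

section \<open>The first-order bound\<close>

context dnls
begin

text \<open>By the Agmon inequality and conservation of mass, the quartic part of the energy is at
  most linear in \<open>norm (fdiff (v t))\<close>. Conservation of energy then gives
  \<open>N^2 <= M^2 + M N\<close>, hence \<open>N <= 2 M\<close>, for both signs of
  \<open>\<nu>\<close>.\<close>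

lemma norm_fdiff_v_le: "norm (fdiff (v t)) \<le> 2 * (norm (fdiff (v 0)) + norm (v 0) ^ 3)"
proof -
  let ?a = "norm (v 0)" and ?N = "\<lambda>t. norm (fdiff (v t))"
  define M where "M = ?N 0 + ?a ^ 3"
  have q: "(norm (v t * conj2 (v t)))\<^sup>2 \<le> 2 * ?a ^ 3 * ?N t" for t
  proof -
    have "norm (v t * conj2 (v t)) \<le> sqrt (2 * norm (v t) * ?N t) * norm (conj2 (v t))"
      by (rule norm_mult_bounded) (simp add: real_le_rsqrt cmod_seq_square_le)
    then have "(norm (v t * conj2 (v t)))\<^sup>2 \<le> (sqrt (2 * norm (v t) * ?N t) * norm (conj2 (v t)))\<^sup>2"
      by (rule power_mono) simp
    also have "\<dots> = 2 * norm (v t) * ?N t * (norm (v t))\<^sup>2"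
      by (simp add: power_mult_distrib)
    also have "\<dots> = 2 * norm (v t) ^ 3 * ?N t"
      by (simp add: power2_eq_square power3_eq_cube mult_ac)
    finally show ?thesis by (simp only: norm_v[of t])
  qed
  have "(?N t)\<^sup>2 - (?N 0)\<^sup>2 = \<nu> / 2 * ((norm (v t * conj2 (v t)))\<^sup>2 - (norm (v 0 * conj2 (v 0)))\<^sup>2)"
    using energy_const[of t] by (simp add: energy_def algebra_simps)
  also have "\<dots> \<le> 1 / 2 * ((norm (v t * conj2 (v t)))\<^sup>2 + (norm (v 0 * conj2 (v 0)))\<^sup>2)"
    using nu by auto
  also have "\<dots> \<le> ?a ^ 3 * ?N t + ?a ^ 3 * ?N 0"
    using q[of t] q[of 0] by simp
  finally have "(?N t)\<^sup>2 \<le> (?N 0 * (?N 0 + ?a ^ 3)) + ?a ^ 3 * ?N t"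
    by (simp add: power2_eq_square algebra_simps)
  also have "\<dots> \<le> M * M + M * ?N t"
    unfolding M_def by (intro add_mono mult_right_mono) simp_all
  finally have *: "(?N t)\<^sup>2 \<le> M * M + M * ?N t" .
  have "0 \<le> M" by (simp add: M_def)
  have "?N t \<le> 2 * M"
  proof (rule ccontr)
    assume "\<not> ?N t \<le> 2 * M"
    then have "2 * M < ?N t" by simp
    then have "0 < ?N t" "M \<le> ?N t / 2" using \<open>0 \<le> M\<close> by linarith+
    then have "M * M \<le> ?N t / 2 * (?N t / 2)" "M * ?N t \<le> ?N t / 2 * ?N t" "0 < ?N t * ?N t"
      using \<open>0 \<le> M\<close> by (intro mult_mono mult_right_mono mult_pos_pos; linarith)+
    then show False
      using * unfolding power2_eq_square by simp
  qed
  then show ?thesis by (simp add: M_def)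
qed

end

section \<open>The growth bound on the integer lattice\<close>

definition Mz :: "ell2 \<Rightarrow> real" where "Mz f = norm (fdiff f) + norm f ^ 3"

lemma Mz_nonneg: "0 \<le> Mz f"
  by (simp add: Mz_def)

lemma dnls_growth:
  assumes "1 \<le> n"
  shows "\<exists>C>0. \<forall>\<nu> v t. dnls \<nu> v \<longrightarrow> norm ((fdiff ^^ n) (v t)) \<le>
    C * (norm ((fdiff ^^ n) (v 0)) + Mz (v 0) powr ((2 * real n + 1) / 3)
      + time_growth n t * Mz (v 0) powr ((4 * real n - 1) / 3))"
proof (cases "n = 1")
  case True
  show ?thesis
  proof (intro exI[of _ 2] conjI allI impI)
    fix \<nu> v t assume "dnls \<nu> v"
    then interpret dnls \<nu> v .
    have "norm (fdiff (v t)) \<le> 2 * Mz (v 0)"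
      using norm_fdiff_v_le[of t] by (simp add: Mz_def)
    also have "\<dots> \<le> 2 * (norm (fdiff (v 0)) + Mz (v 0) + Mz (v 0))"
      using Mz_nonneg[of "v 0"] by (intro mult_left_mono) (simp_all add: add_increasing2 add_increasing)
    finally show "norm ((fdiff ^^ n) (v t)) \<le>
      2 * (norm ((fdiff ^^ n) (v 0)) + Mz (v 0) powr ((2 * real n + 1) / 3)
      + time_growth n t * Mz (v 0) powr ((4 * real n - 1) / 3))"
      using True Mz_nonneg[of "v 0"] by (simp add: time_growth_def)
  qed simp
next
  case False
  define m where "m = n - 1"
  have m: "1 \<le> m" "n = m + 1" using assms False by (simp_all add: m_def)
  obtain K where K: "0 < K" and Kb: "\<And>\<nu> v \<mu> t. dnls \<nu> v \<Longrightarrow> 0 < \<mu> \<Longrightarrow> (\<forall>t. norm (v t) \<le> \<mu>) \<Longrightarrow>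
    (\<forall>t. norm (fdiff (v t)) \<le> \<mu> ^ 3) \<Longrightarrow> (norm ((fdiff ^^ (m + 1)) (v t)))\<^sup>2
      \<le> K * ((norm ((fdiff ^^ (m + 1)) (v 0)))\<^sup>2 + \<mu> ^ (4 * m + 6) + \<mu> ^ (8 * m + 6) * \<bar>t\<bar> ^ m)"
    using high_norm_bound[OF m(1)] by metis
  \<comment> \<open>The larger of the two powers of 2 that come from powers of
    \<open>2 * M\<close>.\<close>
  define c where "c = 2 powr ((4 * real n - 1) / 3)"
  have c: "1 \<le> c" "2 powr ((2 * real n + 1) / 3) \<le> c"
    using assms unfolding c_def by (auto intro!: ge_one_powr_ge_zero powr_mono)
  show ?thesis
  proof (intro exI[of _ "sqrt K * c"] conjI allI impI)
    show "0 < sqrt K * c" using K c by simp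
    fix \<nu> v t assume d: "dnls \<nu> v"
    then interpret dnls \<nu> v .
    let ?R = "\<lambda>t. norm ((fdiff ^^ n) (v t))"
    define M where "M = Mz (v 0)"
    have M0: "0 \<le> M" by (simp add: M_def Mz_nonneg)
    show "?R t \<le> sqrt K * c * (?R 0 + Mz (v 0) powr ((2 * real n + 1) / 3)
      + time_growth n t * Mz (v 0) powr ((4 * real n - 1) / 3))"
    \<comment> \<open>\<open>high_norm_bound\<close> takes a positive scale; \<open>M = 0\<close>
      means the zero solution.\<close>
    proof (cases "M = 0")
      case True
      then have "v 0 = 0"
        by (simp add: M_def Mz_def add_nonneg_eq_0_iff)
      then have "v t = 0" using norm_v[of t] by simp
      then have "?R t = 0" using funpow_fdiff_simps(4)[of n] by simp
      then show ?thesis using K c by (simp add: time_growth_def)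
    next
      case False
      \<comment> \<open>The 2 is the constant of \<open>norm_fdiff_v_le\<close>; as
        \<open>norm (v t) ^ 3 \<le> M\<close>, also \<open>norm (v t) \<le> \<mu>\<close>.\<close>
      define \<mu> where "\<mu> = (2 * M) powr (1/3)"
      have mu: "0 < \<mu>" using False M0 by (simp add: \<mu>_def)
      have mu_pow: "\<mu> ^ j = (2 * M) powr (real j / 3)" for j
        using False M0 by (simp add: \<mu>_def powr_power)
      have mu3: "\<mu> ^ 3 = 2 * M" using M0 by (simp add: mu_pow)
      have "norm (v t) \<le> \<mu>" for t
      proof (rule power_le_imp_le_base[of _ 2])
        have "norm (v t) ^ Suc 2 \<le> M"
          using norm_v[of t] by (simp add: M_def Mz_def eval_nat_numeral)
        also have "\<dots> \<le> \<mu> ^ Suc 2" using mu3 M0 by (simp add: eval_nat_numeral)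
        finally show "norm (v t) ^ Suc 2 \<le> \<mu> ^ Suc 2" .
      qed (use mu in simp)
      moreover have "norm (fdiff (v t)) \<le> \<mu> ^ 3" for t
        using norm_fdiff_v_le[of t] by (simp add: mu3 M_def Mz_def)
      ultimately have R: "(?R t)\<^sup>2 \<le> K * ((?R 0)\<^sup>2 + \<mu> ^ (4 * m + 6) + \<mu> ^ (8 * m + 6) * \<bar>t\<bar> ^ m)"
        using Kb[OF d mu] m(2) by blast
      define \<tau> where "\<tau> = time_growth n t"
      have t0: "0 \<le> \<tau>" by (simp add: \<tau>_def time_growth_def)
      have tm: "\<bar>t\<bar> ^ m = \<tau>\<^sup>2"
      proof (cases "t = 0")
        case False
        then have "\<tau>\<^sup>2 = \<bar>t\<bar> powr real m"
          using m by (simp add: \<tau>_def time_growth_def powr_power)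
        then show ?thesis using False by (simp add: powr_realpow)
      qed (use m in \<open>simp add: \<tau>_def time_growth_def\<close>)
      have "(?R t)\<^sup>2 \<le> K * ((?R 0)\<^sup>2 + (\<mu> ^ (2 * m + 3))\<^sup>2 + (\<mu> ^ (4 * m + 3) * \<tau>)\<^sup>2)"
        using R by (simp add: tm power_mult_distrib power_mult[symmetric] algebra_simps)
      also have "\<dots> \<le> K * (?R 0 + \<mu> ^ (2 * m + 3) + \<mu> ^ (4 * m + 3) * \<tau>)\<^sup>2"
      proof -
        have "x\<^sup>2 + y\<^sup>2 + z\<^sup>2 \<le> (x + y + z)\<^sup>2" if "0 \<le> x" "0 \<le> y" "0 \<le> z" for x y z :: real
          using that by (simp add: power2_eq_square algebra_simps)
        then show ?thesis using K mu t0 by (intro mult_left_mono) simp_all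
      qed
      also have "\<dots> = (sqrt K * (?R 0 + \<mu> ^ (2 * m + 3) + \<mu> ^ (4 * m + 3) * \<tau>))\<^sup>2"
        using K by (simp add: power_mult_distrib)
      finally have "?R t \<le> sqrt K * (?R 0 + \<mu> ^ (2 * m + 3) + \<mu> ^ (4 * m + 3) * \<tau>)"
        using K mu t0 by (elim power2_le_imp_le) simp
      also have "\<mu> ^ (2 * m + 3) = 2 powr ((2 * real n + 1) / 3) * M powr ((2 * real n + 1) / 3)"
        unfolding mu_pow using M0 m(2) by (simp add: powr_mult add_ac)
      also have "\<mu> ^ (4 * m + 3) = c * M powr ((4 * real n - 1) / 3)"
        unfolding mu_pow c_def using M0 m(2) by (simp add: powr_mult add_ac)
      finally have "?R t \<le> sqrt K * (1 * ?R 0 + 2 powr ((2 * real n + 1) / 3) * M powr ((2 * real n + 1) / 3)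
          + c * (\<tau> * M powr ((4 * real n - 1) / 3)))"
        by (simp add: mult_ac)
      also have "\<dots> \<le> sqrt K * (c * ?R 0 + c * M powr ((2 * real n + 1) / 3) + c * (\<tau> * M powr ((4 * real n - 1) / 3)))"
        using K by (intro mult_left_mono add_mono mult_right_mono c order_refl) simp_all
      finally show ?thesis
        by (simp add: \<tau>_def M_def algebra_simps)
    qed
  qed
qed

section \<open>Scaling to the integer lattice\<close>

text \<open>The factor \<open>h\<close> matches the scaling \<open>v\<^sub>k(t) = h u(h\<^sup>2 t)(h k)\<close>, under which the equation is invariant.\<close>
definition to_ell2 :: "real \<Rightarrow> (real \<Rightarrow> complex) \<Rightarrow> ell2" where
  "to_ell2 h w = Abs_ell2 (\<lambda>k. complex_of_real h * w (h * of_int k))"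

lemma bij_betw_grid:
  assumes "0 < h"
  shows "bij_betw (\<lambda>k. h * of_int k) UNIV (grid h)"
  using assms by (auto simp: bij_betw_def grid_def inj_on_def)

lemma infsum_grid:
  fixes f :: "real \<Rightarrow> 'a :: {comm_monoid_add, t2_space}"
  assumes "0 < h"
  shows "infsum f (grid h) = (\<Sum>\<^sub>\<infinity>k. f (h * of_int k))"
  using infsum_reindex_bij_betw[OF bij_betw_grid[OF assms], of f] by simp

lemma seq_embed:
  assumes "0 < h" "w \<in> L2 h"
  shows "seq (to_ell2 h w) k = complex_of_real h * w (h * of_int k)"
proof -
  have "(\<lambda>k. (cmod (w (h * of_int k)))\<^sup>2) summable_on UNIV"
    using assms(2) summable_on_reindex_bij_betw[OF bij_betw_grid[OF assms(1)], of "\<lambda>g. (cmod (w g))\<^sup>2"]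
    by (simp add: L2_def)
  then have "(\<lambda>k. (cmod (complex_of_real h * w (h * of_int k)))\<^sup>2) summable_on UNIV"
    by (simp add: norm_mult power_mult_distrib summable_on_cmult_right)
  then have "seq (Abs_ell2 (\<lambda>k. complex_of_real h * w (h * of_int k))) = (\<lambda>k. complex_of_real h * w (h * of_int k))"
    by (intro Abs_ell2_inverse CollectI)
  then show ?thesis
    by (simp add: to_ell2_def)
qed

lemma norm_eq_L2_norm:
  assumes "0 < h" "\<And>k. seq f k = complex_of_real h * w (h * of_int k)"
  shows "norm f = sqrt h * L2_norm h w"
proof -
  have "(norm f)\<^sup>2 = (\<Sum>\<^sub>\<infinity>k. h\<^sup>2 * (cmod (w (h * of_int k)))\<^sup>2)"
    by (simp add: norm_ell2_square assms norm_mult power_mult_distrib)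
  also have "\<dots> = h * (h * infsum (\<lambda>g. (cmod (w g))\<^sup>2) (grid h))"
    by (simp add: infsum_cmult_right' infsum_grid[OF assms(1)] power2_eq_square)
  finally have "norm f = sqrt (h * (h * infsum (\<lambda>g. (cmod (w g))\<^sup>2) (grid h)))"
    by (metis norm_ge_zero real_sqrt_unique)
  then show ?thesis by (simp add: L2_norm_def real_sqrt_mult)
qed

lemma discrete_laplacian_grid:
  assumes "0 < h" "\<And>k. seq f k = c * w (h * of_int k)"
  shows "seq (lapl f) k = complex_of_real h ^ 2 * (c * discrete_laplacian h w (h * of_int k))"
proof -
  have "h * of_int (k + 1) = h * of_int k + h" "h * of_int (k - 1) = h * of_int k - h"
    by (simp_all add: algebra_simps)
  then have "seq (lapl f) k = c * w (h * of_int k + h) + c * w (h * of_int k - h) - c * w (h * of_int k) - c * w (h * of_int k)"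
    by (simp add: lapl_def assms(2))
  then have "seq (lapl f) k = c * (w (h * of_int k + h) - 2 * w (h * of_int k) + w (h * of_int k - h))"
    by (simp add: algebra_simps)
  moreover have "complex_of_real h ^ 2 * (c * (x / complex_of_real h ^ 2)) = c * x" for x
    using assms(1) by simp
  ultimately show ?thesis
    by (simp only: discrete_laplacian_def)
qed

lemma seq_neg_lapl_power:
  assumes "0 < h" "\<And>k. seq f k = c * w (h * of_int k)"
  shows "seq (((\<lambda>f. - lapl f) ^^ n) f) k
    = complex_of_real h ^ (2 * n) * c * ((\<lambda>v g. - discrete_laplacian h v g) ^^ n) w (h * of_int k)"
proof (induction n arbitrary: k)
  case 0
  then show ?case by (simp add: assms)
next
  case (Suc n)
  show ?case
    using discrete_laplacian_grid[OF assms(1) Suc.IH, of k] by (simp add: power2_eq_square mult_ac)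
qed

lemma inner_neg_lapl_power: "inner (((\<lambda>f. - lapl f) ^^ n) f) f = (norm ((fdiff ^^ n) f))\<^sup>2"
proof -
  have "inner (((\<lambda>f. - lapl f) ^^ n) f) g = inner ((fdiff ^^ n) f) ((fdiff ^^ n) g)" for g
  proof -
    have "((\<lambda>f. - lapl f) ^^ n) f = 4 ^ n *\<^sub>R (xop ^^ n) f"
    proof (induction n)
      case (Suc n)
      have "- lapl g = 4 *\<^sub>R xop g" for g by (simp add: xop_def)
      moreover have "xop (a *\<^sub>R g) = a *\<^sub>R xop g" for a g by (simp add: xop_def)
      ultimately show ?case using Suc by simp
    qed simp
    then show ?thesis
      by (simp add: inner_xop_power power_divide)
  qed
  then show ?thesis by (simp add: power2_norm_eq_inner)
qed

text \<open>Exponent count: \<open>h\<close> from the weight of the inner product,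
  \<open>h^-2\<close> from the two factors \<open>h\<close> in \<open>to_ell2\<close> and
  \<open>h^(-2n)\<close> from the Laplacians; the norm takes the square root.\<close>

lemma Hdot_norm_embed:
  assumes "0 < h" "w \<in> L2 h"
  shows "Hdot_norm h n w = h powr (- (2 * real n + 1) / 2) * norm ((fdiff ^^ n) (to_ell2 h w))"
proof -
  let ?A = "((\<lambda>v g. - discrete_laplacian h v g) ^^ n) w"
  let ?f = "to_ell2 h w"
  let ?g = "((\<lambda>f. - lapl f) ^^ n) ?f"
  have g: "seq ?g k = complex_of_real h ^ (2 * n + 1) * ?A (h * of_int k)" for k
    using seq_neg_lapl_power[OF assms(1) seq_embed[OF assms], of n k] by simp
  have "complex_of_real h ^ (2 * n + 1) * L2_inner h ?A w = pair ?g (conj2 ?f)"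
  proof -
    have "pair ?g (conj2 ?f) = (\<Sum>\<^sub>\<infinity>k. complex_of_real h ^ (2 * n + 1) * complex_of_real h * (?A (h * of_int k) * cnj (w (h * of_int k))))"
      unfolding pair_def by (simp add: g seq_embed[OF assms] mult_ac)
    then show ?thesis
      by (simp add: L2_inner_def infsum_grid[OF assms(1)] infsum_cmult_right' mult.assoc)
  qed
  then have "Re (complex_of_real (h ^ (2 * n + 1)) * L2_inner h ?A w) = (norm ((fdiff ^^ n) ?f))\<^sup>2"
    unfolding inner_neg_lapl_power[symmetric] inner_ell2_def by simp
  then have "Re (L2_inner h ?A w) = h powr - (2 * real n + 1) * (norm ((fdiff ^^ n) ?f))\<^sup>2"
  proof -
    assume "Re (complex_of_real (h ^ (2 * n + 1)) * L2_inner h ?A w) = (norm ((fdiff ^^ n) ?f))\<^sup>2"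
    then have *: "h ^ (2 * n + 1) * Re (L2_inner h ?A w) = (norm ((fdiff ^^ n) ?f))\<^sup>2"
      by (simp only: Re_complex_of_real times_complex.sel Im_complex_of_real mult_zero_left diff_zero)
    have "- (2 * real n + 1) = - real (2 * n + 1)" by simp
    then have p: "h powr - (2 * real n + 1) = 1 / h ^ (2 * n + 1)"
      using assms(1) by (simp only: powr_minus powr_realpow inverse_eq_divide)
    have "x = 1 / a * (a * x)" if "a \<noteq> 0" for a x :: real
      using that by simp
    then show ?thesis
      unfolding p *[symmetric] by this (use assms(1) in simp)
  qed
  then have "Hdot_norm h n w = sqrt (h powr - (2 * real n + 1) * (norm ((fdiff ^^ n) ?f))\<^sup>2)"
    by (simp only: Hdot_norm_def)
  also have "\<dots> = sqrt (h powr - (2 * real n + 1)) * norm ((fdiff ^^ n) ?f)"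
    by (simp add: real_sqrt_mult)
  also have "sqrt (h powr - (2 * real n + 1)) = h powr (- (2 * real n + 1) / 2)"
    using assms(1) by (simp add: powr_half_sqrt_powr)
  finally show ?thesis .
qed

text \<open>Both summands scale alike: \<open>-3/2\<close> is the exponent for \<open>n = 1\<close>,
  and the cube of the \<open>h powr (-1/2)\<close> of the \<open>L2\<close> norm.\<close>

lemma M_const_embed:
  assumes "0 < h" "w \<in> L2 h"
  shows "M_const h w = h powr (- 3 / 2) * Mz (to_ell2 h w)"
proof -
  have "norm (to_ell2 h w) = h powr (1 / 2) * L2_norm h w"
    using norm_eq_L2_norm[OF assms(1) seq_embed[OF assms]] assms(1) by (simp add: powr_half_sqrt)
  then have "L2_norm h w = h powr (- 1 / 2) * norm (to_ell2 h w)"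
    using assms(1) by (simp add: mult.assoc[symmetric] flip: powr_add)
  then have "L2_norm h w ^ 3 = h powr (- 3 / 2) * norm (to_ell2 h w) ^ 3"
    using assms(1) by (simp add: power_mult_distrib powr_power)
  then show ?thesis
    using Hdot_norm_embed[OF assms, of 1] by (simp add: M_const_def Mz_def distrib_left)
qed

lemma embed_has_vector_derivative:
  assumes h: "0 < h" and L2: "\<And>s. u s \<in> L2 h" "w \<in> L2 h" and d: "has_L2_derivative h u w t"
  shows "((\<lambda>s. to_ell2 h (u s)) has_vector_derivative to_ell2 h w) (at t)"
proof -
  let ?U = "\<lambda>s. to_ell2 h (u s)"
  have eq: "norm (?U s - ?U t - (s - t) *\<^sub>R to_ell2 h w) / norm (s - t)
      = sqrt h * L2_norm h (\<lambda>g. (u s g - u t g) /\<^sub>R (s - t) - w g)" if "s \<noteq> t" for s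
  proof -
    let ?f = "(?U s - ?U t) /\<^sub>R (s - t) - to_ell2 h w"
    have "?U s - ?U t - (s - t) *\<^sub>R to_ell2 h w = (s - t) *\<^sub>R ?f"
      using that by (simp add: scaleR_diff_right)
    then have "norm (?U s - ?U t - (s - t) *\<^sub>R to_ell2 h w) / norm (s - t) = norm ?f"
      using that by simp
    also have "\<dots> = sqrt h * L2_norm h (\<lambda>g. (u s g - u t g) /\<^sub>R (s - t) - w g)"
      by (rule norm_eq_L2_norm[OF h]) (simp add: seq_embed[OF h L2(1)] seq_embed[OF h L2(2)] scaleR_conv_of_real algebra_simps)
    finally show ?thesis .
  qed
  have "((\<lambda>s. sqrt h * L2_norm h (\<lambda>g. (u s g - u t g) /\<^sub>R (s - t) - w g)) \<longlongrightarrow> sqrt h * 0) (at t)"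
    using d unfolding has_L2_derivative_def by (intro tendsto_intros)
  then have "((\<lambda>s. norm (?U s - ?U t - (s - t) *\<^sub>R to_ell2 h w) / norm (s - t)) \<longlongrightarrow> 0) (at t)"
    using tendsto_cong[of "\<lambda>s. norm (?U s - ?U t - (s - t) *\<^sub>R to_ell2 h w) / norm (s - t)"
        "\<lambda>s. sqrt h * L2_norm h (\<lambda>g. (u s g - u t g) /\<^sub>R (s - t) - w g)" "at t" 0] eq
    by (simp add: eventually_at_filter)
  then show ?thesis
    unfolding has_vector_derivative_def has_derivative_iff_norm by (simp add: bounded_linear_scaleR_left)
qed

text \<open>All terms acquire \<open>h^3\<close>: the time derivative as \<open>h^2\<close> from
  time and \<open>h\<close> from amplitude, the Laplacian as \<open>h^2\<close> and
  \<open>h\<close>, the cubic term from three amplitudes.\<close>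

lemma dnls_embed:
  assumes h: "0 < h" and nu: "\<nu> \<in> {-1, 1}" and u: "u \<in> C1_L2 h" "DNLS_solution h \<nu> u"
  shows "dnls \<nu> (\<lambda>t. to_ell2 h (u (h\<^sup>2 * t)))"
proof
  show "\<nu> = 1 \<or> \<nu> = - 1" using nu by auto
  fix t
  define T where "T = h\<^sup>2 * t"
  have L2: "u s \<in> L2 h" for s using u(1) by (simp add: C1_L2_def)
  obtain u' where u': "\<And>s. u' s \<in> L2 h" "\<And>s. has_L2_derivative h u (u' s) s"
    using u(1) by (auto simp: C1_L2_def)
  define V where "V = to_ell2 h (u T)"
  have d: "((\<lambda>s. to_ell2 h (u s)) has_vector_derivative to_ell2 h (u' T)) (at T)"
    by (rule embed_has_vector_derivative[OF h L2 u'])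
  have "((\<lambda>t. h\<^sup>2 * t) has_vector_derivative h\<^sup>2) (at t)"
    by (auto intro!: derivative_eq_intros simp flip: has_real_derivative_iff_has_vector_derivative)
  then have "(((\<lambda>s. to_ell2 h (u s)) \<circ> (\<lambda>t. h\<^sup>2 * t)) has_vector_derivative h\<^sup>2 *\<^sub>R to_ell2 h (u' T)) (at t)"
    by (rule vector_diff_chain_at) (use d in \<open>simp add: T_def\<close>)
  moreover have "h\<^sup>2 *\<^sub>R to_ell2 h (u' T) = cmul (- \<i>) (lapl V + \<nu> *\<^sub>R cubic V)"
  proof (rule ell2_eqI)
    fix k
    let ?g = "h * of_int k"
    \<comment> \<open>Evaluation at a lattice point is a bounded linear map, so the derivative in
      norm is also the pointwise one that occurs in \<open>DNLS_solution\<close>.\<close>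
    have "((\<lambda>s. seq (to_ell2 h (u s)) k) has_vector_derivative seq (to_ell2 h (u' T)) k) (at T)"
      by (rule bounded_linear.has_vector_derivative[OF bounded_linear_seq d])
    then have "((\<lambda>s. complex_of_real h * u s ?g) has_vector_derivative complex_of_real h * u' T ?g) (at T)"
      by (simp add: seq_embed[OF h L2] seq_embed[OF h u'(1)])
    then have "((\<lambda>s. (1 / complex_of_real h) * (complex_of_real h * u s ?g)) has_vector_derivative
        (1 / complex_of_real h) * (complex_of_real h * u' T ?g)) (at T)"
      by (rule has_vector_derivative_mult_right)
    then have "((\<lambda>s. u s ?g) has_vector_derivative u' T ?g) (at T)"
      using h by simp
    then have vd: "vector_derivative (\<lambda>s. u s ?g) (at T) = u' T ?g"
      by (rule vector_derivative_at)
    have "?g \<in> grid h" unfolding grid_def by (rule rangeI)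
    then have eq: "\<i> * u' T ?g = discrete_laplacian h (u T) ?g
        + complex_of_real \<nu> * (complex_of_real (cmod (u T ?g)))\<^sup>2 * u T ?g"
      using u(2) by (simp add: DNLS_solution_def flip: vd)
    have "u' T ?g = - \<i> * (\<i> * u' T ?g)" by simp
    then have "seq (h\<^sup>2 *\<^sub>R to_ell2 h (u' T)) k = - \<i> * (complex_of_real h ^ 3 * (\<i> * u' T ?g))"
      by (simp add: seq_embed[OF h u'(1)] power2_eq_square power3_eq_cube mult_ac)
    also have "\<dots> = - \<i> * (complex_of_real h ^ 2 * (complex_of_real h * discrete_laplacian h (u T) ?g)
        + complex_of_real \<nu> * (complex_of_real h ^ 3 * ((complex_of_real (cmod (u T ?g)))\<^sup>2 * u T ?g)))"
      unfolding eq by (simp add: power2_eq_square power3_eq_cube algebra_simps)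
    also have "complex_of_real h ^ 2 * (complex_of_real h * discrete_laplacian h (u T) ?g) = seq (lapl V) k"
      by (rule discrete_laplacian_grid[OF h, symmetric]) (simp add: V_def seq_embed[OF h L2])
    also have "complex_of_real h ^ 3 * ((complex_of_real (cmod (u T ?g)))\<^sup>2 * u T ?g) = seq (cubic V) k"
      unfolding of_real_power[symmetric] complex_norm_square by (simp add: cubic_def V_def seq_embed[OF h L2] power3_eq_cube mult_ac)
    finally show "seq (h\<^sup>2 *\<^sub>R to_ell2 h (u' T)) k = seq (cmul (- \<i>) (lapl V + \<nu> *\<^sub>R cubic V)) k"
      by simp
  qed
  ultimately show "((\<lambda>t. to_ell2 h (u (h\<^sup>2 * t))) has_vector_derivative
      cmul (- \<i>) (lapl (to_ell2 h (u (h\<^sup>2 * t))) + \<nu> *\<^sub>R cubic (to_ell2 h (u (h\<^sup>2 * t))))) (at t)"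
    by (simp add: o_def V_def T_def)
qed

section \<open>Return to the lattice of spacing h\<close>

theorem theorem1p1:
  fixes n :: nat
  assumes "n \<ge> 1"
  shows "\<exists>C>0. \<forall>h>0. \<forall>\<nu>\<in>{-1, 1}. \<forall>u.
    u \<in> C1_L2 h \<and> DNLS_solution h \<nu> u \<longrightarrow>
    (\<forall>t. Hdot_norm h n (u t) \<le>
       C * (Hdot_norm h n (u 0)
            + M_const h (u 0) powr ((2 * real n + 1) / 3)
            + time_growth n t * M_const h (u 0) powr ((4 * real n - 1) / 3)))"
proof -
  obtain C where C: "0 < C" and growth: "\<And>\<nu> v t. dnls \<nu> v \<Longrightarrow> norm ((fdiff ^^ n) (v t)) \<le>
    C * (norm ((fdiff ^^ n) (v 0)) + Mz (v 0) powr ((2 * real n + 1) / 3)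
      + time_growth n t * Mz (v 0) powr ((4 * real n - 1) / 3))"
    using dnls_growth[OF assms] by metis
  show ?thesis
  proof (intro exI[of _ C] conjI allI impI ballI)
    fix h \<nu> :: real and u t
    assume h: "0 < h" and nu: "\<nu> \<in> {-1, 1}" and u: "u \<in> C1_L2 h \<and> DNLS_solution h \<nu> u"
    define v where "v t = to_ell2 h (u (h\<^sup>2 * t))" for t
    define s where "s = h powr (- (2 * real n + 1) / 2)"
    define M where "M = Mz (v 0)"
    have L2: "u t \<in> L2 h" for t using u by (simp add: C1_L2_def)
    have "dnls \<nu> v" unfolding v_def[abs_def] using dnls_embed[OF h nu] u by blast
    from growth[OF this, of "t / h\<^sup>2"]
    have g: "norm ((fdiff ^^ n) (v (t / h\<^sup>2))) \<le> C * (norm ((fdiff ^^ n) (v 0)) + M powr ((2 * real n + 1) / 3)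
      + time_growth n (t / h\<^sup>2) * M powr ((4 * real n - 1) / 3))"
      by (simp only: M_def)
    have vt: "v (t / h\<^sup>2) = to_ell2 h (u t)" and v0: "v 0 = to_ell2 h (u 0)" using h by (simp_all add: v_def)
    have H: "Hdot_norm h n (u t) = s * norm ((fdiff ^^ n) (v (t / h\<^sup>2)))" "Hdot_norm h n (u 0) = s * norm ((fdiff ^^ n) (v 0))"
      unfolding s_def vt v0 by (rule Hdot_norm_embed[OF h L2])+
    have Mc: "M_const h (u 0) = h powr (- 3 / 2) * M"
      unfolding M_def v0 by (rule M_const_embed[OF h L2])
    have M0: "0 \<le> M" by (simp add: M_def Mz_nonneg)
    have Mp: "M_const h (u 0) powr p = h powr (- 3 / 2 * p) * M powr p" for p
      unfolding Mc using M0 h by (simp add: powr_mult powr_powr)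
    have 1: "s * M powr ((2 * real n + 1) / 3) = M_const h (u 0) powr ((2 * real n + 1) / 3)"
    proof -
      have "- 3 / 2 * ((2 * real n + 1) / 3) = - (2 * real n + 1) / 2"
        by (simp add: field_simps)
      then show ?thesis unfolding Mp s_def by (simp only:)
    qed
    have 2: "s * (time_growth n (t / h\<^sup>2) * M powr ((4 * real n - 1) / 3))
        = time_growth n t * M_const h (u 0) powr ((4 * real n - 1) / 3)"
    proof -
      \<comment> \<open>The second power of \<open>M\<close> scales with an extra
        \<open>h powr - (real n - 1)\<close>, which is exactly the change of
        \<open>time_growth\<close> under \<open>t / h\<^sup>2\<close>.\<close>
      have e: "- 3 / 2 * ((4 * real n - 1) / 3) = - (2 * real n + 1) / 2 + - (real n - 1)"
        by (simp add: field_simps)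
      have "time_growth n (t / h\<^sup>2) = h powr - (real n - 1) * time_growth n t"
      proof (cases "n = 1")
        case False
        have "(h\<^sup>2) powr ((real n - 1) / 2) = h powr (real n - 1)"
        proof -
          have "h\<^sup>2 = h powr 2" using h by simp
          then have "(h\<^sup>2) powr ((real n - 1) / 2) = h powr (2 * ((real n - 1) / 2))"
            by (simp only: powr_powr)
          also have "2 * ((real n - 1) / 2) = real n - 1" by simp
          finally show ?thesis .
        qed
        then show ?thesis
          unfolding powr_minus using False h by (simp add: time_growth_def powr_divide) (simp add: field_simps)
      qed (use h in \<open>simp add: time_growth_def\<close>)
      then show ?thesis
        unfolding Mp e s_def powr_add by (simp only: mult_ac)
    qed
    have "Hdot_norm h n (u t) \<le> s * (C * (norm ((fdiff ^^ n) (v 0)) + M powr ((2 * real n + 1) / 3)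
      + time_growth n (t / h\<^sup>2) * M powr ((4 * real n - 1) / 3)))"
      unfolding H using g by (intro mult_left_mono) (simp_all add: s_def)
    also have "\<dots> = C * (s * norm ((fdiff ^^ n) (v 0)) + s * M powr ((2 * real n + 1) / 3)
      + s * (time_growth n (t / h\<^sup>2) * M powr ((4 * real n - 1) / 3)))"
      by (simp add: algebra_simps)
    finally show "Hdot_norm h n (u t) \<le> C * (Hdot_norm h n (u 0) + M_const h (u 0) powr ((2 * real n + 1) / 3)
        + time_growth n t * M_const h (u 0) powr ((4 * real n - 1) / 3))"
      unfolding 1 2 H(2) .
  qed (rule C)
qed

end
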